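(* Let $S,K\subset\mathbb{R}$ be nonempty open bounded intervals and let $h>0$. Let $\mathbf{e}\in L^2(S,\mathbb{R}^2)$ and $M\ge 0$. The problem of finding $\phi_o\in W_0^{1,2}(K)$ with $\|\phi_o\|_{W_0^{1,2}(K)}\le M$ such that $$\|b_2^*[\phi_o]-\mathbf{e}\|_{L^2(S,\mathbb{R}^2)}=\min_{\phi\in W_0^{1,2}(K),\ \|\phi\|_{W_0^{1,2}(K)}\le M}\|b_2^*[\phi]-\mathbf{e}\|_{L^2(S,\mathbb{R}^2)}$$ admits a unique solution $\phi_o\in W_0^{1,2}(K)$. If $\mathbf{e}\notin b_2^*[W_0^{1,2}(K)]$, then $\|\phi_o\|_{W_0^{1,2}(K)}=M$.
   Context: All $L^2(K)$ functions are real-valued, and $L^2(S,\mathbb{R}^2)$ carries the inner product $\langle (f_1,f_2),(g_1,g_2)\rangle=\langle f_1,g_1\rangle_{L^2(S)}+\langle f_2,g_2\rangle_{L^2(S)}$. $W_0^{1,2}(K)$ is the space of real-valued $\phi\in L^2(K)$ with distributional derivative $\phi'\in L^2(K)$ and $\phi=0$ at the endpoints of $K$, equipped with the norm $\|\phi\|_{W_0^{1,2}(K)}=\|\phi'\|_{L^2(K)}$. For a bounded interval $I$ and $f\in L^2(I)$, $\widetilde f\in L^2(\mathbb{R})$ denotes the extension of $f$ by $0$ outside $I$. For $y>0$, $x\in\mathbb{R}$, $P_y(x)=\frac{1}{\pi}\frac{y}{x^2+y^2}$ and $Q_y(x)=\frac{1}{\pi}\frac{x}{x^2+y^2}$; $\star$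 is convolution in $x\in\mathbb{R}$. The operator $b_2^*:L^2(K)\to L^2(S,\mathbb{R}^2)$ is $b_2^*[\phi]=\left(\partial_x(P_h\star\widetilde\phi)_{|S},\ \partial_x(Q_h\star\widetilde\phi)_{|S}\right)$; it is applied here to functions of $W_0^{1,2}(K)\subset L^2(K)$. *)

theory Defs
  imports "HOL-Analysis.Analysis"
begin

text \<open>Elements of \<open>L\<^sup>2(S)\<close> are represented by functions on the whole real line; only their
  restriction to \<open>S\<close> matters, and equality in \<open>L\<^sup>2(S)\<close> is equality almost everywhere on \<open>S\<close>
  (\<open>eq_L2\<close>). The target type is \<open>real\<close> or \<open>real \<times> real\<close>; in the latter case
  the library's inner product of pairs makes \<open>L2_inner\<close> the sum of the inner products of the two
  components.\<close>

definition L2 :: "real set \<Rightarrow> (real \<Rightarrow> 'a::euclidean_space) set" where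
  "L2 S = {f \<in> borel_measurable (lebesgue_on S). integrable (lebesgue_on S) (\<lambda>x. (norm (f x))\<^sup>2)}"

definition eq_L2 :: "real set \<Rightarrow> (real \<Rightarrow> 'a::euclidean_space) \<Rightarrow> (real \<Rightarrow> 'a) \<Rightarrow> bool" where
  "eq_L2 S f g \<longleftrightarrow> (AE x in lebesgue_on S. f x = g x)"

definition L2_inner :: "real set \<Rightarrow> (real \<Rightarrow> 'a::euclidean_space) \<Rightarrow> (real \<Rightarrow> 'a) \<Rightarrow> real" where
  "L2_inner S f g = (LINT x|lebesgue_on S. f x \<bullet> g x)"

definition L2_norm :: "real set \<Rightarrow> (real \<Rightarrow> 'a::euclidean_space) \<Rightarrow> real" where
  "L2_norm S f = sqrt (L2_inner S f f)"

definition test_functions :: "real set \<Rightarrow> (real \<Rightarrow> real) set" where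
  "test_functions K = {\<psi>. (\<forall>n x. ((deriv ^^ n) \<psi>) differentiable (at x)) \<and>
     compact (closure {x. \<psi> x \<noteq> 0}) \<and> closure {x. \<psi> x \<noteq> 0} \<subseteq> K}"

text \<open>\<open>g\<close> is the distributional derivative of \<open>f\<close> on \<open>K\<close>, and \<open>g\<close> lies in \<open>L\<^sup>2(K)\<close>.\<close>

definition has_L2_weak_deriv :: "real set \<Rightarrow> (real \<Rightarrow> real) \<Rightarrow> (real \<Rightarrow> real) \<Rightarrow> bool" where
  "has_L2_weak_deriv K f g \<longleftrightarrow> g \<in> L2 K \<and>
     (\<forall>\<psi>\<in>test_functions K.
        (LINT x|lebesgue_on K. f x * deriv \<psi> x) = - (LINT x|lebesgue_on K. g x * \<psi> x))"

text \<open>The distributional derivative is unique up to almost everywhere equality, so the choice of a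
  representative is immaterial.\<close>

definition weak_deriv :: "real set \<Rightarrow> (real \<Rightarrow> real) \<Rightarrow> (real \<Rightarrow> real)" where
  "weak_deriv K f = (SOME g. has_L2_weak_deriv K f g)"

text \<open>Vanishing at the endpoints refers, as usual, to the representative of \<open>\<phi>\<close> that is
  continuous up to the boundary.\<close>

definition W012 :: "real set \<Rightarrow> (real \<Rightarrow> real) set" where
  "W012 K = {\<phi> \<in> L2 K. (\<exists>g. has_L2_weak_deriv K \<phi> g) \<and>
     (\<exists>u. continuous_on (closure K) u \<and> eq_L2 K \<phi> u \<and> (\<forall>x\<in>frontier K. u x = 0))}"

definition W012_norm :: "real set \<Rightarrow> (real \<Rightarrow> real) \<Rightarrow> real" where
  "W012_norm K \<phi> = L2_norm K (weak_deriv K \<phi>)"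

definition zero_ext :: "real set \<Rightarrow> (real \<Rightarrow> real) \<Rightarrow> (real \<Rightarrow> real)" where
  "zero_ext I f = (\<lambda>x. if x \<in> I then f x else 0)"

definition poisson :: "real \<Rightarrow> real \<Rightarrow> real" where
  "poisson y x = 1 / pi * (y / (x\<^sup>2 + y\<^sup>2))"

definition conj_poisson :: "real \<Rightarrow> real \<Rightarrow> real" where
  "conj_poisson y x = 1 / pi * (x / (x\<^sup>2 + y\<^sup>2))"

definition conv_R :: "(real \<Rightarrow> real) \<Rightarrow> (real \<Rightarrow> real) \<Rightarrow> (real \<Rightarrow> real)" where
  "conv_R f g x = (LINT t|lebesgue. f (x - t) * g t)"

text \<open>The operator \<open>b\<^sub>2\<^sup>*\<close>. The restriction of the result to \<open>S\<close> is left to the \<open>L\<^sup>2(S)\<close>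
  notions it is fed to.\<close>

definition b2_star :: "real \<Rightarrow> real set \<Rightarrow> (real \<Rightarrow> real) \<Rightarrow> (real \<Rightarrow> real \<times> real)" where
  "b2_star h K \<phi> = (\<lambda>x. (deriv (conv_R (poisson h) (zero_ext K \<phi>)) x, deriv (conv_R (conj_poisson h) (zero_ext K \<phi>)) x))"

definition is_solution ::
  "real set \<Rightarrow> real set \<Rightarrow> real \<Rightarrow> (real \<Rightarrow> real \<times> real) \<Rightarrow> real \<Rightarrow> (real \<Rightarrow> real) \<Rightarrow> bool" where
  "is_solution S K h e M \<phi>\<^sub>o \<longleftrightarrow>
     \<phi>\<^sub>o \<in> W012 K \<and> W012_norm K \<phi>\<^sub>o \<le> M \<and>
     (\<forall>\<phi>\<in>W012 K. W012_norm K \<phi> \<le> M \<longrightarrow>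
        L2_norm S (\<lambda>x. b2_star h K \<phi>\<^sub>o x - e x) \<le> L2_norm S (\<lambda>x. b2_star h K \<phi> x - e x))"

end

theory Submission
  imports Defs "HOL-Complex_Analysis.Complex_Analysis"
begin

text \<open>Existence is a direct argument in the Hilbert space \<open>W\<^sub>0\<^sup>1\<^sup>,\<^sup>2(K)\<close> without weak compactness: among nearly
  optimal admissible functions choose those of nearly minimal norm; by the parallelogram identity and
  convexity of the misfit they form a Cauchy sequence. The operator \<open>b\<^sub>2\<^sup>*\<close> is read off from the
  Cauchy transform \<open>F(z) = \<integral> \<phi>(t) / (t - z) dt\<close>: up to the factor \<open>1 / \<pi>\<close> and a sign its two components are
  \<open>Im F'(x + ih)\<close> and \<open>Re F'(x + ih)\<close>. If \<open>F'\<close> vanishes on \<open>S + ih\<close>, then by the identity theorem \<open>F\<close> is constant off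
  the support, hence zero, so that all moments of \<open>\<phi>\<close> vanish and \<open>\<phi> = 0\<close>. This injectivity gives uniqueness,
  since two minimizers have the same image. A minimizer with norm less than \<open>M\<close> is a critical point of the unconstrained
  misfit, so the residual is orthogonal to the range of \<open>b\<^sub>2\<^sup>*\<close>; the range is dense, because for an orthogonal
  density a reflection across the real line extends its transform to an entire function vanishing at infinity.\<close>

text \<open>A minimizing sequence for the misfit alone need not converge: \<open>b2_star\<close>
  smooths, so functions far apart in the Sobolev norm can have nearly equal images. The squared norm
  is uniformly convex, and the choice of nearly shortest elements passes this convexity on to the
  sequence. For the misfit itself L1 convergence of the functions is enough, because the kernels are
  bounded at height \<open>h\<close> above the real line. The norm is built on a representative
  picked by \<open>SOME\<close>, so it can be computed only once weak derivatives are known to be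
  unique. One increment formula, \<open>weak_deriv_increment\<close>, yields this uniqueness and the
  sup bound behind completeness; applied to the zero function, uniqueness also serves as the
  fundamental lemma of the calculus of variations. The pairing on pairs of functions is real. Coding
  a pair as one complex density therefore turns orthogonality into the vanishing of only the real
  part of a transform on an interval. Twice this real part is the transform plus its conjugate
  reflection, which is holomorphic on a common strip, and there the identity theorem
  applies.\<close>

section \<open>Minimization and square-integrable functions\<close>

text \<open>The roles: \<open>J\<close> is the misfit, \<open>N\<close> the squared norm, \<open>D\<close> the squared distance belonging to \<open>N\<close>.\<close>

lemma midpoint_minimizer_exists:
  fixes N J :: "'a \<Rightarrow> real" and D :: "'a \<Rightarrow> 'a \<Rightarrow> real" and mid :: "'a \<Rightarrow> 'a \<Rightarrow> 'a"
  assumes ne: "F \<noteq> {}"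
    and mid: "\<And>x y. x \<in> F \<Longrightarrow> y \<in> F \<Longrightarrow> mid x y \<in> F"
    and N0: "\<And>x. x \<in> F \<Longrightarrow> 0 \<le> N x" and J0: "\<And>x. x \<in> F \<Longrightarrow> 0 \<le> J x"
    and Nmid: "\<And>x y. x \<in> F \<Longrightarrow> y \<in> F \<Longrightarrow> N (mid x y) \<le> (N x + N y) / 2 - D x y / 4"
    and Jmid: "\<And>x y. x \<in> F \<Longrightarrow> y \<in> F \<Longrightarrow> J (mid x y) \<le> (J x + J y) / 2"
    and bnd: "\<And>x. x \<in> F \<Longrightarrow> N x \<le> B"
    and complete: "\<And>X. (\<And>n. X n \<in> F) \<Longrightarrow>
       (\<And>\<epsilon>. \<epsilon> > 0 \<Longrightarrow> \<exists>n0. \<forall>m\<ge>n0. \<forall>n\<ge>n0. D (X m) (X n) < \<epsilon>) \<Longrightarrow>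
       \<exists>x\<in>F. (\<lambda>n. J (X n)) \<longlonglongrightarrow> J x"
  shows "\<exists>x\<in>F. \<forall>y\<in>F. J x \<le> J y"
proof -
  define m where "m = Inf (J ` F)"
  have bJ: "bdd_below (J ` F)" using J0 by (auto intro!: bdd_belowI)
  have mle: "m \<le> J y" if "y \<in> F" for y
    unfolding m_def by (rule cINF_lower[OF bJ that])
  define C where "C n = {x \<in> F. J x \<le> m + 1 / Suc n}" for n :: nat
  have Cne: "C n \<noteq> {}" for n
  proof -
    have "Inf (J ` F) < m + 1 / Suc n" by (simp add: m_def)
    then show ?thesis
      using cInf_lessD[of "J ` F" "m + 1 / Suc n"] ne by (force simp: C_def)
  qed
  \<comment> \<open>The sets \<open>C n\<close> shrink, so these infima increase; \<open>bnd\<close>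
    keeps them bounded, hence they converge. This convergence is the source of the Cauchy property
    of the points chosen below.\<close>
  define d where "d n = Inf (N ` C n)" for n
  have bN: "bdd_below (N ` C n)" for n using N0 by (auto intro!: bdd_belowI simp: C_def)
  have dle: "d n \<le> N y" if "y \<in> C n" for n y
    unfolding d_def by (rule cINF_lower[OF bN that])
  have Cmono: "C n \<subseteq> C k" if "k \<le> n" for n k
  proof -
    have "1 / real (Suc n) \<le> 1 / real (Suc k)" using that by (simp add: frac_le)
    then show ?thesis by (auto simp: C_def)
  qed
  have dmono: "d k \<le> d n" if "k \<le> n" for n k
    unfolding d_def by (rule cINF_superset_mono[OF Cne bN Cmono[OF that]]) auto
  have dB: "d n \<le> B" for n
    using Cne[of n] dle[of _ n] bnd by (force simp: C_def)
  have "incseq d" using dmono by (simp add: incseq_def)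
  then have "convergent d"
    using dB by (metis (no_types) incseq_convergent convergent_def)
  then have Cauchy_d: "Cauchy d" by (rule convergent_Cauchy)
  have "\<exists>x\<in>C n. N x < d n + 1 / Suc n" for n
  proof -
    have "Inf (N ` C n) < d n + 1 / Suc n" by (simp add: d_def)
    then show ?thesis using cInf_lessD[of "N ` C n"] Cne by force
  qed
  then obtain X where XC: "\<And>n. X n \<in> C n" and XN: "\<And>n. N (X n) < d n + 1 / Suc n" by metis
  have XF: "X n \<in> F" for n using XC[of n] by (simp add: C_def)
  have XJ: "J (X n) \<le> m + 1 / Suc n" for n using XC[of n] by (simp add: C_def)
  \<comment> \<open>Both points lie in \<open>C k\<close>, and so does their midpoint because
    \<open>J\<close> is midpoint convex. Its squared norm is thus at least \<open>d k\<close>, and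
    \<open>Nmid\<close> can be solved for the distance.\<close>
  have key: "D (X p) (X n) \<le> 2 * (d p - d k) + 2 * (d n - d k) + 4 * (1 / Suc k)"
    if "k \<le> p" "k \<le> n" for k p n
  proof -
    have in_k: "X p \<in> C k" "X n \<in> C k" using XC Cmono that by blast+
    have "mid (X p) (X n) \<in> C k"
      using in_k mid Jmid[of "X p" "X n"] by (auto simp: C_def)
    from dle[OF this] have "d k \<le> (N (X p) + N (X n)) / 2 - D (X p) (X n) / 4"
      using Nmid[OF XF XF, of p n] by linarith
    moreover have "1 / real (Suc p) \<le> 1 / real (Suc k)" "1 / real (Suc n) \<le> 1 / real (Suc k)"
      using that by (simp_all add: frac_le)
    moreover define ek ep en where "ek = 1 / real (Suc k)" and "ep = 1 / real (Suc p)" and "en = 1 / real (Suc n)"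
    ultimately have "d k \<le> (N (X p) + N (X n)) / 2 - D (X p) (X n) / 4" "ep \<le> ek" "en \<le> ek"
      "N (X p) < d p + ep" "N (X n) < d n + en"
      using XN[of p] XN[of n] by simp_all
    then have "D (X p) (X n) \<le> 2 * (d p - d k) + 2 * (d n - d k) + 4 * ek" by argo
    then show ?thesis by (simp add: ek_def)
  qed
  have "\<exists>n0. \<forall>p\<ge>n0. \<forall>n\<ge>n0. D (X p) (X n) < \<epsilon>" if "\<epsilon> > 0" for \<epsilon>
  proof -
    \<comment> \<open>The coefficients 2, 2 and 4 of the three small terms in \<open>key\<close> add
      up to 8.\<close>
    have "\<epsilon> / 8 > 0" using that by simp
    from metric_CauchyD[OF Cauchy_d this]
    obtain n1 where n1: "\<forall>p\<ge>n1. \<forall>n\<ge>n1. dist (d p) (d n) < \<epsilon> / 8"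
      by blast
    obtain n2 where n2: "1 / real (Suc n2) < \<epsilon> / 8" using nat_approx_posE[OF \<open>\<epsilon> / 8 > 0\<close>] by blast
    define k where "k = max n1 n2"
    have "1 / real (Suc k) \<le> 1 / real (Suc n2)" by (simp add: frac_le k_def)
    then have "1 / real (Suc k) < \<epsilon> / 8" using n2 by linarith
    then have "D (X p) (X n) < \<epsilon>" if "p \<ge> k" "n \<ge> k" for p n
    proof -
      have "\<bar>d p - d k\<bar> < \<epsilon> / 8" "\<bar>d n - d k\<bar> < \<epsilon> / 8"
        using n1 that unfolding k_def dist_real_def by auto
      moreover define ek where "ek = 1 / real (Suc k)"
      ultimately show ?thesis
        using key[OF that] \<open>1 / real (Suc k) < \<epsilon> / 8\<close> unfolding ek_def[symmetric] by argo
    qed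
    then show ?thesis by blast
  qed
  from complete[OF XF this] obtain x where x: "x \<in> F" "(\<lambda>n. J (X n)) \<longlonglongrightarrow> J x" by auto
  have "(\<lambda>n. m + 1 / real (Suc n)) \<longlonglongrightarrow> m + 0"
    by (intro tendsto_intros LIMSEQ_Suc[OF lim_1_over_n])
  then have "J x \<le> m + 0" by (rule LIMSEQ_le[OF x(2)]) (use XJ in auto)
  then show ?thesis using x(1) mle by force
qed

section \<open>Square-integrable functions on a finite measure space\<close>

lemma integrable_mult_of_squares:
  fixes f g :: "'a \<Rightarrow> real"
  assumes [measurable]: "f \<in> borel_measurable M" "g \<in> borel_measurable M"
    and "integrable M (\<lambda>x. (f x)\<^sup>2)" "integrable M (\<lambda>x. (g x)\<^sup>2)"
  shows "integrable M (\<lambda>x. f x * g x)"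
proof (rule Bochner_Integration.integrable_bound[of _ "\<lambda>x. (f x)\<^sup>2 + (g x)\<^sup>2"])
  have "2 * \<bar>f x * g x\<bar> \<le> (f x)\<^sup>2 + (g x)\<^sup>2" for x
    using sum_squares_bound[of "\<bar>f x\<bar>" "\<bar>g x\<bar>"] by (simp add: abs_mult)
  then show "AE x in M. norm (f x * g x) \<le> norm ((f x)\<^sup>2 + (g x)\<^sup>2)"
    by (auto intro!: AE_I2) (smt (verit) abs_ge_zero)
qed (use assms in auto)

context finite_measure
begin

lemma integrable_of_square:
  fixes f :: "'a \<Rightarrow> real"
  assumes "f \<in> borel_measurable M" "integrable M (\<lambda>x. (f x)\<^sup>2)"
  shows "integrable M f"
  using integrable_mult_of_squares[of f M "\<lambda>_. 1"] assms by simp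

text \<open>Cauchy-Schwarz against the constant 1. The quadratic \<open>quad\<close> is nonnegative
  for every \<open>t\<close>; at its minimizer \<open>I / m\<close> it gives
  \<open>I\<^sup>2 \<le> m * Q\<close>. For \<open>m = 0\<close> it is affine in \<open>t\<close>,
  and nonnegativity forces \<open>I = 0\<close>.\<close>

lemma integral_abs_le_sqrt:
  fixes f :: "'a \<Rightarrow> real"
  assumes f: "f \<in> borel_measurable M" "integrable M (\<lambda>x. (f x)\<^sup>2)"
  shows "(LINT x|M. \<bar>f x\<bar>) \<le> sqrt (measure M (space M)) * sqrt (LINT x|M. (f x)\<^sup>2)"
proof -
  define I Q m where "I = (LINT x|M. \<bar>f x\<bar>)" "Q = (LINT x|M. (f x)\<^sup>2)" "m = measure M (space M)"
  have int: "integrable M f" by (rule integrable_of_square[OF f])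
  have quad: "0 \<le> Q - 2 * t * I + t\<^sup>2 * m" for t
  proof -
    have "0 \<le> (LINT x|M. (\<bar>f x\<bar> - t)\<^sup>2)" by simp
    also have "\<dots> = (LINT x|M. (f x)\<^sup>2 - 2 * t * \<bar>f x\<bar> + t\<^sup>2)"
      by (simp add: power2_diff algebra_simps)
    also have "\<dots> = Q - 2 * t * I + t\<^sup>2 * m"
      using f int by (simp add: I_Q_m_def)
    finally show ?thesis .
  qed
  have I0: "I \<ge> 0" "m \<ge> 0" by (simp_all add: I_Q_m_def)
  have "I\<^sup>2 \<le> m * Q"
  proof (cases "m = 0")
    case True
    have "I = 0"
    proof (rule ccontr)
      assume "I \<noteq> 0"
      then show False using quad[of "(Q + 1) / (2 * I)"] True by (simp add: field_simps)
    qed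
    then show ?thesis using True by simp
  next
    case False
    then show ?thesis using quad[of "I / m"] I0 by (simp add: field_simps power2_eq_square)
  qed
  then have "sqrt (I\<^sup>2) \<le> sqrt (m * Q)" by (rule real_sqrt_le_mono)
  then show ?thesis using I0 by (simp add: real_sqrt_mult I_Q_m_def)
qed

text \<open>The Riesz-Fischer theorem. Along a fast subsequence the increments are summable in L1,
  which gives a pointwise limit almost everywhere; Fatou's lemma turns the Cauchy condition into
  convergence of the whole sequence to it.\<close>

lemma L2_Cauchy_has_limit:
  fixes f :: "nat \<Rightarrow> 'a \<Rightarrow> real"
  assumes meas[measurable]: "\<And>n. f n \<in> borel_measurable M" and sq: "\<And>n. integrable M (\<lambda>x. (f n x)\<^sup>2)"
    and Cauchy: "\<And>\<epsilon>. \<epsilon> > 0 \<Longrightarrow> \<exists>n0. \<forall>m\<ge>n0. \<forall>n\<ge>n0. (LINT x|M. (f m x - f n x)\<^sup>2) < \<epsilon>"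
  shows "\<exists>g\<in>borel_measurable M. integrable M (\<lambda>x. (g x)\<^sup>2) \<and>
           (\<lambda>n. LINT x|M. (f n x - g x)\<^sup>2) \<longlonglongrightarrow> 0"
proof -
  have sqd: "integrable M (\<lambda>x. (u x - v x)\<^sup>2)"
    if [measurable]: "u \<in> borel_measurable M" "v \<in> borel_measurable M"
      and "integrable M (\<lambda>x. (u x)\<^sup>2)" "integrable M (\<lambda>x. (v x)\<^sup>2)" for u v :: "'a \<Rightarrow> real"
    using that integrable_mult_of_squares[OF that]
    by (simp add: power2_diff mult.assoc)
  \<comment> \<open>The bound is on squares; its root \<open>(1/2) ^ k\<close> is what has to be
    summable.\<close>
  have "\<exists>n0. \<forall>m\<ge>n0. \<forall>n\<ge>n0. (LINT x|M. (f m x - f n x)\<^sup>2) < (1/4) ^ k" for k :: nat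
    by (rule Cauchy) simp
  then obtain N where N: "\<And>k m n. m \<ge> N k \<Longrightarrow> n \<ge> N k \<Longrightarrow> (LINT x|M. (f m x - f n x)\<^sup>2) < (1/4) ^ k"
    by metis
  \<comment> \<open>Summing the thresholds makes \<open>r\<close> monotone with
    \<open>r k \<ge> N k\<close>; the added \<open>k\<close> makes it unbounded, which
    \<open>fatou\<close> uses.\<close>
  define r where "r k = (\<Sum>i\<le>k. N i) + k" for k
  have rN: "r k \<ge> N k" for k unfolding r_def by (intro trans_le_add1 member_le_sum) auto
  have rge: "r k \<ge> k" for k by (simp add: r_def)
  have r_Suc: "r (Suc k) \<ge> r k" for k by (simp add: r_def)
  define d where "d k x = f (r (Suc k)) x - f (r k) x" for k x
  have [measurable]: "d k \<in> borel_measurable M" for k unfolding d_def by measurable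
  define c where "c = sqrt (measure M (space M))"
  have c0: "c \<ge> 0" by (simp add: c_def)
  have dint: "integrable M (d k)" for k
    unfolding d_def by (intro Bochner_Integration.integrable_diff; rule integrable_of_square[OF meas sq])
  have dbound: "(LINT x|M. \<bar>d k x\<bar>) \<le> c * (1/2) ^ k" for k
  proof -
    have "(LINT x|M. (d k x)\<^sup>2) \<le> (1/4) ^ k"
      using N[of k "r (Suc k)" "r k"] rN r_Suc le_trans unfolding d_def by (meson less_imp_le)
    then have "sqrt (LINT x|M. (d k x)\<^sup>2) \<le> sqrt ((1/4) ^ k)" by simp
    also have "sqrt ((1/4 :: real) ^ k) = (1/2) ^ k"
      by (simp add: real_sqrt_power real_sqrt_divide)
    finally have "c * sqrt (LINT x|M. (d k x)\<^sup>2) \<le> c * (1/2) ^ k" using c0 by (rule mult_left_mono)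
    moreover have "(LINT x|M. \<bar>d k x\<bar>) \<le> c * sqrt (LINT x|M. (d k x)\<^sup>2)"
      unfolding c_def by (rule integral_abs_le_sqrt) (auto simp: d_def intro!: sqd sq)
    ultimately show ?thesis by linarith
  qed
  have "(\<integral>\<^sup>+x. (\<Sum>k. ennreal \<bar>d k x\<bar>) \<partial>M) = (\<Sum>k. \<integral>\<^sup>+x. ennreal \<bar>d k x\<bar> \<partial>M)"
    by (rule nn_integral_suminf) measurable
  also have "\<dots> = (\<Sum>k. ennreal (LINT x|M. \<bar>d k x\<bar>))"
    using dint by (subst nn_integral_eq_integral) auto
  also have "\<dots> \<le> (\<Sum>k. ennreal (c * (1/2) ^ k))"
    by (intro suminf_le ennreal_leI dbound) auto
  also have "\<dots> = ennreal (\<Sum>k. c * (1/2) ^ k)"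
    by (intro suminf_ennreal2) (auto simp: c0 intro!: summable_mult summable_geometric)
  finally have "(\<integral>\<^sup>+x. (\<Sum>k. ennreal \<bar>d k x\<bar>) \<partial>M) \<noteq> \<infinity>"
    by (metis ennreal_less_top infinity_ennreal_def leD)
  then have "AE x in M. (\<Sum>k. ennreal \<bar>d k x\<bar>) \<noteq> \<infinity>"
    by (intro nn_integral_noteq_infinite) auto
  then have conv: "AE x in M. convergent (\<lambda>k. f (r k) x)"
  proof (rule AE_mp, intro AE_I2 impI)
    fix x assume "(\<Sum>k. ennreal \<bar>d k x\<bar>) \<noteq> \<infinity>"
    then have "summable (\<lambda>k. \<bar>d k x\<bar>)"
      by (intro summable_suminf_not_top) auto
    then have "summable (\<lambda>k. d k x)" by (rule summable_rabs_cancel)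
    then have "convergent (\<lambda>n. \<Sum>k<n. d k x)" by (simp add: summable_iff_convergent)
    then have "convergent (\<lambda>n. f (r n) x - f (r 0) x)"
      by (simp add: d_def sum_lessThan_telescope[of "\<lambda>n. f (r n) x"])
    then have "convergent (\<lambda>n. (f (r n) x - f (r 0) x) + f (r 0) x)"
      by (intro convergent_add convergent_const)
    then show "convergent (\<lambda>k. f (r k) x)" by simp
  qed
  define g where "g x = lim (\<lambda>k. f (r k) x)" for x
  have g[measurable]: "g \<in> borel_measurable M" unfolding g_def by measurable
  have lim: "AE x in M. (\<lambda>k. f (r k) x) \<longlonglongrightarrow> g x"
    using conv by eventually_elim (simp add: g_def convergent_LIMSEQ_iff)
  have fatou: "(\<integral>\<^sup>+x. ennreal ((f n x - g x)\<^sup>2) \<partial>M) \<le> ennreal \<epsilon>"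
    if n0: "\<forall>m\<ge>n0. \<forall>n\<ge>n0. (LINT x|M. (f m x - f n x)\<^sup>2) < \<epsilon>" and n: "n \<ge> n0" for n n0 \<epsilon>
  proof -
    have "(\<integral>\<^sup>+x. ennreal ((f n x - g x)\<^sup>2) \<partial>M)
        = (\<integral>\<^sup>+x. liminf (\<lambda>k. ennreal ((f n x - f (r k) x)\<^sup>2)) \<partial>M)"
    proof (rule nn_integral_cong_AE, use lim in eventually_elim)
      fix x assume "(\<lambda>k. f (r k) x) \<longlonglongrightarrow> g x"
      then have "(\<lambda>k. ennreal ((f n x - f (r k) x)\<^sup>2)) \<longlonglongrightarrow> ennreal ((f n x - g x)\<^sup>2)"
        by (intro tendsto_ennrealI tendsto_intros)
      then show "ennreal ((f n x - g x)\<^sup>2) = liminf (\<lambda>k. ennreal ((f n x - f (r k) x)\<^sup>2))"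
        by (metis lim_imp_Liminf trivial_limit_sequentially)
    qed
    also have "\<dots> \<le> liminf (\<lambda>k. \<integral>\<^sup>+x. ennreal ((f n x - f (r k) x)\<^sup>2) \<partial>M)"
      by (rule nn_integral_liminf) measurable
    also have "\<dots> \<le> limsup (\<lambda>k. \<integral>\<^sup>+x. ennreal ((f n x - f (r k) x)\<^sup>2) \<partial>M)"
      by (rule Liminf_le_Limsup) simp
    also have "\<dots> \<le> ennreal \<epsilon>"
    proof (rule Limsup_bounded, rule eventually_sequentiallyI[of n0])
      fix k assume "n0 \<le> k"
      then have "r k \<ge> n0" using rge le_trans by blast
      then have "(LINT x|M. (f n x - f (r k) x)\<^sup>2) \<le> \<epsilon>" using n0 n less_imp_le by blast
      then show "(\<integral>\<^sup>+x. ennreal ((f n x - f (r k) x)\<^sup>2) \<partial>M) \<le> ennreal \<epsilon>"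
        by (subst nn_integral_eq_integral) (auto intro!: sqd sq ennreal_leI)
    qed
    finally show ?thesis .
  qed
  have int_diff: "integrable M (\<lambda>x. (f n x - g x)\<^sup>2)"
    if n0: "\<forall>m\<ge>n0. \<forall>n\<ge>n0. (LINT x|M. (f m x - f n x)\<^sup>2) < \<epsilon>" and n: "n \<ge> n0" for n n0 \<epsilon>
    using fatou[OF that] by (intro integrableI_bounded) (auto simp: le_less_trans)
  obtain n1 where n1: "\<forall>m\<ge>n1. \<forall>n\<ge>n1. (LINT x|M. (f m x - f n x)\<^sup>2) < 1"
    using Cauchy[of 1] by auto
  \<comment> \<open>The limit is square-integrable as the difference of a member of the sequence and
    an error with finite square integral.\<close>
  have "integrable M (\<lambda>x. (f n1 x - (f n1 x - g x))\<^sup>2)"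
    by (intro sqd sq int_diff[OF n1]) auto
  then have gsq: "integrable M (\<lambda>x. (g x)\<^sup>2)" by simp
  have "(\<lambda>n. LINT x|M. (f n x - g x)\<^sup>2) \<longlonglongrightarrow> 0"
  proof (rule LIMSEQ_I)
    fix e :: real assume "e > 0"
    then obtain n0 where n0: "\<forall>m\<ge>n0. \<forall>n\<ge>n0. (LINT x|M. (f m x - f n x)\<^sup>2) < e / 2"
      using Cauchy[of "e / 2"] by auto
    have "(LINT x|M. (f n x - g x)\<^sup>2) \<le> e / 2" if "n \<ge> n0" for n
      using fatou[OF n0 that] \<open>e > 0\<close> int_diff[OF n0 that]
      by (subst (asm) nn_integral_eq_integral) auto
    then have "norm ((LINT x|M. (f n x - g x)\<^sup>2) - 0) < e" if "n \<ge> n0" for n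
      using \<open>e > 0\<close> that le_less_trans[of "LINT x|M. (f n x - g x)\<^sup>2" "e / 2" e] by simp
    then show "\<exists>n0. \<forall>n\<ge>n0. norm ((LINT x|M. (f n x - g x)\<^sup>2) - 0) < e" by blast
  qed
  then show ?thesis using gsq by auto
qed

end

text \<open>Half-lines form an intersection-stable generator of the Borel sets, so by Dynkin's
  argument the integral vanishes over every Borel set. As \<open>f\<close> is only Lebesgue
  measurable, a Borel version \<open>g\<close> stands in for it.\<close>

lemma AE_zero_of_integral_lessThan:
  fixes f :: "real \<Rightarrow> real"
  assumes int: "integrable lebesgue f" and zero: "\<And>x. (LINT t|lebesgue. indicator {..<x} t * f t) = 0"
  shows "AE x in lebesgue. f x = 0"
proof -
  have "f \<in> borel_measurable (completion lborel)" using int by auto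
  then obtain g where g[measurable]: "g \<in> borel_measurable lborel" and fg: "AE x in lborel. f x = g x"
    using completion_ex_borel_measurable_real by blast
  have fg': "AE x in lebesgue. f x = g x" using fg by (rule AE_completion)
  have gl: "integrable lebesgue g"
    using int fg' g by (subst integrable_cong_AE[of _ _ f]) (auto intro: measurable_completion)
  then have gint: "integrable lborel g" by (simp add: integrable_completion)
  have gz: "(LINT t|lborel. indicator {..<x} t * g t) = 0" for x
  proof -
    have "(LINT t|lebesgue. indicator {..<x} t * f t) = (LINT t|lebesgue. indicator {..<x} t * g t)"
      by (rule integral_cong_AE)
        (use fg' integrable_mult_indicator[OF _ int, of "{..<x}"] integrable_mult_indicator[OF _ gl, of "{..<x}"] in auto)
    then show ?thesis using zero[of x] by (simp add: integral_completion)
  qed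
  have si: "integrable lborel (\<lambda>t. indicator A t * g t)" if "A \<in> sets borel" for A
    using integrable_mult_indicator[OF _ gint, of A] that by simp
  \<comment> \<open>The complement step of the induction needs the integral over the whole line,
    which is exhausted by half-lines.\<close>
  have total: "(LINT t|lborel. g t) = 0"
  proof -
    have "(\<lambda>n. LINT t|lborel. indicator {..<real n} t * g t) \<longlonglongrightarrow> (LINT t|lborel. g t)"
    proof (rule integral_dominated_convergence[where w = "\<lambda>t. norm (g t)"])
      show "AE x in lborel. (\<lambda>n. indicator {..<real n} x * g x) \<longlonglongrightarrow> g x"
      proof (intro AE_I2 tendsto_eventually)
        fix x
        obtain n0 where "x < real n0" using reals_Archimedean2 by blast
        then show "\<forall>\<^sub>F n in sequentially. indicator {..<real n} x * g x = g x"
          by (intro eventually_sequentiallyI[of n0]) (auto simp: indicator_def)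
      qed
    qed (use gint in \<open>auto simp: indicator_def\<close>)
    then show ?thesis by (simp add: gz LIMSEQ_const_iff)
  qed
  let ?G = "range (\<lambda>a::real. {..<a})"
  have gen: "sets borel = sigma_sets UNIV ?G"
    by (simp add: borel_eq_lessThan[where 'a = real] eucl_lessThan)
  have "{..<a} \<inter> {..<b} \<in> ?G" for a b :: real
    by (intro image_eqI[of _ _ "min a b"]) auto
  then have "Int_stable ?G" by (auto simp: Int_stable_def)
  have all: "(LINT t|lborel. indicator A t * g t) = 0" if "A \<in> sets borel" for A
    using \<open>Int_stable ?G\<close> subset_UNIV[of ?G, folded Pow_UNIV] that[unfolded gen]
  proof (induction rule: sigma_sets_induct_disjoint)
    case (compl A)
    have A: "A \<in> sets borel" using compl(1) gen by simp
    have "(LINT t|lborel. indicator (UNIV - A) t * g t) = (LINT t|lborel. g t - indicator A t * g t)"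
      by (intro Bochner_Integration.integral_cong) (auto simp: indicator_def)
    also have "\<dots> = 0" using si[OF A] gint compl(2) total by simp
    finally show ?case .
  next
    case (union A)
    have A: "A i \<in> sets borel" for i using union(2) gen by auto
    have "(LINT x:(\<Union>i. A i)|lborel. g x) = (\<Sum>i. (LINT x:(A i)|lborel. g x))"
    proof (rule lebesgue_integral_countable_add)
      show "A i \<inter> A j = {}" if "i \<noteq> j" for i j
        using union(1) that by (simp add: disjoint_family_on_def)
      show "set_integrable lborel (\<Union>i. A i) g"
        using si[of "\<Union>i. A i"] A by (simp add: set_integrable_def)
    qed (use A in simp)
    then show ?case using union(3) by (simp add: set_lebesgue_integral_def)
  qed (use gz in auto)
  have "AE x in lborel. g x = 0"
    by (rule sigma_finite_measure.density_zero[OF _ gint])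
      (use all in \<open>auto simp: set_lebesgue_integral_def sigma_finite_lborel\<close>)
  then have "AE x in lebesgue. g x = 0" by (rule AE_completion)
  then show ?thesis using fg' by eventually_elim simp
qed

section \<open>A smooth step function\<close>

text \<open>The smoothness clause of \<open>test_functions\<close>, isolated so that it can be
  proved by coinduction.\<close>

definition smooth_real :: "(real \<Rightarrow> real) \<Rightarrow> bool" where
  "smooth_real f \<longleftrightarrow> (\<forall>n x. (deriv ^^ n) f differentiable (at x))"

text \<open>Closure under differentiation keeps every \<open>(deriv ^^ n) f\<close> inside
  \<open>C\<close>, so smoothness follows without a formula for the n-th derivative.\<close>

lemma smooth_real_coinduct:
  assumes "f \<in> C" and "\<And>g. g \<in> C \<Longrightarrow> \<exists>g'\<in>C. \<forall>x. (g has_real_derivative g' x) (at x)"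
  shows "smooth_real f"
proof -
  have "(deriv ^^ n) f \<in> C" for n
  proof (induction n)
    case (Suc n)
    then obtain g' where g': "g' \<in> C" "\<forall>x. ((deriv ^^ n) f has_real_derivative g' x) (at x)"
      using assms(2) by blast
    then have "deriv ((deriv ^^ n) f) = g'" by (auto intro!: ext DERIV_imp_deriv)
    then show ?case using g' by simp
  qed (use assms in simp)
  then show ?thesis
    unfolding smooth_real_def using assms(2) real_differentiable_def by blast
qed

lemma smooth_real_DERIV: "smooth_real f \<Longrightarrow> ((deriv ^^ n) f has_real_derivative (deriv ^^ Suc n) f x) (at x)"
  unfolding smooth_real_def by (metis DERIV_deriv_iff_real_differentiable funpow.simps(2) o_apply)

lemma smooth_real_derivI:
  assumes "smooth_real f'" "\<And>x. (f has_real_derivative f' x) (at x)"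
  shows "smooth_real f"
proof (rule smooth_real_coinduct[where C = "insert f (range (\<lambda>n. (deriv ^^ n) f'))"])
  fix g assume "g \<in> insert f (range (\<lambda>n. (deriv ^^ n) f'))"
  then consider "g = f" | n where "g = (deriv ^^ n) f'" by auto
  then show "\<exists>g'\<in>insert f (range (\<lambda>n. (deriv ^^ n) f')). \<forall>x. (g has_real_derivative g' x) (at x)"
  proof cases
    case 1
    then show ?thesis using assms(2) by (intro bexI[of _ f']) (auto intro: image_eqI[of _ _ 0])
  next
    case (2 n)
    then show ?thesis using smooth_real_DERIV[OF assms(1), of n]
      by (intro bexI[of _ "(deriv ^^ Suc n) f'"]) (auto intro: image_eqI[of _ _ "Suc n"])
  qed
qed simp

text \<open>One statement covers scaling, translation and differences. The class used is stable
  because the inner slopes are absorbed into the outer coefficients on differentiation.\<close>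

lemma smooth_real_lin_comb:
  assumes "smooth_real f" "smooth_real g"
  shows "smooth_real (\<lambda>x. p * f (a * x + b) + q * g (c * x + d))"
proof (rule smooth_real_coinduct)
  let ?C = "{(\<lambda>x. p * (deriv ^^ n) f (a * x + b) + q * (deriv ^^ n) g (c * x + d)) | p q n. True}"
  show "(\<lambda>x. p * f (a * x + b) + q * g (c * x + d)) \<in> ?C"
    by (rule CollectI, rule exI[of _ p], rule exI[of _ q], rule exI[of _ 0]) simp
  fix h assume "h \<in> ?C"
  then obtain p q n where h: "h = (\<lambda>x. p * (deriv ^^ n) f (a * x + b) + q * (deriv ^^ n) g (c * x + d))"
    by blast
  have "(h has_real_derivative p * a * (deriv ^^ Suc n) f (a * x + b) + q * c * (deriv ^^ Suc n) g (c * x + d)) (at x)" for x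
    unfolding h
    by (rule derivative_eq_intros DERIV_chain2[OF smooth_real_DERIV[OF assms(1)]]
        DERIV_chain2[OF smooth_real_DERIV[OF assms(2)]] refl | simp)+
  then show "\<exists>g'\<in>?C. \<forall>x. (h has_real_derivative g' x) (at x)"
    by (intro bexI[of _ "\<lambda>x. p * a * (deriv ^^ Suc n) f (a * x + b) + q * c * (deriv ^^ Suc n) g (c * x + d)"]
        CollectI exI[of _ "p * a"] exI[of _ "q * c"] exI[of _ "Suc n"]) auto
qed

text \<open>A class of functions closed under differentiation, so that its members are smooth.\<close>

definition bump :: "real poly \<Rightarrow> nat \<Rightarrow> real \<Rightarrow> real" where
  "bump p k x = (if \<bar>x\<bar> < 1 then poly p x / (1 - x\<^sup>2) ^ k * exp (- 1 / (1 - x\<^sup>2)) else 0)"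

text \<open>With \<open>w = 1 - x\<^sup>2\<close>, the single term of index \<open>k + 2\<close> in
  the series of \<open>exp (1 / w)\<close> already gives
  \<open>exp (- 1 / w) / w ^ k \<le> fact (k + 2) * w\<^sup>2\<close>. Vanishing to second order at
  the endpoints is what makes the derivative exist and be zero there.\<close>

lemma bump_bound: "\<exists>C. \<forall>x. \<bar>bump p k x\<bar> \<le> C * (1 - x\<^sup>2)\<^sup>2"
proof -
  have "continuous_on {-1..1} (poly p)" by (intro continuous_intros)
  then have "bounded (poly p ` {-1..1})"
    using compact_continuous_image compact_imp_bounded compact_Icc by blast
  then obtain P where P: "\<And>x. x \<in> {-1..1} \<Longrightarrow> \<bar>poly p x\<bar> \<le> P" unfolding bounded_real by blast
  have P0: "P \<ge> 0" using P[of 0] by simp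
  have "\<bar>bump p k x\<bar> \<le> P * fact (k + 2) * (1 - x\<^sup>2)\<^sup>2" for x
  proof (cases "\<bar>x\<bar> < 1")
    case True
    define w where "w = 1 - x\<^sup>2"
    have w: "w > 0" using True by (simp add: w_def abs_square_less_1)
    have "(1 / w) ^ (k + 2) /\<^sub>R fact (k + 2) \<le> exp (1 / w)"
    proof -
      have "(\<Sum>n\<in>{k + 2}. (1 / w) ^ n /\<^sub>R fact n) \<le> (\<Sum>n. (1 / w) ^ n /\<^sub>R fact n)"
        using w by (intro sum_le_suminf summable_exp_generic) auto
      then show ?thesis by (simp add: exp_def)
    qed
    then have "inverse (w ^ k) * exp (- 1 / w) \<le> fact (k + 2) * w\<^sup>2"
      using w by (simp add: exp_minus power_add field_simps power_divide power2_eq_square del: fact_Suc)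
    moreover have "\<bar>poly p x\<bar> \<le> P" using P[of x] True by (simp add: abs_less_iff)
    ultimately have "\<bar>poly p x\<bar> * (inverse (w ^ k) * exp (- 1 / w)) \<le> P * (fact (k + 2) * w\<^sup>2)"
      by (intro mult_mono[of "\<bar>poly p x\<bar>"]) (use P0 w in simp_all)
    then show ?thesis
      using True w by (simp add: bump_def w_def[symmetric] abs_mult abs_divide field_simps del: fact_Suc)
  qed (use P0 in \<open>simp add: bump_def del: fact_Suc\<close>)
  then show ?thesis by blast
qed

text \<open>The polynomial \<open>[:1, 0, -1:]\<close> is \<open>1 - x\<^sup>2\<close>. After
  clearing denominators the three terms come from differentiating \<open>p\<close>, the power in the
  denominator and the exponential; the last one raises the exponent by 2.\<close>

lemma bump_DERIV:
  "(bump p k has_real_derivative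
     bump (pderiv p * [:1, 0, -1:] ^ 2 + [:0, 2 * real k:] * p * [:1, 0, -1:] - [:0, 2:] * p) (k + 2) x) (at x)"
    (is "(_ has_real_derivative bump ?q _ x) _")
proof -
  consider "\<bar>x\<bar> < 1" | "\<bar>x\<bar> > 1" | "\<bar>x\<bar> = 1" by linarith
  then show ?thesis
  proof cases
    case 1
    define w where "w = 1 - x\<^sup>2"
    have w: "w > 0" using 1 by (simp add: w_def abs_square_less_1)
    have "((\<lambda>x. poly p x * inverse ((1 - x\<^sup>2) ^ k) * exp (- inverse (1 - x\<^sup>2))) has_real_derivative
        (poly (pderiv p) x * inverse (w ^ k) + poly p x * (real k * w ^ (k - 1) * (2 * x) * inverse (w ^ k) * inverse (w ^ k)))
          * exp (- inverse w) - poly p x * inverse (w ^ k) * (exp (- inverse w) * (2 * x * inverse w * inverse w))) (at x)"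
      unfolding w_def using w[unfolded w_def]
      by (auto intro!: derivative_eq_intros simp: algebra_simps)
    also have "(poly (pderiv p) x * inverse (w ^ k) + poly p x * (real k * w ^ (k - 1) * (2 * x) * inverse (w ^ k) * inverse (w ^ k)))
          * exp (- inverse w) - poly p x * inverse (w ^ k) * (exp (- inverse w) * (2 * x * inverse w * inverse w))
       = bump ?q (k + 2) x"
    proof -
      have q: "poly ?q x = poly (pderiv p) x * w\<^sup>2 + 2 * real k * x * poly p x * w - 2 * x * poly p x"
        by (simp add: w_def algebra_simps power2_eq_square)
      have "real k * w ^ (k - 1) * inverse (w ^ k) = real k / w"
        using w by (cases k) (auto simp: field_simps)
      then have "poly p x * (real k * w ^ (k - 1) * (2 * x) * inverse (w ^ k) * inverse (w ^ k)) =
         poly p x * (2 * x) * (real k / w) * inverse (w ^ k)"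
        (is "?l = _")
        by (rule subst[where P = "\<lambda>t. ?l = poly p x * (2 * x) * t * inverse (w ^ k)"]) (simp only: mult_ac)
      then show ?thesis
        using 1 w unfolding bump_def q w_def[symmetric]
        by (simp add: field_simps power_add power2_eq_square)
    qed
    finally show ?thesis
      by (rule has_field_derivative_transform_within_open[where S = "{-1<..<1}"])
        (use 1 in \<open>auto simp: bump_def field_simps abs_less_iff\<close>)
  next
    case 2
    have "open (- cball (0::real) 1)" by (intro open_Compl closed_cball)
    moreover have "x \<in> - cball 0 1" using 2 by (simp add: dist_norm)
    moreover have "((\<lambda>_. 0) has_real_derivative bump ?q (k + 2) x) (at x)"
      using 2 by (simp add: bump_def)
    ultimately show ?thesis
      by (elim has_field_derivative_transform_within_open) (auto simp: bump_def dist_norm)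
  next
    case 3
    then have x2: "x\<^sup>2 = 1" by (metis power2_abs one_power2)
    obtain C where C: "\<And>y. \<bar>bump p k y\<bar> \<le> C * (1 - y\<^sup>2)\<^sup>2" using bump_bound by blast
    have "bump p k x = 0" "bump ?q (k + 2) x = 0" using 3 by (simp_all add: bump_def)
    \<comment> \<open>At an endpoint the difference quotient is estimated directly:
      \<open>1 - y\<^sup>2\<close> contains the factor \<open>y - x\<close>, and the bound contains
      its square.\<close>
    moreover have "((\<lambda>y. bump p k y / (y - x)) \<longlongrightarrow> 0) (at x)"
    proof (rule Lim_null_comparison)
      have "norm (bump p k y / (y - x)) \<le> C * (\<bar>y - x\<bar> * (y + x)\<^sup>2)" if "y \<noteq> x" for y
      proof -
        have cancel: "C * (d * d * e) / d = C * (d * e)" if "d \<noteq> 0" for d e :: real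
          using that by simp
        have "(1 - y\<^sup>2)\<^sup>2 = (y - x)\<^sup>2 * (y + x)\<^sup>2"
          by (subst x2[symmetric], simp add: power2_eq_square algebra_simps)
        then have "\<bar>bump p k y\<bar> \<le> C * (\<bar>y - x\<bar> * \<bar>y - x\<bar> * (y + x)\<^sup>2)"
          using C[of y] by (metis abs_mult_self_eq power2_eq_square)
        then have "\<bar>bump p k y\<bar> / \<bar>y - x\<bar> \<le> C * (\<bar>y - x\<bar> * \<bar>y - x\<bar> * (y + x)\<^sup>2) / \<bar>y - x\<bar>"
          by (rule divide_right_mono) simp
        also have "\<dots> = C * (\<bar>y - x\<bar> * (y + x)\<^sup>2)"
          by (rule cancel) (use that in simp)
        finally show ?thesis by simp
      qed
      then show "\<forall>\<^sub>F y in at x. norm (bump p k y / (y - x)) \<le> C * (\<bar>y - x\<bar> * (y + x)\<^sup>2)"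
        by (auto simp: eventually_at_filter)
      have "((\<lambda>y. C * (\<bar>y - x\<bar> * (y + x)\<^sup>2)) \<longlongrightarrow> C * (\<bar>x - x\<bar> * (x + x)\<^sup>2)) (at x)"
        by (intro tendsto_intros)
      then show "((\<lambda>y. C * (\<bar>y - x\<bar> * (y + x)\<^sup>2)) \<longlongrightarrow> 0) (at x)" by simp
    qed
    ultimately show ?thesis by (simp add: has_field_derivative_iff)
  qed
qed

lemma smooth_bump: "smooth_real (bump p k)"
proof (rule smooth_real_coinduct[where C = "{bump p k | p k. True}"])
  fix g assume "g \<in> {bump p k | p k. True}"
  then obtain p k where "g = bump p k" by blast
  then show "\<exists>g'\<in>{bump p k | p k. True}. \<forall>x. (g has_real_derivative g' x) (at x)"
    using bump_DERIV[of p k] by blast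
qed blast

text \<open>The normalized primitive of the standard mollifier
  \<open>exp (- 1 / (1 - x\<^sup>2))\<close>. It plays two roles: \<open>s'\<close> is a mollifier
  of mass one, and differences of scaled copies of \<open>s\<close> are smooth plateaus.\<close>

lemma smooth_step_exists:
  obtains s s' :: "real \<Rightarrow> real" where "smooth_real s" "\<And>x. (s has_real_derivative s' x) (at x)"
    "\<And>x. s' x \<ge> 0" "\<And>x. \<bar>x\<bar> \<ge> 1 \<Longrightarrow> s' x = 0" "\<And>x. x \<le> -1 \<Longrightarrow> s x = 0" "\<And>x. x \<ge> 1 \<Longrightarrow> s x = 1"
    "\<And>x. 0 \<le> s x" "\<And>x. s x \<le> 1" "continuous_on UNIV s'"
proof -
  let ?\<rho> = "bump [:1:] 0"
  have \<rho>cont: "isCont ?\<rho> x" for x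
    using bump_DERIV DERIV_isCont by blast
  have \<rho>0: "?\<rho> x \<ge> 0" for x by (simp add: bump_def)
  obtain F where F: "\<And>x. (F has_real_derivative ?\<rho> x) (at x)"
    using einterval_antiderivative[of "-\<infinity>" \<infinity> ?\<rho>] \<rho>cont
    by (auto simp: has_real_derivative_iff_has_vector_derivative)
  have mono: "F x \<le> F y" if "x \<le> y" for x y
    using that F \<rho>0 by (intro DERIV_nonneg_imp_nondecreasing[OF that]) blast
  have const: "F x = F y" if "x \<le> y" "y \<le> -1 \<or> 1 \<le> x" for x y
  proof (cases "x = y")
    case False
    then have "x < y" using that by simp
    have "(F has_real_derivative 0) (at z)" if "x < z" "z < y" for z
    proof -
      have "?\<rho> z = 0" using that \<open>y \<le> -1 \<or> 1 \<le> x\<close> by (auto simp: bump_def)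
      then show ?thesis using F[of z] by simp
    qed
    moreover have "continuous_on {x..y} F"
      using F by (meson DERIV_isCont continuous_at_imp_continuous_on)
    ultimately show ?thesis using DERIV_isconst2[of x y F y] \<open>x < y\<close> by simp
  qed simp
  \<comment> \<open>The mean value point lies where the density is positive, so the total increase
    of \<open>F\<close>, the normalizing constant, is positive.\<close>
  obtain z where z: "-1/2 < z" "z < 1/2" "F (1/2) - F (-1/2) = (1/2 - (-1/2)) * ?\<rho> z"
    using MVT2[of "-1/2" "1/2" F ?\<rho>] F by auto
  then have "?\<rho> z > 0" by (auto simp: bump_def)
  then have c: "F 1 - F (-1) > 0" using z mono[of "-1" "-1/2"] mono[of "1/2" 1] by simp
  define c where "c = F 1 - F (-1)"
  have c: "c > 0" using c by (simp add: c_def)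
  show ?thesis
  proof (rule that[of "\<lambda>x. (F x - F (-1)) / c" "\<lambda>x. ?\<rho> x / c"])
    show deriv: "((\<lambda>x. (F x - F (-1)) / c) has_real_derivative ?\<rho> x / c) (at x)" for x
      using c by (auto intro!: derivative_eq_intros F)
    have "smooth_real (\<lambda>x. (1 / c) * ?\<rho> (1 * x + 0) + 0 * ?\<rho> (1 * x + 0))"
      by (intro smooth_real_lin_comb smooth_bump)
    then have "smooth_real (\<lambda>x. ?\<rho> x / c)" by simp
    then show "smooth_real (\<lambda>x. (F x - F (-1)) / c)" using deriv by (rule smooth_real_derivI)
    show "?\<rho> x / c \<ge> 0" for x using \<rho>0 c by simp
    show "?\<rho> x / c = 0" if "\<bar>x\<bar> \<ge> 1" for x using that by (simp add: bump_def)
    show "(F x - F (-1)) / c = 0" if "x \<le> -1" for x using const[of x "-1"] that by simp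
    show one: "(F x - F (-1)) / c = 1" if "x \<ge> 1" for x using const[of 1 x] that c by (simp add: c_def)
    have "F (-1) \<le> F x" "F x \<le> F 1" for x
      using mono[of "-1" x] const[of x "-1"] mono[of x 1] const[of 1 x] by linarith+
    then show "0 \<le> (F x - F (-1)) / c" "(F x - F (-1)) / c \<le> 1" for x
      using c by (simp_all add: c_def)
    show "continuous_on UNIV (\<lambda>x. ?\<rho> x / c)"
      using \<rho>cont c by (auto intro!: continuous_intros simp: continuous_on_eq_continuous_at)
  qed
qed

section \<open>Square-integrable functions and test functions on an interval\<close>

lemma finite_measure_lebesgue_on_Ioo [simp]: "finite_measure (lebesgue_on {a<..<b::real})"
  by (intro finite_measure_lebesgue_on) auto

lemma AE_lebesgue_on_neq: "S \<in> sets lebesgue \<Longrightarrow> AE x in lebesgue_on S. x \<noteq> (c::real)"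
  using AE_completion[OF AE_lborel_singleton[of c]] by (subst AE_restrict_space_iff) auto

lemma continuous_integrable_Ioo:
  fixes f :: "real \<Rightarrow> 'a::euclidean_space"
  assumes "continuous_on {a..b} f"
  shows "integrable (lebesgue_on {a<..<b}) f"
proof -
  have "f absolutely_integrable_on {a<..<b}"
    by (rule set_integrable_subset[OF absolutely_integrable_continuous_real[OF assms]]) auto
  then show ?thesis by (rule absolutely_integrable_imp_integrable) simp
qed

lemma integral_derivative_Ioo:
  fixes F f :: "real \<Rightarrow> real"
  assumes "a \<le> b" "continuous_on {a..b} f" "\<And>x. x \<in> {a..b} \<Longrightarrow> (F has_real_derivative f x) (at x)"
  shows "(LINT x|lebesgue_on {a<..<b}. f x) = F b - F a"
proof -
  have "(f has_integral (F b - F a)) {a..b}"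
    using assms(1,3) by (intro fundamental_theorem_of_calculus)
      (auto simp: has_real_derivative_iff_has_vector_derivative[symmetric] intro: has_field_derivative_at_within)
  then show ?thesis
    using lebesgue_integral_eq_integral[OF continuous_integrable_Ioo[OF assms(2)]]
    by (simp add: integral_open_interval_real[symmetric] integral_unique)
qed

lemma L2_measurable: "f \<in> L2 S \<Longrightarrow> f \<in> borel_measurable (lebesgue_on S)"
  and L2_square: "f \<in> L2 S \<Longrightarrow> integrable (lebesgue_on S) (\<lambda>x. (norm (f x))\<^sup>2)"
  by (auto simp: L2_def)

lemma L2_square_real: "f \<in> L2 S \<Longrightarrow> integrable (lebesgue_on S) (\<lambda>x. (f x :: real)\<^sup>2)"
  using L2_square[of f S] by simp

lemma L2_lin_comb:
  assumes "f \<in> L2 S" "g \<in> L2 S"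
  shows "(\<lambda>x. p *\<^sub>R f x + q *\<^sub>R g x) \<in> L2 S"
proof -
  have [measurable]: "f \<in> borel_measurable (lebesgue_on S)" "g \<in> borel_measurable (lebesgue_on S)"
    using assms by (auto simp: L2_def)
  have "(norm (p *\<^sub>R f x + q *\<^sub>R g x))\<^sup>2 \<le> 2 * p\<^sup>2 * (norm (f x))\<^sup>2 + 2 * q\<^sup>2 * (norm (g x))\<^sup>2" for x
  proof -
    have "(norm (p *\<^sub>R f x + q *\<^sub>R g x))\<^sup>2 \<le> (\<bar>p\<bar> * norm (f x) + \<bar>q\<bar> * norm (g x))\<^sup>2"
      by (intro power_mono) (auto intro: order_trans[OF norm_triangle_ineq])
    also have "\<dots> \<le> 2 * (\<bar>p\<bar> * norm (f x))\<^sup>2 + 2 * (\<bar>q\<bar> * norm (g x))\<^sup>2"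
      using sum_squares_bound[of "\<bar>p\<bar> * norm (f x)" "\<bar>q\<bar> * norm (g x)"] by (simp add: power2_sum)
    finally show ?thesis by (simp add: power_mult_distrib)
  qed
  then have le: "norm ((norm (p *\<^sub>R f x + q *\<^sub>R g x))\<^sup>2) \<le> norm (2 * p\<^sup>2 * (norm (f x))\<^sup>2 + 2 * q\<^sup>2 * (norm (g x))\<^sup>2)" for x
    by (smt (verit) real_norm_def zero_le_power2)
  have "integrable (lebesgue_on S) (\<lambda>x. 2 * p\<^sup>2 * (norm (f x))\<^sup>2 + 2 * q\<^sup>2 * (norm (g x))\<^sup>2)"
    using L2_square[OF assms(1)] L2_square[OF assms(2)] by simp
  then have "integrable (lebesgue_on S) (\<lambda>x. (norm (p *\<^sub>R f x + q *\<^sub>R g x))\<^sup>2)"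
    by (rule Bochner_Integration.integrable_bound) (use le in simp_all)
  then show ?thesis by (simp add: L2_def)
qed

lemma L2_diff: "f \<in> L2 S \<Longrightarrow> g \<in> L2 S \<Longrightarrow> (\<lambda>x. f x - g x) \<in> L2 S"
  using L2_lin_comb[of f S g 1 "-1"] by simp

lemma L2_lin_comb_real: "f \<in> L2 S \<Longrightarrow> g \<in> L2 S \<Longrightarrow> (\<lambda>x. p * f x + q * g x :: real) \<in> L2 S"
  using L2_lin_comb[of f S g p q] by simp

lemma L2_integrable:
  assumes "f \<in> L2 {a<..<b}"
  shows "integrable (lebesgue_on {a<..<b}) f"
proof -
  interpret finite_measure "lebesgue_on {a<..<b}" by simp
  have "(\<lambda>x. norm (f x)) \<in> borel_measurable (lebesgue_on {a<..<b})"
    using L2_measurable[OF assms] by simp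
  then have "integrable (lebesgue_on {a<..<b}) (\<lambda>x. norm (f x))"
    by (rule integrable_of_square[OF _ L2_square[OF assms]])
  then show ?thesis using L2_measurable[OF assms] by (simp add: integrable_norm_iff)
qed

lemma L2_abs_le:
  fixes f :: "real \<Rightarrow> real"
  assumes "a \<le> b" "f \<in> L2 {a<..<b}"
  shows "(LINT x|lebesgue_on {a<..<b}. \<bar>f x\<bar>) \<le> sqrt (b - a) * sqrt (LINT x|lebesgue_on {a<..<b}. (f x)\<^sup>2)"
proof -
  interpret finite_measure "lebesgue_on {a<..<b}" by simp
  have "measure (lebesgue_on {a<..<b}) (space (lebesgue_on {a<..<b})) = b - a"
    using assms(1) by (simp add: measure_restrict_space)
  then show ?thesis
    using integral_abs_le_sqrt[OF L2_measurable[OF assms(2)] L2_square_real[OF assms(2)]] by simp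
qed

lemma continuous_L2_Ioo:
  fixes f :: "real \<Rightarrow> 'a::euclidean_space"
  assumes "continuous_on {a..b} f"
  shows "f \<in> L2 {a<..<b}"
proof -
  have "continuous_on {a..b} (\<lambda>x. (norm (f x))\<^sup>2)" by (intro continuous_intros assms)
  then show ?thesis
    using borel_measurable_integrable[OF continuous_integrable_Ioo[OF assms]]
      continuous_integrable_Ioo[of a b "\<lambda>x. (norm (f x))\<^sup>2"] by (simp add: L2_def)
qed

lemma norm_integral_le:
  fixes f :: "'a \<Rightarrow> 'b::{banach, second_countable_topology}"
  assumes "integrable M f" "integrable M g" "\<And>x. x \<in> space M \<Longrightarrow> norm (f x) \<le> g x"
  shows "norm (LINT x|M. f x) \<le> (LINT x|M. g x)"
  by (rule order_trans[OF integral_norm_bound integral_mono]) (use assms in auto)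

lemma integrable_mult_bounded:
  fixes f w :: "'a \<Rightarrow> real"
  assumes "integrable M f" "w \<in> borel_measurable M" "\<And>x. x \<in> space M \<Longrightarrow> \<bar>w x\<bar> \<le> B"
  shows "integrable M (\<lambda>x. f x * w x)"
proof (rule Bochner_Integration.integrable_bound[of _ "\<lambda>x. B * f x"])
  show "AE x in M. norm (f x * w x) \<le> norm (B * f x)"
  proof (rule AE_I2)
    fix x assume "x \<in> space M"
    then have "\<bar>w x\<bar> \<le> \<bar>B\<bar>" using assms(3) by force
    from mult_left_mono[OF this, of "\<bar>f x\<bar>"] show "norm (f x * w x) \<le> norm (B * f x)"
      by (simp add: abs_mult mult_ac)
  qed
qed (use assms in auto)

text \<open>Serves to pass to the limit on both sides of the identity that defines a weak
  derivative, with a test function or its derivative as the weight.\<close>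

lemma tendsto_integral_mult_bounded:
  fixes f :: "nat \<Rightarrow> 'a \<Rightarrow> real"
  assumes f: "\<And>n. integrable M (f n)" "integrable M g"
    and w: "w \<in> borel_measurable M" "\<And>x. x \<in> space M \<Longrightarrow> \<bar>w x\<bar> \<le> B"
    and lim: "(\<lambda>n. LINT x|M. \<bar>f n x - g x\<bar>) \<longlonglongrightarrow> 0"
  shows "(\<lambda>n. LINT x|M. f n x * w x) \<longlonglongrightarrow> (LINT x|M. g x * w x)"
proof -
  note i = integrable_mult_bounded[OF _ w]
  have bound: "norm ((LINT x|M. f n x * w x) - (LINT x|M. g x * w x)) \<le> B * (LINT x|M. \<bar>f n x - g x\<bar>)" for n
  proof -
    have "(LINT x|M. f n x * w x) - (LINT x|M. g x * w x) = (LINT x|M. (f n x - g x) * w x)"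
      using i[OF f(1)] i[OF f(2)] by (simp add: left_diff_distrib)
    also have "norm \<dots> \<le> (LINT x|M. B * \<bar>f n x - g x\<bar>)"
    proof (rule norm_integral_le)
      show "integrable M (\<lambda>x. (f n x - g x) * w x)" using i f by auto
      fix x assume "x \<in> space M"
      from mult_left_mono[OF w(2)[OF this], of "\<bar>f n x - g x\<bar>"]
      show "norm ((f n x - g x) * w x) \<le> B * \<bar>f n x - g x\<bar>" by (simp add: abs_mult mult_ac)
    qed (use f in auto)
    finally show ?thesis by simp
  qed
  have "(\<lambda>n. B * (LINT x|M. \<bar>f n x - g x\<bar>)) \<longlonglongrightarrow> 0"
    using tendsto_mult_right_zero[OF lim] by simp
  from bound this have "(\<lambda>n. (LINT x|M. f n x * w x) - (LINT x|M. g x * w x)) \<longlonglongrightarrow> 0"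
    by (rule Lim_null_comparison[OF always_eventually[OF allI]])
  then show ?thesis by (simp add: LIM_zero_iff)
qed

section \<open>Test functions, mollifiers and plateaus\<close>

lemma test_function_smooth: "\<psi> \<in> test_functions K \<Longrightarrow> smooth_real \<psi>"
  by (simp add: test_functions_def smooth_real_def)

lemma test_function_deriv:
  assumes "\<psi> \<in> test_functions K"
  shows "(\<psi> has_real_derivative deriv \<psi> x) (at x)"
    and "continuous_on A \<psi>" and "continuous_on A (deriv \<psi>)"
proof -
  note d = smooth_real_DERIV[OF test_function_smooth[OF assms]]
  show *: "(\<psi> has_real_derivative deriv \<psi> x) (at x)" for x using d[of 0 x] by simp
  have **: "(deriv \<psi> has_real_derivative deriv (deriv \<psi>) x) (at x)" for x using d[of 1 x] by simp
  show "continuous_on A \<psi>" using * by (meson DERIV_isCont continuous_at_imp_continuous_on)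
  show "continuous_on A (deriv \<psi>)"
    using ** by (meson DERIV_isCont continuous_at_imp_continuous_on)
qed

lemma test_function_zero: "\<psi> \<in> test_functions K \<Longrightarrow> x \<notin> K \<Longrightarrow> \<psi> x = 0"
  using closure_subset[of "{x. \<psi> x \<noteq> 0}"] by (auto simp: test_functions_def)

lemma continuous_bounded_Ioo:
  fixes f :: "real \<Rightarrow> real"
  assumes "continuous_on {a..b} f"
  obtains B where "\<And>x. x \<in> {a..b} \<Longrightarrow> \<bar>f x\<bar> \<le> B"
proof -
  have "bounded (f ` {a..b})"
    using assms compact_continuous_image compact_imp_bounded compact_Icc by blast
  then show ?thesis using that unfolding bounded_real by blast
qed

lemma integrable_mult_continuous_Ioo:
  fixes f w :: "real \<Rightarrow> real"
  assumes "integrable (lebesgue_on {a<..<b}) f" "continuous_on {a..b} w"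
  shows "integrable (lebesgue_on {a<..<b}) (\<lambda>x. f x * w x)"
proof -
  obtain B where "\<And>x. x \<in> {a..b} \<Longrightarrow> \<bar>w x\<bar> \<le> B" using continuous_bounded_Ioo[OF assms(2)] by blast
  then show ?thesis
    using continuous_integrable_Ioo[OF assms(2)]
    by (intro integrable_mult_bounded[OF assms(1), of _ B]) auto
qed

lemma has_L2_weak_deriv_lin_comb:
  assumes "has_L2_weak_deriv {a<..<b} f f'" "has_L2_weak_deriv {a<..<b} g g'"
    and L2: "f \<in> L2 {a<..<b}" "g \<in> L2 {a<..<b}"
  shows "has_L2_weak_deriv {a<..<b} (\<lambda>x. p * f x + q * g x) (\<lambda>x. p * f' x + q * g' x)"
  unfolding has_L2_weak_deriv_def
proof (intro conjI ballI)
  have L2': "f' \<in> L2 {a<..<b}" "g' \<in> L2 {a<..<b}" using assms by (auto simp: has_L2_weak_deriv_def)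
  then show "(\<lambda>x. p * f' x + q * g' x) \<in> L2 {a<..<b}" by (rule L2_lin_comb_real)
  fix \<psi> assume \<psi>: "\<psi> \<in> test_functions {a<..<b}"
  note c = test_function_deriv(2,3)[OF \<psi>]
  note i = integrable_mult_continuous_Ioo[OF L2_integrable]
  have "(LINT x|lebesgue_on {a<..<b}. (p * f x + q * g x) * deriv \<psi> x)
     = p * (LINT x|lebesgue_on {a<..<b}. f x * deriv \<psi> x) + q * (LINT x|lebesgue_on {a<..<b}. g x * deriv \<psi> x)"
    using i[OF L2(1) c(2)] i[OF L2(2) c(2)] by (simp add: distrib_right mult.assoc)
  also have "\<dots> = - (p * (LINT x|lebesgue_on {a<..<b}. f' x * \<psi> x) + q * (LINT x|lebesgue_on {a<..<b}. g' x * \<psi> x))"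
    using assms(1,2) \<psi> by (simp add: has_L2_weak_deriv_def)
  also have "\<dots> = - (LINT x|lebesgue_on {a<..<b}. (p * f' x + q * g' x) * \<psi> x)"
    using i[OF L2'(1) c(1)] i[OF L2'(2) c(1)] by (simp add: distrib_right mult.assoc)
  finally show "(LINT x|lebesgue_on {a<..<b}. (p * f x + q * g x) * deriv \<psi> x)
    = - (LINT x|lebesgue_on {a<..<b}. (p * f' x + q * g' x) * \<psi> x)" .
qed

text \<open>The kernels are nonnegative, have mass one and live within \<open>\<epsilon> n\<close>
  of \<open>c\<close>, so the error is a weighted mean of \<open>u x - u c\<close> over a shrinking
  neighbourhood of \<open>c\<close>.\<close>

lemma approximate_identity:
  fixes u s s' :: "real \<Rightarrow> real"
  assumes u: "continuous_on {a..b} u" and c: "a < c" "c < b"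
    and s: "\<And>x. (s has_real_derivative s' x) (at x)" "\<And>x. s' x \<ge> 0" "\<And>x. \<bar>x\<bar> \<ge> 1 \<Longrightarrow> s' x = 0"
      "\<And>x. x \<le> -1 \<Longrightarrow> s x = 0" "\<And>x. x \<ge> 1 \<Longrightarrow> s x = 1" "continuous_on UNIV s'"
    and \<epsilon>: "\<And>n. \<epsilon> n > 0" "\<epsilon> \<longlonglongrightarrow> 0" "\<And>n. \<epsilon> n \<le> c - a" "\<And>n. \<epsilon> n \<le> b - c"
  shows "(\<lambda>n. LINT x|lebesgue_on {a<..<b}. u x * (s' ((x - c) / \<epsilon> n) / \<epsilon> n)) \<longlonglongrightarrow> u c"
proof (rule LIMSEQ_I)
  fix r :: real assume "r > 0"
  let ?M = "lebesgue_on {a<..<b}"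
  define w where "w n x = s' ((x - c) / \<epsilon> n) / \<epsilon> n" for n x
  have wc: "continuous_on A (w n)" for n A
    unfolding w_def using \<epsilon>(1)[of n]
    by (auto intro!: continuous_intros continuous_on_compose2[OF s(6)])
  have w1: "(LINT x|?M. w n x) = 1" for n
  proof -
    have "(LINT x|?M. w n x) = s ((b - c) / \<epsilon> n) - s ((a - c) / \<epsilon> n)"
    proof (rule integral_derivative_Ioo[OF _ wc])
      fix x
      have "((\<lambda>x. s ((x - c) / \<epsilon> n)) has_real_derivative s' ((x - c) / \<epsilon> n) * (1 / \<epsilon> n)) (at x)"
        using \<epsilon>(1)[of n] by (intro DERIV_chain2[OF s(1)]) (auto intro!: derivative_eq_intros)
      then show "((\<lambda>x. s ((x - c) / \<epsilon> n)) has_real_derivative w n x) (at x)" by (simp add: w_def)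
    qed (use c in simp)
    \<comment> \<open>The bounds on \<open>\<epsilon> n\<close> send \<open>a\<close> to at most -1
      and \<open>b\<close> to at least 1 after rescaling, where \<open>s\<close> is
      constant.\<close>
    also have "\<dots> = 1"
      using s(4)[of "(a - c) / \<epsilon> n"] s(5)[of "(b - c) / \<epsilon> n"] \<epsilon>(1)[of n] \<epsilon>(3)[of n] \<epsilon>(4)[of n]
      by (simp add: field_simps)
    finally show ?thesis .
  qed
  have w0: "w n x \<ge> 0" for n x using s(2) \<epsilon>(1)[of n] by (simp add: w_def)
  have "continuous (at c within {a..b}) u" using u c by (simp add: continuous_on_eq_continuous_within)
  then obtain d where d: "d > 0" "\<And>x. x \<in> {a..b} \<Longrightarrow> dist x c < d \<Longrightarrow> dist (u x) (u c) < r / 2"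
    unfolding continuous_within_eps_delta using \<open>r > 0\<close> by (meson half_gt_zero)
  obtain N where N: "\<And>n. n \<ge> N \<Longrightarrow> \<epsilon> n < d"
    using order_tendstoD(2)[OF \<epsilon>(2) d(1)] by (auto simp: eventually_sequentially)
  have "norm ((LINT x|?M. u x * w n x) - u c) < r" if "n \<ge> N" for n
  proof -
    have i: "integrable ?M (\<lambda>x. u x * w n x)" "integrable ?M (w n)"
      by (intro continuous_integrable_Ioo continuous_intros wc u)+
    have "(LINT x|?M. u x * w n x) - u c = (LINT x|?M. u x * w n x) - u c * (LINT x|?M. w n x)"
      by (simp add: w1)
    also have "\<dots> = (LINT x|?M. (u x - u c) * w n x)"
      using i by (simp add: left_diff_distrib)
    also have "norm \<dots> \<le> (LINT x|?M. r / 2 * w n x)"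
    proof (rule norm_integral_le)
      show "integrable ?M (\<lambda>x. (u x - u c) * w n x)"
        by (intro continuous_integrable_Ioo continuous_intros wc u)
      fix x assume x: "x \<in> space ?M"
      show "norm ((u x - u c) * w n x) \<le> r / 2 * w n x"
      proof (cases "w n x = 0")
        case False
        then have "\<not> \<bar>(x - c) / \<epsilon> n\<bar> \<ge> 1" using s(3) by (auto simp: w_def)
        then have "\<bar>x - c\<bar> < \<epsilon> n" using \<epsilon>(1)[of n] by (simp add: abs_divide)
        then have "\<bar>u x - u c\<bar> \<le> r / 2"
          using d(2)[of x] N[OF that] x by (simp add: dist_real_def)
        from mult_right_mono[OF this w0[of n x]] show ?thesis using w0[of n x] by (simp add: abs_mult)
      qed simp
    qed (use i in auto)
    also have "\<dots> = r / 2" by (simp add: w1)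
    finally show ?thesis using \<open>r > 0\<close> by simp
  qed
  then show "\<exists>N. \<forall>n\<ge>N. norm ((LINT x|?M. u x * (s' ((x - c) / \<epsilon> n) / \<epsilon> n)) - u c) < r"
    unfolding w_def by blast
qed

text \<open>Left of \<open>x1 - \<epsilon>\<close> both steps are 0 and right of
  \<open>x2 + \<epsilon>\<close> both are 1, so the difference has its support in a compact
  subinterval.\<close>

lemma plateau_test_function:
  assumes s: "smooth_real s" "\<And>x. x \<le> -1 \<Longrightarrow> s x = 0" "\<And>x. x \<ge> 1 \<Longrightarrow> s x = 1"
    and "\<epsilon> > 0" "a < x1 - \<epsilon>" "x1 \<le> x2" "x2 + \<epsilon> < b"
  shows "(\<lambda>x. s ((x - x1) / \<epsilon>) - s ((x - x2) / \<epsilon>)) \<in> test_functions {a<..<b}"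
proof -
  let ?\<psi> = "\<lambda>x. s ((x - x1) / \<epsilon>) - s ((x - x2) / \<epsilon>)"
  have "smooth_real (\<lambda>x. 1 * s ((1 / \<epsilon>) * x + (- x1 / \<epsilon>)) + (-1) * s ((1 / \<epsilon>) * x + (- x2 / \<epsilon>)))"
    by (rule smooth_real_lin_comb[OF s(1) s(1)])
  then have smooth: "smooth_real ?\<psi>" by (simp add: diff_divide_distrib)
  have "?\<psi> x = 0" if "x \<notin> {x1 - \<epsilon>..x2 + \<epsilon>}" for x
  proof (cases "x < x1 - \<epsilon>")
    case True
    then have "(x - x1) / \<epsilon> \<le> -1" "(x - x2) / \<epsilon> \<le> -1" using assms(4,6) by (simp_all add: field_simps)
    then show ?thesis using s(2) by simp
  next
    case False
    then have "(x - x1) / \<epsilon> \<ge> 1" "(x - x2) / \<epsilon> \<ge> 1" using that assms(4,6) by (simp_all add: field_simps)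
    then show ?thesis using s(3) by simp
  qed
  then have "{x. ?\<psi> x \<noteq> 0} \<subseteq> {x1 - \<epsilon>..x2 + \<epsilon>}" by blast
  then have sub: "closure {x. ?\<psi> x \<noteq> 0} \<subseteq> {x1 - \<epsilon>..x2 + \<epsilon>}" by (intro closure_minimal) auto
  then have "compact (closure {x. ?\<psi> x \<noteq> 0})"
    using bounded_subset[OF bounded_closed_interval[of "x1 - \<epsilon>" "x2 + \<epsilon>"]] by (auto simp: compact_eq_bounded_closed cbox_interval)
  moreover have "closure {x. ?\<psi> x \<noteq> 0} \<subseteq> {a<..<b}"
  proof (rule order_trans[OF sub])
    show "{x1 - \<epsilon>..x2 + \<epsilon>} \<subseteq> {a<..<b}" using assms(4-7) by auto
  qed
  ultimately show ?thesis using smooth unfolding test_functions_def smooth_real_def by blast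
qed

section \<open>Weak derivatives\<close>

lemma integrable_indicator_lebesgue_on:
  fixes k :: "real \<Rightarrow> real"
  assumes "A \<in> sets lebesgue" "integrable (lebesgue_on S) k"
  shows "integrable (lebesgue_on S) (\<lambda>t. indicator A t * k t)"
proof -
  have "indicator A \<in> borel_measurable (lebesgue_on S)"
    using assms(1) by (intro measurable_restrict_space1 borel_measurable_indicator)
  then have "integrable (lebesgue_on S) (\<lambda>t. k t * indicator A t)"
    by (rule integrable_mult_bounded[OF assms(2), of _ 1]) (simp add: indicator_def)
  then show ?thesis by (simp add: mult.commute)
qed

text \<open>Test the weak derivative with smooth approximations of the indicator of \<open>{x1..x2}\<close>.\<close>

lemma weak_deriv_increment:
  assumes \<phi>: "\<phi> \<in> L2 {a<..<b}" "has_L2_weak_deriv {a<..<b} \<phi> g"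
    and u: "continuous_on {a..b} u" "eq_L2 {a<..<b} \<phi> u"
    and x: "a < x1" "x1 < x2" "x2 < b"
  shows "u x2 - u x1 = (LINT t|lebesgue_on {a<..<b}. indicator {x1..x2} t * g t)"
proof -
  let ?M = "lebesgue_on {a<..<b}"
  obtain s s' where s: "smooth_real s" "\<And>x. (s has_real_derivative s' x) (at x)"
    "\<And>x. s' x \<ge> 0" "\<And>x. \<bar>x\<bar> \<ge> 1 \<Longrightarrow> s' x = 0" "\<And>x. x \<le> -1 \<Longrightarrow> s x = 0" "\<And>x. x \<ge> 1 \<Longrightarrow> s x = 1"
    "\<And>x. 0 \<le> s x" "\<And>x. s x \<le> 1" "continuous_on UNIV s'"
    using smooth_step_exists by blast
  \<comment> \<open>Half the distance to the nearer endpoint, so that every plateau of width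
    parameter at most \<open>\<delta>\<close> stays supported inside the interval.\<close>
  define \<delta> where "\<delta> = min (x1 - a) (b - x2) / 2"
  have \<delta>: "\<delta> > 0" "a < x1 - \<delta>" "x2 + \<delta> < b" using x by (auto simp: \<delta>_def min_def field_simps)
  define \<epsilon> where "\<epsilon> n = \<delta> / real (Suc n)" for n
  have \<epsilon>0: "\<epsilon> n > 0" for n using \<delta> by (simp add: \<epsilon>_def)
  have \<epsilon>le: "\<epsilon> n \<le> \<delta>" for n using \<delta> by (simp add: \<epsilon>_def divide_le_eq mult_le_cancel_left1)
  have \<epsilon>lim: "\<epsilon> \<longlonglongrightarrow> 0"
    using tendsto_mult_right_zero[OF LIMSEQ_Suc[OF lim_1_over_n], of \<delta>] by (simp add: \<epsilon>_def[abs_def])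
  define \<psi> where "\<psi> n x = s ((x - x1) / \<epsilon> n) - s ((x - x2) / \<epsilon> n)" for n x
  have \<psi>: "\<psi> n \<in> test_functions {a<..<b}" for n
    unfolding \<psi>_def[abs_def]
    by (rule plateau_test_function[OF s(1,5,6) \<epsilon>0]) (use \<delta> \<epsilon>le[of n] x in linarith)+
  have s_scaled: "((\<lambda>x. s ((x - c) / \<epsilon> n)) has_real_derivative s' ((x - c) / \<epsilon> n) / \<epsilon> n) (at x)" for c n x
  proof -
    have "((\<lambda>x. s ((x - c) / \<epsilon> n)) has_real_derivative s' ((x - c) / \<epsilon> n) * (1 / \<epsilon> n)) (at x)"
      using \<epsilon>0[of n] by (intro DERIV_chain2[OF s(2)]) (auto intro!: derivative_eq_intros)
    then show ?thesis by simp
  qed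
  \<comment> \<open>A mollifier at \<open>x1\<close> minus a mollifier at \<open>x2\<close>: the
    left side of the weak identity therefore tends to \<open>u x1 - u x2\<close>.\<close>
  have deriv: "deriv (\<psi> n) x = s' ((x - x1) / \<epsilon> n) / \<epsilon> n - s' ((x - x2) / \<epsilon> n) / \<epsilon> n" for n x
    unfolding \<psi>_def[abs_def] by (intro DERIV_imp_deriv DERIV_diff s_scaled)
  have wc: "continuous_on A (\<lambda>x. s' ((x - c) / \<epsilon> n) / \<epsilon> n)" for c n A
    using \<epsilon>0[of n] by (auto intro!: continuous_intros continuous_on_compose2[OF s(9)])
  have "(LINT x|?M. \<phi> x * deriv (\<psi> n) x)
     = (LINT x|?M. u x * (s' ((x - x1) / \<epsilon> n) / \<epsilon> n)) - (LINT x|?M. u x * (s' ((x - x2) / \<epsilon> n) / \<epsilon> n))" for n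
  proof -
    have "(LINT x|?M. \<phi> x * deriv (\<psi> n) x) = (LINT x|?M. u x * deriv (\<psi> n) x)"
    proof (rule integral_cong_AE)
      show "AE x in ?M. \<phi> x * deriv (\<psi> n) x = u x * deriv (\<psi> n) x"
        using u(2) unfolding eq_L2_def by eventually_elim simp
      show "(\<lambda>x. \<phi> x * deriv (\<psi> n) x) \<in> borel_measurable ?M"
        by (rule borel_measurable_integrable[OF integrable_mult_continuous_Ioo])
          (use L2_integrable[OF \<phi>(1)] test_function_deriv(3)[OF \<psi>] in auto)
      show "(\<lambda>x. u x * deriv (\<psi> n) x) \<in> borel_measurable ?M"
        by (rule borel_measurable_integrable[OF integrable_mult_continuous_Ioo])
          (use continuous_integrable_Ioo[OF u(1)] test_function_deriv(3)[OF \<psi>] in auto)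
    qed
    also have "\<dots> = (LINT x|?M. u x * (s' ((x - x1) / \<epsilon> n) / \<epsilon> n) - u x * (s' ((x - x2) / \<epsilon> n) / \<epsilon> n))"
      by (simp only: deriv right_diff_distrib)
    also have "\<dots> = (LINT x|?M. u x * (s' ((x - x1) / \<epsilon> n) / \<epsilon> n)) - (LINT x|?M. u x * (s' ((x - x2) / \<epsilon> n) / \<epsilon> n))"
      by (intro Bochner_Integration.integral_diff integrable_mult_continuous_Ioo continuous_integrable_Ioo u wc)
    finally show ?thesis .
  qed
  moreover have "(\<lambda>n. (LINT x|?M. u x * (s' ((x - x1) / \<epsilon> n) / \<epsilon> n)) - (LINT x|?M. u x * (s' ((x - x2) / \<epsilon> n) / \<epsilon> n)))
      \<longlonglongrightarrow> u x1 - u x2"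
  proof (rule tendsto_diff)
    have "\<epsilon> n \<le> x1 - a" "\<epsilon> n \<le> b - x1" "\<epsilon> n \<le> x2 - a" "\<epsilon> n \<le> b - x2" for n
      using \<epsilon>le[of n] \<delta> x by linarith+
    then show "(\<lambda>n. LINT x|?M. u x * (s' ((x - x1) / \<epsilon> n) / \<epsilon> n)) \<longlonglongrightarrow> u x1"
      and "(\<lambda>n. LINT x|?M. u x * (s' ((x - x2) / \<epsilon> n) / \<epsilon> n)) \<longlonglongrightarrow> u x2"
      using x by (intro approximate_identity[OF u(1) _ _ s(2,3,4,5,6,9) \<epsilon>0 \<epsilon>lim]; simp)+
  qed
  ultimately have lim1: "(\<lambda>n. LINT x|?M. \<phi> x * deriv (\<psi> n) x) \<longlonglongrightarrow> u x1 - u x2" by simp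
  have g: "g \<in> L2 {a<..<b}" using \<phi>(2) by (simp add: has_L2_weak_deriv_def)
  have "(\<lambda>n. LINT x|?M. g x * \<psi> n x) \<longlonglongrightarrow> (LINT t|?M. indicator {x1..x2} t * g t)"
  proof (rule integral_dominated_convergence[where w = "\<lambda>t. \<bar>g t\<bar>"])
    show "(\<lambda>t. indicator {x1..x2} t * g t) \<in> borel_measurable ?M"
      using integrable_indicator_lebesgue_on[OF _ L2_integrable[OF g]] by (intro borel_measurable_integrable) simp
    show "(\<lambda>t. g t * \<psi> n t) \<in> borel_measurable ?M" for n
      by (rule borel_measurable_integrable[OF integrable_mult_continuous_Ioo])
        (use L2_integrable[OF g] test_function_deriv(2)[OF \<psi>] in auto)
    show "integrable ?M (\<lambda>t. \<bar>g t\<bar>)" using L2_integrable[OF g] by simp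
    have "\<bar>\<psi> n t\<bar> \<le> 1" for n t
      using s(7,8)[of "(t - x1) / \<epsilon> n"] s(7,8)[of "(t - x2) / \<epsilon> n"] unfolding \<psi>_def by linarith
    then show "AE t in ?M. norm (g t * \<psi> n t) \<le> \<bar>g t\<bar>" for n
      by (intro AE_I2) (simp add: abs_mult mult_left_le)
    \<comment> \<open>At \<open>t = x1\<close> or \<open>t = x2\<close> one of the steps is
      evaluated at 0 for every \<open>n\<close>, where its value is not prescribed; these two points
      form a null set.\<close>
    have ptw: "(\<lambda>n. g t * \<psi> n t) \<longlonglongrightarrow> indicator {x1..x2} t * g t" if t: "t \<noteq> x1" "t \<noteq> x2" for t
    proof (rule tendsto_eventually)
      have step: "\<forall>\<^sub>F n in sequentially. s ((t - c) / \<epsilon> n) = (if t < c then 0 else 1)" if "t \<noteq> c" for c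
      proof -
        have "\<forall>\<^sub>F n in sequentially. \<epsilon> n < \<bar>t - c\<bar>"
          using \<epsilon>lim that by (intro order_tendstoD(2)) auto
        then show ?thesis
        proof eventually_elim
          case (elim n)
          show ?case
          proof (cases "t < c")
            case True
            then have "(t - c) / \<epsilon> n \<le> -1" using elim \<epsilon>0[of n] by (simp add: field_simps)
            then show ?thesis using s(5) True by simp
          next
            case False
            then have "(t - c) / \<epsilon> n \<ge> 1" using elim \<epsilon>0[of n] by (simp add: field_simps)
            then show ?thesis using s(6) False by simp
          qed
        qed
      qed
      show "\<forall>\<^sub>F n in sequentially. g t * \<psi> n t = indicator {x1..x2} t * g t"
        using step[OF t(1)] step[OF t(2)]
        by eventually_elim (use x t in \<open>auto simp: \<psi>_def indicator_def\<close>)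
    qed
    have "AE t in ?M. t \<noteq> x1" "AE t in ?M. t \<noteq> x2" by (rule AE_lebesgue_on_neq; simp)+
    then show "AE t in ?M. (\<lambda>n. g t * \<psi> n t) \<longlonglongrightarrow> indicator {x1..x2} t * g t"
      by eventually_elim (rule ptw)
  qed
  then have "(\<lambda>n. LINT x|?M. \<phi> x * deriv (\<psi> n) x) \<longlonglongrightarrow> - (LINT t|?M. indicator {x1..x2} t * g t)"
    using \<phi>(2) \<psi> by (simp add: has_L2_weak_deriv_def tendsto_minus)
  from LIMSEQ_unique[OF lim1 this] show ?thesis by simp
qed

lemma AE_zero_of_integral_lessThan_on:
  fixes d :: "real \<Rightarrow> real"
  assumes S: "S \<in> sets lebesgue" and d: "integrable (lebesgue_on S) d"
    and zero: "\<And>x. (LINT t|lebesgue_on S. indicator {..<x} t * d t) = 0"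
  shows "AE x in lebesgue_on S. d x = 0"
proof -
  have "(LINT t|lebesgue. indicator {..<x} t * (indicator S t * d t)) = (LINT t|lebesgue_on S. indicator {..<x} t * d t)" for x
    using S by (subst integral_restrict_space) (auto simp: mult_ac)
  then have "AE x in lebesgue. indicator S x * d x = 0"
    by (intro AE_zero_of_integral_lessThan) (use d S zero in \<open>simp_all add: integrable_restrict_space\<close>)
  then show ?thesis using S by (subst AE_restrict_space_iff) (auto simp: indicator_def)
qed

text \<open>Compact subintervals exhaust \<open>{a<..<x}\<close>, so dominated convergence reduces
  the claim to the criterion with half-lines.\<close>

lemma AE_zero_of_interval_integrals:
  fixes d :: "real \<Rightarrow> real"
  assumes d: "integrable (lebesgue_on {a<..<b}) d"
    and zero: "\<And>x1 x2. a < x1 \<Longrightarrow> x1 < x2 \<Longrightarrow> x2 < b \<Longrightarrow> (LINT t|lebesgue_on {a<..<b}. indicator {x1..x2} t * d t) = 0"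
  shows "AE x in lebesgue_on {a<..<b}. d x = 0"
proof -
  let ?M = "lebesgue_on {a<..<b}"
  have main: "(LINT t|?M. indicator {..<x} t * d t) = 0" if x: "a < x" "x \<le> b" for x
  proof -
    \<comment> \<open>The shift by 3 keeps \<open>r n\<close> at most a third of the length, so
      \<open>a + r n < x - r n\<close> holds from \<open>n = 0\<close> on.\<close>
    define r where "r n = (x - a) / real (n + 3)" for n
    have r0: "r n > 0" for n using x by (simp add: r_def)
    have r3: "r n \<le> (x - a) / 3" for n unfolding r_def using x by (intro divide_left_mono) auto
    have "(\<lambda>n. (x - a) * (1 / real (n + 3))) \<longlonglongrightarrow> 0"
      by (intro tendsto_mult_right_zero LIMSEQ_ignore_initial_segment[OF lim_1_over_n])
    then have rlim: "r \<longlonglongrightarrow> 0" by (simp add: r_def[abs_def])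
    have "(\<lambda>n. LINT t|?M. indicator {a + r n..x - r n} t * d t) \<longlonglongrightarrow> (LINT t|?M. indicator {..<x} t * d t)"
    proof (rule integral_dominated_convergence[where w = "\<lambda>t. \<bar>d t\<bar>"])
      show "AE t in ?M. (\<lambda>n. indicator {a + r n..x - r n} t * d t) \<longlonglongrightarrow> indicator {..<x} t * d t"
      proof (rule AE_I2)
        fix t assume t: "t \<in> space ?M"
        show "(\<lambda>n. indicator {a + r n..x - r n} t * d t) \<longlonglongrightarrow> indicator {..<x} t * d t"
        proof (rule tendsto_eventually, cases "t < x")
          case True
          have "\<forall>\<^sub>F n in sequentially. r n < min (t - a) (x - t)"
            using rlim True t by (intro order_tendstoD(2)) auto
          then show "\<forall>\<^sub>F n in sequentially. indicator {a + r n..x - r n} t * d t = indicator {..<x} t * d t"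
            by eventually_elim (use True in auto)
        next
          case False
          have "t \<notin> {a + r n..x - r n}" for n using r0[of n] False by auto
          then show "\<forall>\<^sub>F n in sequentially. indicator {a + r n..x - r n} t * d t = indicator {..<x} t * d t"
            using False by simp
        qed
      qed
      have "(\<lambda>t. indicator A t * d t) \<in> borel_measurable ?M" if "A \<in> sets lebesgue" for A
        using integrable_indicator_lebesgue_on[OF that d] by (rule borel_measurable_integrable)
      then show "(\<lambda>t. indicator {..<x} t * d t) \<in> borel_measurable ?M"
        "(\<lambda>t. indicator {a + r n..x - r n} t * d t) \<in> borel_measurable ?M" for n by simp_all
    qed (use d in \<open>auto simp: indicator_def\<close>)
    moreover have "(LINT t|?M. indicator {a + r n..x - r n} t * d t) = 0" for n
      using r0[of n] r3[of n] x by (intro zero) auto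
    ultimately show ?thesis by (simp add: LIMSEQ_const_iff)
  qed
  have "(LINT t|?M. indicator {..<x} t * d t) = 0" for x
  proof -
    have "(LINT t|?M. indicator {..<x} t * d t) = (LINT t|?M. indicator {..<min x b} t * d t)"
      by (intro Bochner_Integration.integral_cong) (auto simp: indicator_def)
    also have "\<dots> = 0"
    proof (cases "a < min x b")
      case False
      then have "(LINT t|?M. indicator {..<min x b} t * d t) = (LINT t|?M. 0)"
        by (intro Bochner_Integration.integral_cong) (auto simp: indicator_def)
      then show ?thesis by simp
    qed (use main in auto)
    finally show ?thesis .
  qed
  then show ?thesis by (intro AE_zero_of_integral_lessThan_on d) auto
qed

section \<open>The Sobolev space on an interval: norm, embedding and completeness\<close>

lemma W012_Ioo_iff:
  assumes "a < b"
  shows "\<phi> \<in> W012 {a<..<b} \<longleftrightarrow> \<phi> \<in> L2 {a<..<b} \<and> (\<exists>g. has_L2_weak_deriv {a<..<b} \<phi> g) \<and>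
     (\<exists>u. continuous_on {a..b} u \<and> eq_L2 {a<..<b} \<phi> u \<and> u a = 0 \<and> u b = 0)"
proof -
  have "frontier {a<..<b} = {a, b}" "closure {a<..<b} = {a..b}"
    using assms by (auto simp: frontier_def closure_greaterThanLessThan interior_open)
  then show ?thesis by (simp add: W012_def)
qed

text \<open>Both derivatives integrate to the same increment of the continuous representative over
  every inner interval. This is what makes the choice in \<open>weak_deriv\<close> harmless.\<close>

lemma weak_deriv_unique:
  assumes ab: "a < b" and \<phi>: "\<phi> \<in> W012 {a<..<b}" and g: "has_L2_weak_deriv {a<..<b} \<phi> g" "has_L2_weak_deriv {a<..<b} \<phi> g'"
  shows "eq_L2 {a<..<b} g g'"
proof -
  let ?M = "lebesgue_on {a<..<b}"
  obtain u where u: "continuous_on {a..b} u" "eq_L2 {a<..<b} \<phi> u" and L: "\<phi> \<in> L2 {a<..<b}"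
    using \<phi> W012_Ioo_iff[OF ab] by blast
  have i: "integrable ?M g" "integrable ?M g'"
    using g by (auto simp: has_L2_weak_deriv_def intro: L2_integrable)
  have ind: "integrable ?M (\<lambda>t. indicator {x1..x2} t * k t)" if "integrable ?M k" for x1 x2 and k :: "real \<Rightarrow> real"
    by (rule integrable_indicator_lebesgue_on[OF _ that]) simp
  have "AE x in ?M. g x - g' x = 0"
  proof (rule AE_zero_of_interval_integrals)
    fix x1 x2 :: real assume x: "a < x1" "x1 < x2" "x2 < b"
    show "(LINT t|?M. indicator {x1..x2} t * (g t - g' t)) = 0"
      using weak_deriv_increment[OF L g(1) u x] weak_deriv_increment[OF L g(2) u x] ind i
      by (simp add: right_diff_distrib)
  qed (use i in auto)
  then show ?thesis by (simp add: eq_L2_def)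
qed

lemma has_weak_deriv: "\<phi> \<in> W012 K \<Longrightarrow> has_L2_weak_deriv K \<phi> (weak_deriv K \<phi>)"
  using someI_ex[of "has_L2_weak_deriv K \<phi>"] by (simp add: weak_deriv_def W012_def)

text \<open>The representative chosen by \<open>weak_deriv\<close> is inaccessible; here any weak
  derivative at hand may compute the norm.\<close>

lemma W012_norm_eq:
  assumes "a < b" "\<phi> \<in> W012 {a<..<b}" "has_L2_weak_deriv {a<..<b} \<phi> g"
  shows "W012_norm {a<..<b} \<phi> = sqrt (LINT x|lebesgue_on {a<..<b}. (g x)\<^sup>2)"
proof -
  note w = has_weak_deriv[OF assms(2)]
  have "(LINT x|lebesgue_on {a<..<b}. (weak_deriv {a<..<b} \<phi> x)\<^sup>2) = (LINT x|lebesgue_on {a<..<b}. (g x)\<^sup>2)"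
  proof (rule integral_cong_AE)
    show "AE x in lebesgue_on {a<..<b}. (weak_deriv {a<..<b} \<phi> x)\<^sup>2 = (g x)\<^sup>2"
      using weak_deriv_unique[OF assms(1,2) w assms(3)] unfolding eq_L2_def by eventually_elim simp
  qed (use w assms(3) in \<open>auto simp: has_L2_weak_deriv_def L2_def\<close>)
  then show ?thesis by (simp add: W012_norm_def L2_norm_def L2_inner_def power2_eq_square)
qed

text \<open>The one-dimensional Sobolev embedding: starting from the zero at \<open>a\<close>, the
  increment formula bounds the continuous representative by the total mass of the
  derivative.\<close>

lemma W012_abs_le:
  assumes ab: "a < b" and \<phi>: "\<phi> \<in> L2 {a<..<b}" "has_L2_weak_deriv {a<..<b} \<phi> g"
    and u: "continuous_on {a..b} u" "eq_L2 {a<..<b} \<phi> u" "u a = 0" "u b = 0"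
    and x: "x \<in> {a..b}"
  shows "\<bar>u x\<bar> \<le> (LINT t|lebesgue_on {a<..<b}. \<bar>g t\<bar>)"
proof (cases "x = a \<or> x = b")
  case False
  let ?M = "lebesgue_on {a<..<b}"
  have gi: "integrable ?M g" using \<phi> by (auto simp: has_L2_weak_deriv_def intro: L2_integrable)
  have x: "a < x" "x < b" using x False by auto
  have "\<bar>u x - u a\<bar> \<le> (LINT t|?M. \<bar>g t\<bar>)"
  \<comment> \<open>The increment formula speaks of interior points only; the endpoint
    \<open>a\<close> is reached by continuity in \<open>y\<close>.\<close>
  proof (rule continuous_le_on_closure[where S = "{a<..<x}" and f = "\<lambda>y. \<bar>u x - u y\<bar>"])
    show "continuous_on (closure {a<..<x}) (\<lambda>y. \<bar>u x - u y\<bar>)"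
      using x by (auto intro!: continuous_intros continuous_on_subset[OF u(1)])
    show "a \<in> closure {a<..<x}" using x by simp
    fix y assume y: "y \<in> {a<..<x}"
    then have "\<bar>u x - u y\<bar> = \<bar>LINT t|?M. indicator {y..x} t * g t\<bar>"
      using weak_deriv_increment[OF \<phi> u(1,2)] x by simp
    also have "\<dots> \<le> (LINT t|?M. \<bar>indicator {y..x} t * g t\<bar>)" by (rule integral_abs_bound)
    also have "\<dots> \<le> (LINT t|?M. \<bar>g t\<bar>)"
      using gi by (intro integral_mono') (auto simp: indicator_def)
    finally show "\<bar>u x - u y\<bar> \<le> (LINT t|?M. \<bar>g t\<bar>)" .
  qed
  then show ?thesis using u by simp
qed (use u in auto)


text \<open>Classical integration by parts: the boundary terms vanish, so the ordinary derivative is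
  a weak one.\<close>

lemma test_function_W012:
  assumes ab: "a < b" and \<psi>: "\<psi> \<in> test_functions {a<..<b}"
  shows "has_L2_weak_deriv {a<..<b} \<psi> (deriv \<psi>)" and "\<psi> \<in> W012 {a<..<b}"
proof -
  let ?M = "lebesgue_on {a<..<b}"
  note D = test_function_deriv
  have z: "\<psi> a = 0" "\<psi> b = 0" using test_function_zero[OF \<psi>] by auto
  show w: "has_L2_weak_deriv {a<..<b} \<psi> (deriv \<psi>)"
    unfolding has_L2_weak_deriv_def
  proof (intro conjI ballI continuous_L2_Ioo D(3)[OF \<psi>])
    fix \<eta> assume \<eta>: "\<eta> \<in> test_functions {a<..<b}"
    have "(LINT x|?M. \<psi> x * deriv \<eta> x + deriv \<psi> x * \<eta> x) = \<psi> b * \<eta> b - \<psi> a * \<eta> a"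
      by (rule integral_derivative_Ioo)
        (use ab in \<open>auto intro!: continuous_intros D(2,3)[OF \<psi>] D(2,3)[OF \<eta>] derivative_eq_intros D(1)[OF \<psi>] D(1)[OF \<eta>]\<close>)
    moreover have "(LINT x|?M. \<psi> x * deriv \<eta> x + deriv \<psi> x * \<eta> x)
        = (LINT x|?M. \<psi> x * deriv \<eta> x) + (LINT x|?M. deriv \<psi> x * \<eta> x)"
      by (intro Bochner_Integration.integral_add continuous_integrable_Ioo continuous_intros D(2,3)[OF \<psi>] D(2,3)[OF \<eta>])
    ultimately show "(LINT x|?M. \<psi> x * deriv \<eta> x) = - (LINT x|?M. deriv \<psi> x * \<eta> x)"
      using z by simp
  qed
  show "\<psi> \<in> W012 {a<..<b}"
    unfolding W012_Ioo_iff[OF ab]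
  proof (intro conjI exI)
    show "\<psi> \<in> L2 {a<..<b}" by (rule continuous_L2_Ioo[OF D(2)[OF \<psi>]])
    show "eq_L2 {a<..<b} \<psi> \<psi>" by (simp add: eq_L2_def)
  qed (use w z D(2)[OF \<psi>] in auto)
qed

lemma W012_lin_comb:
  assumes ab: "a < b" and f: "f \<in> W012 {a<..<b}" and g: "g \<in> W012 {a<..<b}"
  shows "(\<lambda>x. p * f x + q * g x) \<in> W012 {a<..<b}"
proof -
  obtain f' u where f: "f \<in> L2 {a<..<b}" "has_L2_weak_deriv {a<..<b} f f'"
     "continuous_on {a..b} u" "eq_L2 {a<..<b} f u" "u a = 0" "u b = 0"
    using f unfolding W012_Ioo_iff[OF ab] by blast
  obtain g' v where g: "g \<in> L2 {a<..<b}" "has_L2_weak_deriv {a<..<b} g g'"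
     "continuous_on {a..b} v" "eq_L2 {a<..<b} g v" "v a = 0" "v b = 0"
    using g unfolding W012_Ioo_iff[OF ab] by blast
  show ?thesis
    unfolding W012_Ioo_iff[OF ab]
  proof (intro conjI exI)
    show "(\<lambda>x. p * f x + q * g x) \<in> L2 {a<..<b}" by (rule L2_lin_comb_real[OF f(1) g(1)])
    show "has_L2_weak_deriv {a<..<b} (\<lambda>x. p * f x + q * g x) (\<lambda>x. p * f' x + q * g' x)"
      by (rule has_L2_weak_deriv_lin_comb[OF f(2) g(2) f(1) g(1)])
    show "continuous_on {a..b} (\<lambda>x. p * u x + q * v x)" by (intro continuous_intros f g)
    show "eq_L2 {a<..<b} (\<lambda>x. p * f x + q * g x) (\<lambda>x. p * u x + q * v x)"
      using f(4) g(4) unfolding eq_L2_def by eventually_elim simp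
  qed (use f g in auto)
qed

lemma zero_W012: "a < b \<Longrightarrow> (\<lambda>_. 0) \<in> W012 {a<..<b}"
  and zero_weak_deriv: "has_L2_weak_deriv {a<..<b} (\<lambda>_. 0) (\<lambda>_. 0)"
proof -
  have L: "(\<lambda>_. 0 :: real) \<in> L2 {a<..<b}" by (simp add: L2_def)
  then show w: "has_L2_weak_deriv {a<..<b} (\<lambda>_. 0) (\<lambda>_. 0)" by (simp add: has_L2_weak_deriv_def)
  assume "a < b"
  then show "(\<lambda>_. 0) \<in> W012 {a<..<b}"
    unfolding W012_Ioo_iff[OF \<open>a < b\<close>]
    using L w by (intro conjI exI[of _ "\<lambda>_. 0"]) (auto simp: eq_L2_def)
qed

text \<open>The derivatives converge in L2 to some \<open>g\<close>. By the embedding the continuous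
  representatives converge uniformly, which preserves continuity and the boundary zeros, and L1
  convergence on both sides carries the weak identity to the limit.\<close>

lemma W012_complete:
  fixes X G :: "nat \<Rightarrow> real \<Rightarrow> real"
  assumes ab: "a < b" and X: "\<And>n. X n \<in> W012 {a<..<b}"
    and G: "\<And>n. has_L2_weak_deriv {a<..<b} (X n) (G n)"
    and Cauchy: "\<And>\<epsilon>. \<epsilon> > 0 \<Longrightarrow> \<exists>n0. \<forall>m\<ge>n0. \<forall>n\<ge>n0. (LINT x|lebesgue_on {a<..<b}. (G m x - G n x)\<^sup>2) < \<epsilon>"
  shows "\<exists>\<phi> g. \<phi> \<in> W012 {a<..<b} \<and> has_L2_weak_deriv {a<..<b} \<phi> g \<and>
     (\<lambda>n. LINT x|lebesgue_on {a<..<b}. (G n x - g x)\<^sup>2) \<longlonglongrightarrow> 0 \<and>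
     (\<lambda>n. LINT x|lebesgue_on {a<..<b}. \<bar>X n x - \<phi> x\<bar>) \<longlonglongrightarrow> 0"
proof -
  let ?M = "lebesgue_on {a<..<b}"
  interpret finite_measure ?M by simp
  define c where "c = sqrt (b - a)"
  have c: "c > 0" using ab by (simp add: c_def)
  have GL: "G n \<in> L2 {a<..<b}" for n using G by (simp add: has_L2_weak_deriv_def)
  obtain g where g: "g \<in> borel_measurable ?M" "integrable ?M (\<lambda>x. (g x)\<^sup>2)"
    and glim: "(\<lambda>n. LINT x|?M. (G n x - g x)\<^sup>2) \<longlonglongrightarrow> 0"
    using L2_Cauchy_has_limit[OF L2_measurable[OF GL] L2_square_real[OF GL] Cauchy] by blast
  have gL: "g \<in> L2 {a<..<b}" using g by (simp add: L2_def)
  have "\<exists>u. continuous_on {a..b} u \<and> eq_L2 {a<..<b} (X n) u \<and> u a = 0 \<and> u b = 0" for n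
    using X[of n] unfolding W012_Ioo_iff[OF ab] by blast
  then obtain U where U: "\<And>n. continuous_on {a..b} (U n)" "\<And>n. eq_L2 {a<..<b} (X n) (U n)"
    "\<And>n. U n a = 0" "\<And>n. U n b = 0" by metis
  have XL: "X n \<in> L2 {a<..<b}" for n using X[of n] by (simp add: W012_def)
  have Udiff: "\<bar>U m x - U n x\<bar> \<le> c * sqrt (LINT x|?M. (G m x - G n x)\<^sup>2)" if "x \<in> {a..b}" for m n x
  proof -
    have "\<bar>U m x - U n x\<bar> \<le> (LINT t|?M. \<bar>1 * G m t + (-1) * G n t\<bar>)"
    proof (rule W012_abs_le[OF ab, where u = "\<lambda>x. U m x - U n x"])
      show "(\<lambda>x. 1 * X m x + (-1) * X n x) \<in> L2 {a<..<b}" by (rule L2_lin_comb_real[OF XL XL])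
      show "has_L2_weak_deriv {a<..<b} (\<lambda>x. 1 * X m x + (-1) * X n x) (\<lambda>t. 1 * G m t + (-1) * G n t)"
        by (rule has_L2_weak_deriv_lin_comb[OF G G XL XL])
      show "eq_L2 {a<..<b} (\<lambda>x. 1 * X m x + (-1) * X n x) (\<lambda>x. U m x - U n x)"
        using U(2)[of m] U(2)[of n] unfolding eq_L2_def by eventually_elim simp
      show "continuous_on {a..b} (\<lambda>x. U m x - U n x)" by (intro continuous_intros U)
    qed (use U that in auto)
    also have "\<dots> \<le> c * sqrt (LINT x|?M. (G m x - G n x)\<^sup>2)"
      using L2_abs_le[OF less_imp_le[OF ab] L2_diff[OF GL GL], of m n] by (simp add: c_def)
    finally show ?thesis .
  qed
  have "uniformly_Cauchy_on {a..b} U"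
    unfolding uniformly_Cauchy_on_def
  proof (intro allI impI)
    fix e :: real assume "e > 0"
    then have "(e / c)\<^sup>2 > 0" using c by simp
    from Cauchy[OF this] obtain n0 where n0: "\<forall>m\<ge>n0. \<forall>n\<ge>n0. (LINT x|?M. (G m x - G n x)\<^sup>2) < (e / c)\<^sup>2" by blast
    have "dist (U m x) (U n x) < e" if "x \<in> {a..b}" "m \<ge> n0" "n \<ge> n0" for x m n
    proof -
      have "sqrt (LINT x|?M. (G m x - G n x)\<^sup>2) < sqrt ((e / c)\<^sup>2)"
        using n0 that by (intro real_sqrt_less_mono) blast
      then have "c * sqrt (LINT x|?M. (G m x - G n x)\<^sup>2) < e"
        using c \<open>e > 0\<close> pos_less_divide_eq[OF c] by (simp add: mult.commute del: real_sqrt_less_iff)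
      then show ?thesis using Udiff[OF that(1), of m n] by (simp add: dist_real_def)
    qed
    then show "\<exists>M. \<forall>x\<in>{a..b}. \<forall>m\<ge>M. \<forall>n\<ge>M. dist (U m x) (U n x) < e" by blast
  qed
  then obtain \<phi> where \<phi>: "uniform_limit {a..b} U \<phi> sequentially"
    using Cauchy_uniformly_convergent uniformly_convergent_on_def by blast
  have \<phi>c: "continuous_on {a..b} \<phi>"
    by (rule uniform_limit_theorem[OF _ \<phi>]) (use U in auto)
  have "\<phi> x = 0" if "x \<in> {a, b}" for x
  proof -
    have "(\<lambda>n. U n x) \<longlonglongrightarrow> \<phi> x" using tendsto_uniform_limitI[OF \<phi>] that ab by auto
    then show ?thesis using U(3,4) that by (auto simp: LIMSEQ_const_iff)
  qed
  then have \<phi>0: "\<phi> a = 0" "\<phi> b = 0" by auto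
  have \<phi>L: "\<phi> \<in> L2 {a<..<b}" by (rule continuous_L2_Ioo[OF \<phi>c])
  have Xlim: "(\<lambda>n. LINT x|?M. \<bar>X n x - \<phi> x\<bar>) \<longlonglongrightarrow> 0"
  proof (rule LIMSEQ_I)
    fix r :: real assume "r > 0"
    have cancel: "d * (r / (2 * d)) = r / 2" if "d \<noteq> 0" for d :: real using that by simp
    define e where "e = r / (2 * (b - a))"
    have e: "e > 0" using \<open>r > 0\<close> ab by (simp add: e_def)
    obtain n0 where n0: "\<And>n x. n \<ge> n0 \<Longrightarrow> x \<in> {a..b} \<Longrightarrow> dist (U n x) (\<phi> x) < e"
      using uniform_limitD[OF \<phi> e] unfolding eventually_sequentially by blast
    have "norm ((LINT x|?M. \<bar>X n x - \<phi> x\<bar>) - 0) < r" if "n \<ge> n0" for n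
    proof -
      have "(LINT x|?M. \<bar>X n x - \<phi> x\<bar>) \<le> (LINT x|?M. e)"
      proof (rule integral_mono_AE)
        show "integrable ?M (\<lambda>x. \<bar>X n x - \<phi> x\<bar>)"
          using L2_integrable[OF XL] L2_integrable[OF \<phi>L] by simp
        have "AE x in ?M. x \<in> {a<..<b}" by (intro AE_I2) simp
        then show "AE x in ?M. \<bar>X n x - \<phi> x\<bar> \<le> e"
          using U(2)[of n] unfolding eq_L2_def
        proof eventually_elim
          case (elim x)
          then show ?case using n0[OF that, of x] by (simp add: dist_real_def)
        qed
      qed simp
      also have "\<dots> = (b - a) * e" using ab by (simp add: measure_restrict_space)
      also have "\<dots> = r / 2" unfolding e_def by (rule cancel) (use ab in simp)
      finally show ?thesis using \<open>r > 0\<close> Bochner_Integration.integral_nonneg[of ?M "\<lambda>x. \<bar>X n x - \<phi> x\<bar>"] by simp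
    qed
    then show "\<exists>n0. \<forall>n\<ge>n0. norm ((LINT x|?M. \<bar>X n x - \<phi> x\<bar>) - 0) < r" by blast
  qed
  have Glim: "(\<lambda>n. LINT x|?M. \<bar>G n x - g x\<bar>) \<longlonglongrightarrow> 0"
  proof (rule Lim_null_comparison[OF always_eventually[OF allI]])
    fix n
    show "norm (LINT x|?M. \<bar>G n x - g x\<bar>) \<le> c * sqrt (LINT x|?M. (G n x - g x)\<^sup>2)"
      using L2_abs_le[OF less_imp_le[OF ab] L2_diff[OF GL gL], of n] by (simp add: c_def)
    have "(\<lambda>n. c * sqrt (LINT x|?M. (G n x - g x)\<^sup>2)) \<longlonglongrightarrow> c * sqrt 0"
      by (intro tendsto_intros glim)
    then show "(\<lambda>n. c * sqrt (LINT x|?M. (G n x - g x)\<^sup>2)) \<longlonglongrightarrow> 0" by simp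
  qed
  have weak: "has_L2_weak_deriv {a<..<b} \<phi> g"
    unfolding has_L2_weak_deriv_def
  proof (intro conjI ballI gL)
    fix \<psi> assume \<psi>: "\<psi> \<in> test_functions {a<..<b}"
    note D = test_function_deriv(2,3)[OF \<psi>]
    obtain B where B: "\<And>x. x \<in> {a..b} \<Longrightarrow> \<bar>\<psi> x\<bar> \<le> B" using continuous_bounded_Ioo[OF D(1)] by blast
    obtain B' where B': "\<And>x. x \<in> {a..b} \<Longrightarrow> \<bar>deriv \<psi> x\<bar> \<le> B'" using continuous_bounded_Ioo[OF D(2)] by blast
    have "(\<lambda>n. LINT x|?M. X n x * deriv \<psi> x) \<longlonglongrightarrow> (LINT x|?M. \<phi> x * deriv \<psi> x)"
      by (rule tendsto_integral_mult_bounded[where B = B', OF L2_integrable[OF XL] L2_integrable[OF \<phi>L] _ _ Xlim])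
        (use B' borel_measurable_integrable[OF continuous_integrable_Ioo[OF D(2)]] in auto)
    moreover have "(\<lambda>n. LINT x|?M. G n x * \<psi> x) \<longlonglongrightarrow> (LINT x|?M. g x * \<psi> x)"
      by (rule tendsto_integral_mult_bounded[where B = B, OF L2_integrable[OF GL] L2_integrable[OF gL] _ _ Glim])
        (use B borel_measurable_integrable[OF continuous_integrable_Ioo[OF D(1)]] in auto)
    then have "(\<lambda>n. LINT x|?M. X n x * deriv \<psi> x) \<longlonglongrightarrow> - (LINT x|?M. g x * \<psi> x)"
      using G \<psi> by (simp add: has_L2_weak_deriv_def tendsto_minus)
    ultimately show "(LINT x|?M. \<phi> x * deriv \<psi> x) = - (LINT x|?M. g x * \<psi> x)"
      by (rule LIMSEQ_unique)
  qed
  have "\<phi> \<in> W012 {a<..<b}"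
    unfolding W012_Ioo_iff[OF ab]
    using \<phi>L weak \<phi>c \<phi>0 by (intro conjI exI[of _ g] exI[of _ \<phi>]) (auto simp: eq_L2_def)
  then show ?thesis using weak glim Xlim by blast
qed

section \<open>The Cauchy transform of a density on an interval\<close>

lemma integrable_mult_norm_bounded:
  fixes f w :: "'a \<Rightarrow> complex"
  assumes "integrable M f" "w \<in> borel_measurable M" "\<And>x. x \<in> space M \<Longrightarrow> norm (w x) \<le> B"
  shows "integrable M (\<lambda>x. f x * w x)"
    and "norm (LINT x|M. f x * w x) \<le> B * (LINT x|M. norm (f x))"
proof -
  have le: "norm (f x * w x) \<le> B * norm (f x)" if "x \<in> space M" for x
    using mult_left_mono[OF assms(3)[OF that], of "norm (f x)"] by (simp add: norm_mult mult_ac)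
  have i: "integrable M (\<lambda>x. B * norm (f x))" using assms(1) by simp
  show int: "integrable M (\<lambda>x. f x * w x)"
  proof (rule Bochner_Integration.integrable_bound[OF i])
    show "AE x in M. norm (f x * w x) \<le> norm (B * norm (f x))"
      by (intro AE_I2) (use le in \<open>force intro: order_trans\<close>)
  qed (use assms in auto)
  have "norm (LINT x|M. f x * w x) \<le> (LINT x|M. B * norm (f x))"
    by (rule norm_integral_le[OF int i le])
  then show "norm (LINT x|M. f x * w x) \<le> B * (LINT x|M. norm (f x))" by simp
qed

text \<open>By Weierstrass approximation vanishing moments give vanishing integrals against all
  continuous functions, and continuous ramps approximate the indicators of half-lines.\<close>

lemma AE_zero_of_moments:
  fixes f :: "real \<Rightarrow> real"
  assumes f: "integrable (lebesgue_on {a<..<b}) f"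
    and moments: "\<And>n. (LINT t|lebesgue_on {a<..<b}. f t * t ^ n) = 0"
  shows "AE t in lebesgue_on {a<..<b}. f t = 0"
proof (rule AE_zero_of_integral_lessThan_on[OF _ f])
  let ?M = "lebesgue_on {a<..<b}"
  have pow: "integrable ?M (\<lambda>t. f t * t ^ n)" for n
    by (intro integrable_mult_continuous_Ioo f continuous_intros)
  have cont: "(LINT t|?M. f t * \<psi> t) = 0" if \<psi>: "continuous_on {a..b} \<psi>" for \<psi>
  proof -
    have "\<bar>LINT t|?M. f t * \<psi> t\<bar> \<le> e" if "e > 0" for e
    proof -
      \<comment> \<open>The added 1 keeps the divisor positive when \<open>f\<close> is zero almost
        everywhere.\<close>
      define c where "c = (LINT t|?M. \<bar>f t\<bar>) + 1"
      have c: "c > 0" "(LINT t|?M. \<bar>f t\<bar>) \<le> c" by (simp_all add: c_def add_nonneg_pos)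
      obtain p where p: "real_polynomial_function p" "\<And>t. t \<in> {a..b} \<Longrightarrow> \<bar>\<psi> t - p t\<bar> < e / c"
        using Stone_Weierstrass_real_polynomial_function[OF compact_Icc \<psi>, of "e / c"] c \<open>e > 0\<close> by auto
      obtain k n where pk: "p = (\<lambda>t. \<Sum>i\<le>n. k i * t ^ i)"
        using p(1) by (auto simp: real_polynomial_function_iff_sum)
      have pc: "continuous_on {a..b} p" unfolding pk by (intro continuous_intros)
      have "(LINT t|?M. f t * p t) = (LINT t|?M. (\<Sum>i\<le>n. k i * (f t * t ^ i)))"
        by (simp add: pk sum_distrib_left mult_ac)
      also have "\<dots> = 0" using pow moments by (subst Bochner_Integration.integral_sum) auto
      finally have "(LINT t|?M. f t * \<psi> t) = (LINT t|?M. f t * \<psi> t) - (LINT t|?M. f t * p t)" by simp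
      also have "\<dots> = (LINT t|?M. f t * (\<psi> t - p t))"
        by (subst Bochner_Integration.integral_diff[symmetric])
          (auto intro!: integrable_mult_continuous_Ioo f \<psi> pc simp: right_diff_distrib)
      also have "norm \<dots> \<le> (LINT t|?M. (e / c) * \<bar>f t\<bar>)"
      proof (rule norm_integral_le)
        show "integrable ?M (\<lambda>t. f t * (\<psi> t - p t))"
          by (intro integrable_mult_continuous_Ioo f continuous_intros \<psi> pc)
        fix t assume "t \<in> space ?M"
        then have "\<bar>\<psi> t - p t\<bar> \<le> e / c" using p(2)[of t] by simp
        from mult_left_mono[OF this, of "\<bar>f t\<bar>"]
        show "norm (f t * (\<psi> t - p t)) \<le> (e / c) * \<bar>f t\<bar>" by (simp add: abs_mult mult_ac)
      qed (use f in simp)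
      also have "\<dots> \<le> (e / c) * c"
        unfolding Bochner_Integration.integral_mult_right_zero using c \<open>e > 0\<close> by (intro mult_left_mono) auto
      finally show ?thesis using c by simp
    qed
    then show ?thesis by (metis abs_le_zero_iff field_le_epsilon add_0)
  qed
  fix x :: real
  \<comment> \<open>A ramp that reaches 0 exactly at \<open>x\<close> and steepens with
    \<open>n\<close>: it is 0 from \<open>x\<close> on for all \<open>n\<close>, and eventually 1 at
    each point to the left.\<close>
  define \<psi> where "\<psi> n t = max 0 (min 1 (real n * (x - t)))" for n t
  have "(\<lambda>n. LINT t|?M. f t * \<psi> n t) \<longlonglongrightarrow> (LINT t|?M. indicator {..<x} t * f t)"
  proof (rule integral_dominated_convergence[where w = "\<lambda>t. \<bar>f t\<bar>"])
    show "AE t in ?M. (\<lambda>n. f t * \<psi> n t) \<longlonglongrightarrow> indicator {..<x} t * f t"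
    proof (intro AE_I2 tendsto_eventually)
      fix t
      show "\<forall>\<^sub>F n in sequentially. f t * \<psi> n t = indicator {..<x} t * f t"
      proof (cases "t < x")
        case True
        obtain N where N: "1 < real N * (x - t)" using ex_less_of_nat_mult[of "x - t" 1] True by auto
        have "\<psi> n t = 1" if "n \<ge> N" for n
        proof -
          have "real N * (x - t) \<le> real n * (x - t)" using that True by (intro mult_right_mono) auto
          then show ?thesis using N by (simp add: \<psi>_def)
        qed
        then show ?thesis using True by (intro eventually_sequentiallyI[of N]) auto
      next
        case False
        then have "real n * (x - t) \<le> 0" for n by (intro mult_nonneg_nonpos) auto
        then have "\<psi> n t = 0" for n by (simp add: \<psi>_def max_absorb1 min_le_iff_disj)
        then show ?thesis using False by simp
      qed
    qed
    show "AE t in ?M. norm (f t * \<psi> n t) \<le> \<bar>f t\<bar>" for n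
      by (intro AE_I2) (auto simp: \<psi>_def abs_mult intro!: mult_left_le)
    show "(\<lambda>t. indicator {..<x} t * f t) \<in> borel_measurable ?M"
      using integrable_indicator_lebesgue_on[OF _ f] by (intro borel_measurable_integrable) simp
    show "(\<lambda>t. f t * \<psi> n t) \<in> borel_measurable ?M" for n unfolding \<psi>_def
      by (intro borel_measurable_integrable integrable_mult_continuous_Ioo f continuous_intros)
  qed (use f in simp)
  moreover have "(LINT t|?M. f t * \<psi> n t) = 0" for n
    unfolding \<psi>_def by (intro cont continuous_intros)
  ultimately show "(LINT t|?M. indicator {..<x} t * f t) = 0" by (simp add: LIMSEQ_const_iff)
qed simp

text \<open>The closed segment is removed although densities live on the open interval: this makes
  the domain open.\<close>

abbreviation slit :: "real \<Rightarrow> real \<Rightarrow> complex set" where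
  "slit a b \<equiv> - (complex_of_real ` {a..b})"

definition cauchy_transform :: "real \<Rightarrow> real \<Rightarrow> (real \<Rightarrow> complex) \<Rightarrow> complex \<Rightarrow> complex" where
  "cauchy_transform a b f z = (LINT t|lebesgue_on {a<..<b}. f t * (1 / (of_real t - z)))"

text \<open>The kernel is the derivative of \<open>1 / (of_real t - z)\<close> in \<open>z\<close>.
  Having it as an integral gives bounds and Fubini directly.\<close>

definition cauchy_transform_deriv :: "real \<Rightarrow> real \<Rightarrow> (real \<Rightarrow> complex) \<Rightarrow> complex \<Rightarrow> complex" where
  "cauchy_transform_deriv a b f z = (LINT t|lebesgue_on {a<..<b}. f t * (1 / (of_real t - z)\<^sup>2))"

lemma open_slit: "open (slit a b)"
  by (intro open_Compl compact_imp_closed compact_continuous_image continuous_intros compact_Icc)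

text \<open>A bounded convex set does not separate the plane. Connectedness is what lets the
  identity theorem spread zeros from a line to the whole domain.\<close>

lemma connected_slit: "connected (slit a b)"
proof (rule connected_complement_bounded_convex)
  show "bounded (complex_of_real ` {a..b})"
    by (intro compact_imp_bounded compact_continuous_image continuous_intros compact_Icc)
  show "convex (complex_of_real ` {a..b})"
    by (intro convex_linear_image) (auto simp: linear_of_real)
qed simp

lemma slit_distance:
  assumes "z \<in> slit a b"
  obtains d where "d > 0" "\<And>t. t \<in> {a..b} \<Longrightarrow> d \<le> norm (of_real t - z)"
proof -
  obtain d where "d > 0" "ball z d \<subseteq> slit a b"
    using open_slit[of a b] assms by (meson open_contains_ball)
  have "d \<le> norm (of_real t - z)" if "t \<in> {a..b}" for t
  proof (rule ccontr)
    assume "\<not> d \<le> norm (of_real t - z)"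
    then have "of_real t \<in> ball z d" by (simp add: dist_norm norm_minus_commute)
    then show False using \<open>ball z d \<subseteq> slit a b\<close> that by auto
  qed
  then show ?thesis using that \<open>d > 0\<close> by blast
qed

lemma slit_kernels_measurable:
  assumes "z \<in> slit a b" "w \<in> slit a b"
  shows "(\<lambda>t. 1 / ((of_real t - w) * (of_real t - z)\<^sup>2)) \<in> borel_measurable (lebesgue_on {a<..<b})"
    and "(\<lambda>t. 1 / (of_real t - z)) \<in> borel_measurable (lebesgue_on {a<..<b})"
    and "(\<lambda>t. 1 / (of_real t - z)\<^sup>2) \<in> borel_measurable (lebesgue_on {a<..<b})"
  by (intro borel_measurable_integrable continuous_integrable_Ioo continuous_intros; use assms in force)+

lemma cauchy_transform_bound:
  assumes f: "integrable (lebesgue_on {a<..<b}) f" and d: "d > 0" "\<And>t. t \<in> {a..b} \<Longrightarrow> d \<le> norm (of_real t - z)"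
  shows "integrable (lebesgue_on {a<..<b}) (\<lambda>t. f t * (1 / (of_real t - z)))"
    and "norm (cauchy_transform a b f z) \<le> 1 / d * (LINT t|lebesgue_on {a<..<b}. norm (f t))"
    and "integrable (lebesgue_on {a<..<b}) (\<lambda>t. f t * (1 / (of_real t - z)\<^sup>2))"
    and "norm (cauchy_transform_deriv a b f z) \<le> 1 / d\<^sup>2 * (LINT t|lebesgue_on {a<..<b}. norm (f t))"
proof -
  have z: "z \<in> slit a b" using d by force
  have "norm (1 / (of_real t - z)) \<le> 1 / d" if "t \<in> space (lebesgue_on {a<..<b})" for t
    using d(1) d(2)[of t] that by (simp add: norm_divide frac_le)
  from integrable_mult_norm_bounded[OF f slit_kernels_measurable(2)[OF z z] this]
  show "integrable (lebesgue_on {a<..<b}) (\<lambda>t. f t * (1 / (of_real t - z)))"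
    "norm (cauchy_transform a b f z) \<le> 1 / d * (LINT t|lebesgue_on {a<..<b}. norm (f t))"
    unfolding cauchy_transform_def by blast+
  have "norm (1 / (of_real t - z)\<^sup>2) \<le> 1 / d\<^sup>2" if "t \<in> space (lebesgue_on {a<..<b})" for t
    using d(1) power_mono[OF d(2)[of t], of 2] that by (simp add: norm_divide norm_power frac_le)
  from integrable_mult_norm_bounded[OF f slit_kernels_measurable(3)[OF z z] this]
  show "integrable (lebesgue_on {a<..<b}) (\<lambda>t. f t * (1 / (of_real t - z)\<^sup>2))"
    "norm (cauchy_transform_deriv a b f z) \<le> 1 / d\<^sup>2 * (LINT t|lebesgue_on {a<..<b}. norm (f t))"
    unfolding cauchy_transform_deriv_def by blast+
qed

text \<open>The error of the difference quotient is exactly \<open>w - z\<close> times the integral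
  against \<open>1 / ((of_real t - w) * (of_real t - z)\<^sup>2)\<close>, a kernel bounded uniformly
  for \<open>w\<close> within half the distance from \<open>z\<close> to the slit.\<close>

lemma cauchy_transform_has_derivative:
  assumes f: "integrable (lebesgue_on {a<..<b}) f" and z: "z \<in> slit a b"
  shows "(cauchy_transform a b f has_field_derivative cauchy_transform_deriv a b f z) (at z)"
proof -
  let ?M = "lebesgue_on {a<..<b}"
  obtain d where d: "d > 0" "\<And>t. t \<in> {a..b} \<Longrightarrow> d \<le> norm (of_real t - z)"
    using slit_distance[OF z] by blast
  define C where "C = 1 / (d / 2 * d\<^sup>2) * (LINT t|?M. norm (f t))"
  have est: "norm ((cauchy_transform a b f w - cauchy_transform a b f z) / (w - z) - cauchy_transform_deriv a b f z)
      \<le> norm (w - z) * C" if w: "dist w z < d / 2" "w \<noteq> z" for w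
  proof -
    have dw: "d / 2 \<le> norm (of_real t - w)" if "t \<in> {a..b}" for t
    proof -
      have "norm (of_real t - z) \<le> norm (of_real t - w) + norm (w - z)"
        using norm_triangle_ineq[of "of_real t - w" "w - z"] by simp
      then show ?thesis using d(2)[OF that] w(1) by (simp add: dist_norm)
    qed
    have ws: "w \<in> slit a b" using dw d(1) by force
    have kb: "norm (1 / ((of_real t - w) * (of_real t - z)\<^sup>2)) \<le> 1 / (d / 2 * d\<^sup>2)" if "t \<in> space ?M" for t
    proof -
      have "d / 2 * d\<^sup>2 \<le> norm (of_real t - w) * (norm (of_real t - z))\<^sup>2"
        using that d dw[of t] by (intro mult_mono power_mono) auto
      from frac_le[OF _ order_refl _ this, of 1] show ?thesis
        using d(1) by (simp add: norm_divide norm_mult norm_power)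
    qed
    note k = integrable_mult_norm_bounded[OF f slit_kernels_measurable(1)[OF z ws] kb]
    have iw: "integrable ?M (\<lambda>t. f t * (1 / (of_real t - w)))"
      by (rule cauchy_transform_bound(1)[OF f _ dw]) (use d in simp)
    note iz = cauchy_transform_bound(1,3)[OF f d]
    have "(cauchy_transform a b f w - cauchy_transform a b f z) - (w - z) * cauchy_transform_deriv a b f z
       = (LINT t|?M. f t * (1 / (of_real t - w)) - f t * (1 / (of_real t - z)) - (w - z) * (f t * (1 / (of_real t - z)\<^sup>2)))"
      unfolding cauchy_transform_def cauchy_transform_deriv_def using iw iz
      by (simp only: Bochner_Integration.integral_diff Bochner_Integration.integrable_diff
          Bochner_Integration.integral_mult_right_zero integrable_mult_right)
    also have "\<dots> = (LINT t|?M. (w - z)\<^sup>2 * (f t * (1 / ((of_real t - w) * (of_real t - z)\<^sup>2))))"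
    proof (rule Bochner_Integration.integral_cong[OF refl])
      fix t assume "t \<in> space ?M"
      then have "t \<in> {a..b}" by simp
      then have nz: "of_real t - w \<noteq> 0" "of_real t - z \<noteq> 0" using z ws by auto
      \<comment> \<open>Here \<open>p\<close> stands for \<open>of_real t - w\<close> and
        \<open>q\<close> for \<open>of_real t - z\<close>, so that
        \<open>q - p = w - z\<close>.\<close>
      have alg: "x * (1 / p) - x * (1 / q) - (q - p) * (x * (1 / q\<^sup>2)) = (q - p)\<^sup>2 * (x * (1 / (p * q\<^sup>2)))"
        if "p \<noteq> 0" "q \<noteq> 0" for x p q :: complex
        using that by (simp add: field_simps power2_eq_square)
      show "f t * (1 / (of_real t - w)) - f t * (1 / (of_real t - z)) - (w - z) * (f t * (1 / (of_real t - z)\<^sup>2))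
          = (w - z)\<^sup>2 * (f t * (1 / ((of_real t - w) * (of_real t - z)\<^sup>2)))"
        using alg[OF nz, of "f t"] by simp
    qed
    also have "\<dots> = (w - z)\<^sup>2 * (LINT t|?M. f t * (1 / ((of_real t - w) * (of_real t - z)\<^sup>2)))"
      by (rule Bochner_Integration.integral_mult_right_zero)
    finally have "(cauchy_transform a b f w - cauchy_transform a b f z) / (w - z) - cauchy_transform_deriv a b f z
       = (w - z) * (LINT t|?M. f t * (1 / ((of_real t - w) * (of_real t - z)\<^sup>2)))"
      using w(2) by (simp add: field_simps power2_eq_square)
    then show ?thesis
      using mult_left_mono[OF k(2)[folded C_def] norm_ge_zero, of "w - z"] by (simp only: norm_mult)
  qed
  have "((\<lambda>w. (cauchy_transform a b f w - cauchy_transform a b f z) / (w - z) - cauchy_transform_deriv a b f z) \<longlongrightarrow> 0) (at z)"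
  proof (rule Lim_null_comparison)
    show "\<forall>\<^sub>F w in at z. norm ((cauchy_transform a b f w - cauchy_transform a b f z) / (w - z) - cauchy_transform_deriv a b f z)
      \<le> norm (w - z) * C"
      unfolding eventually_at using est d(1) by (intro exI[of _ "d / 2"]) simp
    have "((\<lambda>w. norm (w - z) * C) \<longlongrightarrow> norm (z - z) * C) (at z)" by (intro tendsto_intros)
    then show "((\<lambda>w. norm (w - z) * C) \<longlongrightarrow> 0) (at z)" by simp
  qed
  then show ?thesis unfolding has_field_derivative_iff by (simp add: LIM_zero_iff)
qed

lemma cauchy_transform_holomorphic:
  assumes f: "integrable (lebesgue_on {a<..<b}) f"
  shows "cauchy_transform a b f holomorphic_on slit a b" and "cauchy_transform_deriv a b f holomorphic_on slit a b"
proof -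
  show F: "cauchy_transform a b f holomorphic_on slit a b"
    unfolding holomorphic_on_open[OF open_slit] using cauchy_transform_has_derivative[OF f] by blast
  have "deriv (cauchy_transform a b f) holomorphic_on slit a b"
    by (rule holomorphic_deriv[OF F open_slit])
  then show "cauchy_transform_deriv a b f holomorphic_on slit a b"
    by (rule holomorphic_transform) (rule DERIV_imp_deriv[OF cauchy_transform_has_derivative[OF f]])
qed

lemma norm_ge_far:
  assumes "norm z \<ge> \<bar>a\<bar> + \<bar>b\<bar> + r" "t \<in> {a..b}"
  shows "r \<le> norm (of_real t - z :: complex)"
proof -
  have "\<bar>t\<bar> \<le> \<bar>a\<bar> + \<bar>b\<bar>" using assms(2) by auto
  then show ?thesis
    using assms(1) norm_triangle_ineq2[of z "of_real t"] by (simp add: norm_minus_commute)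
qed

lemma inverse_far_tendsto:
  fixes G :: "complex \<Rightarrow> complex"
  assumes "\<And>z r. r \<ge> 1 \<Longrightarrow> norm z \<ge> R + r \<Longrightarrow> norm (G z) \<le> 1 / r * C"
  shows "(G \<longlongrightarrow> 0) at_infinity"
proof (rule tendstoI)
  fix e :: real assume e: "e > 0"
  define r where "r = max 1 ((\<bar>C\<bar> + 1) / e)"
  have "\<forall>\<^sub>F z in at_infinity. norm z \<ge> R + r" by (simp add: eventually_at_infinity) blast
  then show "\<forall>\<^sub>F z in at_infinity. dist (G z) 0 < e"
  proof eventually_elim
    case (elim z)
    have r: "r \<ge> 1" "(\<bar>C\<bar> + 1) / e \<le> r" by (simp_all add: r_def)
    have "norm (G z) \<le> C / r" using assms[OF r(1) elim] by simp
    also have "C / r < e" using r e by (simp add: field_simps abs_if split: if_splits)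
    finally show ?case by simp
  qed
qed

lemma cauchy_transform_at_infinity:
  assumes f: "integrable (lebesgue_on {a<..<b}) f"
  shows "(cauchy_transform a b f \<longlongrightarrow> 0) at_infinity"
  by (rule inverse_far_tendsto[where R = "\<bar>a\<bar> + \<bar>b\<bar>"], rule cauchy_transform_bound(2)[OF f _ norm_ge_far]) auto

text \<open>The shift \<open>s\<close> is there for the reflection argument, which translates the
  transform vertically by \<open>h\<close>. The quadratic decay is weakened to \<open>1 / r\<close>
  to fit the common criterion.\<close>

lemma cauchy_transform_deriv_at_infinity:
  assumes f: "integrable (lebesgue_on {a<..<b}) f"
  shows "((\<lambda>w. cauchy_transform_deriv a b f (w + s)) \<longlongrightarrow> 0) at_infinity"
proof (rule inverse_far_tendsto[where R = "\<bar>a\<bar> + \<bar>b\<bar> + norm s"])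
  fix w :: complex and r :: real assume r: "r \<ge> 1" and w: "norm w \<ge> \<bar>a\<bar> + \<bar>b\<bar> + norm s + r"
  have "norm (w + s) \<ge> \<bar>a\<bar> + \<bar>b\<bar> + r" using w norm_diff_ineq[of w s] by linarith
  from cauchy_transform_bound(4)[OF f _ norm_ge_far[OF this]] r
  have "norm (cauchy_transform_deriv a b f (w + s)) \<le> 1 / r\<^sup>2 * (LINT t|lebesgue_on {a<..<b}. norm (f t))" by simp
  also have "\<dots> \<le> 1 / r * (LINT t|lebesgue_on {a<..<b}. norm (f t))"
    using r by (intro mult_right_mono) (simp_all add: power2_eq_square divide_simps)
  finally show "norm (cauchy_transform_deriv a b f (w + s)) \<le> 1 / r * (LINT t|lebesgue_on {a<..<b}. norm (f t))" .
qed

text \<open>The moments come out of \<open>t / (t - z) = 1 + z / (t - z)\<close>: once the transform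
  of \<open>t ^ n\<close> times the density vanishes, the next one is constant with value the n-th
  moment, and decay at infinity makes this constant zero.\<close>

lemma cauchy_transform_deriv_injective:
  assumes f: "integrable (lebesgue_on {a<..<b}) f"
    and zero: "\<And>z. z \<in> slit a b \<Longrightarrow> cauchy_transform_deriv a b f z = 0"
  shows "AE t in lebesgue_on {a<..<b}. f t = 0"
proof -
  let ?M = "lebesgue_on {a<..<b}"
  have far: "\<forall>\<^sub>F z in at_infinity. z \<in> slit a b"
    unfolding eventually_at_infinity
  proof (intro exI allI impI)
    fix z :: complex assume "norm z \<ge> \<bar>a\<bar> + \<bar>b\<bar> + 1"
    from norm_ge_far[OF this] show "z \<in> slit a b" by force
  qed
  have const0: "c = 0" if "\<And>z. z \<in> slit a b \<Longrightarrow> G z = c" "(G \<longlongrightarrow> 0) at_infinity" for G and c :: complex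
  proof -
    have "(G \<longlongrightarrow> c) at_infinity"
      by (rule tendsto_eventually) (use far that(1) in \<open>auto elim: eventually_mono\<close>)
    then show ?thesis using that(2) tendsto_unique trivial_limit_at_infinity by blast
  qed
  have "cauchy_transform a b f constant_on slit a b"
    using cauchy_transform_has_derivative[OF f] zero
    by (intro has_field_derivative_0_imp_constant_on[OF _ connected_slit open_slit]) metis
  then obtain c where c: "\<And>z. z \<in> slit a b \<Longrightarrow> cauchy_transform a b f z = c" unfolding constant_on_def by blast
  have F0: "cauchy_transform a b f z = 0" if "z \<in> slit a b" for z
    using const0[OF c cauchy_transform_at_infinity[OF f]] c[OF that] by simp
  have fn: "integrable ?M (\<lambda>t. f t * of_real t ^ n)" for n
  proof -
    have "continuous_on {a..b} (\<lambda>t. complex_of_real t ^ n)" by (intro continuous_intros)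
    moreover from this have "bounded ((\<lambda>t. complex_of_real t ^ n) ` {a..b})"
      by (intro compact_imp_bounded compact_continuous_image compact_Icc)
    then obtain B where "\<And>t. t \<in> {a..b} \<Longrightarrow> norm (complex_of_real t ^ n) \<le> B" unfolding bounded_iff by blast
    ultimately show ?thesis
      by (intro integrable_mult_norm_bounded(1)[OF f, where B = B] borel_measurable_integrable continuous_integrable_Ioo) auto
  qed
  \<comment> \<open>One induction carries both facts; the moment lags by one index because it
    appears as a by-product of the next transform.\<close>
  have moments: "(\<forall>z\<in>slit a b. cauchy_transform a b (\<lambda>t. f t * of_real t ^ n) z = 0) \<and>
      (n > 0 \<longrightarrow> (LINT t|?M. f t * of_real t ^ (n - 1)) = 0)" for n
  proof (induction n)
    case (Suc n)
    define m where "m = (LINT t|?M. f t * of_real t ^ n)"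
    have "cauchy_transform a b (\<lambda>t. f t * of_real t ^ Suc n) z = m" if z: "z \<in> slit a b" for z
    proof -
      obtain d where d: "d > 0" "\<And>t. t \<in> {a..b} \<Longrightarrow> d \<le> norm (of_real t - z)"
        using slit_distance[OF z] by blast
      have "cauchy_transform a b (\<lambda>t. f t * of_real t ^ Suc n) z
         = (LINT t|?M. f t * of_real t ^ n + z * (f t * of_real t ^ n * (1 / (of_real t - z))))"
        unfolding cauchy_transform_def
      proof (rule Bochner_Integration.integral_cong[OF refl])
        fix t assume "t \<in> space ?M"
        then have "of_real t - z \<noteq> 0" using d(2)[of t] d(1) by auto
        then show "f t * of_real t ^ Suc n * (1 / (of_real t - z))
           = f t * of_real t ^ n + z * (f t * of_real t ^ n * (1 / (of_real t - z)))"
          by (simp add: field_simps)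
      qed
      also have "\<dots> = m + z * cauchy_transform a b (\<lambda>t. f t * of_real t ^ n) z"
        unfolding m_def cauchy_transform_def
        using fn[of n] cauchy_transform_bound(1)[OF fn[of n] d]
        by (simp only: Bochner_Integration.integral_add Bochner_Integration.integral_mult_right_zero integrable_mult_right)
      finally show ?thesis using Suc z by simp
    qed
    then show ?case using const0[OF _ cauchy_transform_at_infinity[OF fn[of "Suc n"]], of m] m_def by simp
  qed (use F0 in simp)
  have mom: "(LINT t|?M. f t * of_real t ^ n) = 0" for n using moments[of "Suc n"] by simp
  have ReIm: "(LINT t|?M. Re (f t) * t ^ n) = 0" "(LINT t|?M. Im (f t) * t ^ n) = 0" for n
  proof -
    have "Re (f t * of_real t ^ n) = Re (f t) * t ^ n" "Im (f t * of_real t ^ n) = Im (f t) * t ^ n" for t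
      by (simp_all flip: of_real_power)
    then show "(LINT t|?M. Re (f t) * t ^ n) = 0" "(LINT t|?M. Im (f t) * t ^ n) = 0"
      using integral_Re[OF fn[of n]] integral_Im[OF fn[of n]] mom[of n] by simp_all
  qed
  have "AE t in ?M. Re (f t) = 0" "AE t in ?M. Im (f t) = 0"
    using f ReIm by (auto intro!: AE_zero_of_moments)
  then show ?thesis by eventually_elim (simp add: complex_eq_iff)
qed

section \<open>The operator \<open>b\<^sub>2\<^sup>*\<close>\<close>

lemma line_in_slit: "h \<noteq> 0 \<Longrightarrow> Complex x h \<in> slit a b"
  by (auto simp: complex_eq_iff)

lemma line_distance: "\<bar>h\<bar> \<le> norm (complex_of_real t - Complex x h)"
  using abs_Im_le_cmod[of "complex_of_real t - Complex x h"] by simp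

lemma integrable_of_real_Ioo:
  "integrable (lebesgue_on {a<..<b}) \<phi> \<Longrightarrow> integrable (lebesgue_on {a<..<b}) (\<lambda>t. complex_of_real (\<phi> t))"
  by simp

text \<open>Multiply numerator and denominator by the conjugate. The real part is odd in
  \<open>x - t\<close>, whence the minus sign at \<open>conj_poisson\<close>.\<close>

lemma cauchy_kernel_poisson:
  assumes "h > 0"
  shows "1 / (complex_of_real t - Complex x h) = pi * Complex (- conj_poisson h (x - t)) (poisson h (x - t))"
proof -
  define D where "D = (x - t)\<^sup>2 + h\<^sup>2"
  have "complex_of_real t - Complex x h = Complex (t - x) (- h)" by (simp add: complex_eq_iff)
  moreover have "(t - x)\<^sup>2 = (x - t)\<^sup>2" by (rule power2_commute)
  ultimately have "1 / (complex_of_real t - Complex x h) = Complex ((t - x) / D) (h / D)"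
    by (simp add: divide_inverse[of 1] complex_inverse D_def)
  moreover have "(t - x) / D = - ((x - t) / D)" by (simp add: minus_divide_left)
  ultimately show ?thesis
    unfolding poisson_def conj_poisson_def D_def[symmetric] by (simp add: complex_eq_iff)
qed

lemma conv_R_zero_ext:
  "conv_R k (zero_ext {a<..<b} \<phi>) x = (LINT t|lebesgue_on {a<..<b}. k (x - t) * \<phi> t)"
  unfolding conv_R_def zero_ext_def
  by (subst integral_restrict_space) (auto intro!: Bochner_Integration.integral_cong simp: indicator_def)

lemma conv_poisson_eq:
  assumes h: "h > 0" and \<phi>: "integrable (lebesgue_on {a<..<b}) \<phi>"
  shows "conv_R (poisson h) (zero_ext {a<..<b} \<phi>) x = Im (cauchy_transform a b (\<lambda>t. \<phi> t) (Complex x h)) / pi"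
    and "conv_R (conj_poisson h) (zero_ext {a<..<b} \<phi>) x = - Re (cauchy_transform a b (\<lambda>t. \<phi> t) (Complex x h)) / pi"
proof -
  let ?M = "lebesgue_on {a<..<b}"
  have i: "integrable ?M (\<lambda>t. complex_of_real (\<phi> t) * (1 / (of_real t - Complex x h)))"
    by (rule cauchy_transform_bound(1)[OF integrable_of_real_Ioo[OF \<phi>], of h]) (use h line_distance[of h _ x] in auto)
  have "Im (complex_of_real (\<phi> t) * (1 / (of_real t - Complex x h))) = pi * (poisson h (x - t) * \<phi> t)"
    "Re (complex_of_real (\<phi> t) * (1 / (of_real t - Complex x h))) = pi * (- (conj_poisson h (x - t) * \<phi> t))" for t
    unfolding cauchy_kernel_poisson[OF h] by simp_all
  then show "conv_R (poisson h) (zero_ext {a<..<b} \<phi>) x = Im (cauchy_transform a b (\<lambda>t. \<phi> t) (Complex x h)) / pi"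
    "conv_R (conj_poisson h) (zero_ext {a<..<b} \<phi>) x = - Re (cauchy_transform a b (\<lambda>t. \<phi> t) (Complex x h)) / pi"
    unfolding conv_R_zero_ext cauchy_transform_def integral_Im[OF i, symmetric] integral_Re[OF i, symmetric]
    by simp_all
qed

text \<open>The line at height \<open>h\<close> has tangent 1, so differentiation in
  \<open>x\<close> is complex differentiation of the transform and commutes with \<open>Re\<close>
  and \<open>Im\<close>.\<close>

lemma b2_star_eq:
  assumes h: "h > 0" and \<phi>: "integrable (lebesgue_on {a<..<b}) \<phi>"
  shows "b2_star h {a<..<b} \<phi> x =
    (Im (cauchy_transform_deriv a b (\<lambda>t. \<phi> t) (Complex x h)) / pi, - Re (cauchy_transform_deriv a b (\<lambda>t. \<phi> t) (Complex x h)) / pi)"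
proof -
  let ?F = "cauchy_transform a b (\<lambda>t. complex_of_real (\<phi> t))"
  let ?D = "cauchy_transform_deriv a b (\<lambda>t. complex_of_real (\<phi> t)) (Complex x h)"
  have "((\<lambda>x. of_real x + Complex 0 h) has_vector_derivative 1) (at x)"
    by (auto intro!: derivative_eq_intros)
  moreover have "of_real x + Complex 0 h = Complex x h" for x by (simp add: complex_eq_iff)
  ultimately have "((\<lambda>x. Complex x h) has_vector_derivative 1) (at x)" by simp
  from field_vector_diff_chain_at[OF this cauchy_transform_has_derivative[OF integrable_of_real_Ioo[OF \<phi>] line_in_slit]]
  have D: "((\<lambda>x. ?F (Complex x h)) has_vector_derivative ?D) (at x)" using h by (simp add: o_def)
  have "((\<lambda>x. Im (?F (Complex x h)) / pi) has_real_derivative Im ?D / pi) (at x)"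
    using bounded_linear.has_vector_derivative[OF bounded_linear_Im D]
    by (intro DERIV_cdivide) (simp add: has_real_derivative_iff_has_vector_derivative)
  moreover have "((\<lambda>x. - Re (?F (Complex x h)) / pi) has_real_derivative - Re ?D / pi) (at x)"
    using bounded_linear.has_vector_derivative[OF bounded_linear_Re D]
    by (intro DERIV_cdivide DERIV_minus) (simp add: has_real_derivative_iff_has_vector_derivative)
  ultimately show ?thesis
    unfolding b2_star_def conv_poisson_eq[OF h \<phi>] by (simp add: DERIV_imp_deriv)
qed

lemma cauchy_transform_deriv_lin_comb:
  assumes h: "h > 0" and "integrable (lebesgue_on {a<..<b}) f" "integrable (lebesgue_on {a<..<b}) g"
  shows "cauchy_transform_deriv a b (\<lambda>t. complex_of_real (p * f t + q * g t)) (Complex x h) =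
     p * cauchy_transform_deriv a b (\<lambda>t. f t) (Complex x h) + q * cauchy_transform_deriv a b (\<lambda>t. g t) (Complex x h)"
proof -
  let ?k = "\<lambda>t. 1 / (complex_of_real t - Complex x h)\<^sup>2"
  have i: "integrable (lebesgue_on {a<..<b}) (\<lambda>t. complex_of_real (f t) * ?k t)"
    if "integrable (lebesgue_on {a<..<b}) f" for f
    by (rule cauchy_transform_bound(3)[OF integrable_of_real_Ioo[OF that], of h]) (use h line_distance[of h _ x] in auto)
  have "complex_of_real (p * f t + q * g t) * ?k t = p * (f t * ?k t) + q * (g t * ?k t)" for t
    by (simp only: of_real_add of_real_mult distrib_right mult.assoc)
  then show ?thesis
    unfolding cauchy_transform_deriv_def using i[OF assms(2)] i[OF assms(3)]
    by (simp only: Bochner_Integration.integral_add Bochner_Integration.integral_mult_right_zero integrable_mult_right)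
qed

lemma b2_star_lin_comb:
  assumes h: "h > 0" and f: "integrable (lebesgue_on {a<..<b}) f" and g: "integrable (lebesgue_on {a<..<b}) g"
  shows "b2_star h {a<..<b} (\<lambda>t. p * f t + q * g t) x = p *\<^sub>R b2_star h {a<..<b} f x + q *\<^sub>R b2_star h {a<..<b} g x"
proof -
  have fg: "integrable (lebesgue_on {a<..<b}) (\<lambda>t. p * f t + q * g t)" using f g by simp
  show ?thesis
    unfolding b2_star_eq[OF h f] b2_star_eq[OF h g] b2_star_eq[OF h fg] cauchy_transform_deriv_lin_comb[OF h f g]
    by (simp add: field_simps)
qed

text \<open>Up to the factor \<open>1 / pi\<close> the pair has the modulus of a complex transform,
  and the line stays at distance at least \<open>h\<close> from the real axis. The bound is uniform
  in \<open>x\<close> and uses only the L1 norm, the mode of convergence that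
  \<open>W012_complete\<close> supplies.\<close>

lemma b2_star_bound:
  assumes h: "h > 0" and \<phi>: "integrable (lebesgue_on {a<..<b}) \<phi>"
  shows "norm (b2_star h {a<..<b} \<phi> x) \<le> 1 / h\<^sup>2 * (LINT t|lebesgue_on {a<..<b}. \<bar>\<phi> t\<bar>)"
proof -
  let ?D = "cauchy_transform_deriv a b (\<lambda>t. complex_of_real (\<phi> t)) (Complex x h)"
  have "norm (b2_star h {a<..<b} \<phi> x) = norm ?D / pi"
    unfolding b2_star_eq[OF h \<phi>] norm_Pair
    by (simp add: cmod_def power_divide real_sqrt_divide add.commute flip: add_divide_distrib)
  also have "\<dots> \<le> norm ?D"
    using divide_left_mono[of 1 pi "norm ?D"] pi_gt3 by simp
  also have "\<dots> \<le> 1 / h\<^sup>2 * (LINT t|lebesgue_on {a<..<b}. norm (complex_of_real (\<phi> t)))"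
    by (rule cauchy_transform_bound(4)[OF integrable_of_real_Ioo[OF \<phi>]]) (use h line_distance[of h _ x] in auto)
  finally show ?thesis by simp
qed

section \<open>Continuity and injectivity of the operator\<close>

lemma cauchy_transform_deriv_line_continuous:
  assumes "integrable (lebesgue_on {a<..<b}) f" "h \<noteq> 0"
  shows "continuous_on A (\<lambda>x. cauchy_transform_deriv a b f (Complex x h))"
proof (rule continuous_on_compose2[OF holomorphic_on_imp_continuous_on[OF cauchy_transform_holomorphic(2)[OF assms(1)]]])
  have "continuous_on A (\<lambda>x. of_real x + Complex 0 h)" by (intro continuous_intros)
  moreover have "of_real x + Complex 0 h = Complex x h" for x by (simp add: complex_eq_iff)
  ultimately show "continuous_on A (\<lambda>x. Complex x h)" by simp
qed (intro image_subsetI line_in_slit assms)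

lemma b2_star_continuous:
  assumes h: "h > 0" and \<phi>: "integrable (lebesgue_on {a<..<b}) \<phi>"
  shows "continuous_on A (b2_star h {a<..<b} \<phi>)"
proof -
  have "continuous_on A (\<lambda>x. cauchy_transform_deriv a b (\<lambda>t. complex_of_real (\<phi> t)) (Complex x h))"
    by (rule cauchy_transform_deriv_line_continuous) (use h \<phi> in auto)
  then show ?thesis
    unfolding b2_star_eq[OF h \<phi>] by (intro continuous_intros) auto
qed

text \<open>The points where \<open>g\<close> is nonzero form an open set, and an open negligible
  set is empty.\<close>

lemma continuous_AE_zero_imp_zero:
  fixes g :: "real \<Rightarrow> 'a::real_normed_vector"
  assumes g: "continuous_on {p<..<q} g" and ae: "AE x in lebesgue_on {p<..<q}. g x = 0" and x: "x \<in> {p<..<q}"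
  shows "g x = 0"
proof (rule ccontr)
  assume "g x \<noteq> 0"
  let ?U = "{p<..<q} \<inter> g -` (- {0})"
  have "open ?U" by (intro continuous_open_preimage g) auto
  moreover have "negligible ?U"
  proof -
    have "AE x in lebesgue. x \<in> {p<..<q} \<longrightarrow> g x = 0"
      using ae by (subst (asm) AE_restrict_space_iff) auto
    then obtain N where "N \<in> null_sets lebesgue" "{x. \<not> (x \<in> {p<..<q} \<longrightarrow> g x = 0)} \<subseteq> N"
      by (auto simp: eventually_ae_filter)
    then have "?U \<subseteq> N" "negligible N" by (auto simp: negligible_iff_null_sets)
    then show ?thesis by (rule negligible_subset[rotated])
  qed
  moreover have "x \<in> ?U" using x \<open>g x \<noteq> 0\<close> by simp
  ultimately show False using open_not_negligible by blast
qed

lemma islimpt_line: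
  assumes "p < q"
  shows "Complex ((p + q) / 2) h islimpt ((\<lambda>x. Complex x h) ` {p<..<q})"
proof -
  let ?m = "(p + q) / 2"
  have "\<exists>x'\<in>(\<lambda>x. Complex x h) ` {p<..<q}. x' \<noteq> Complex ?m h \<and> dist x' (Complex ?m h) < e" if "e > 0" for e
  proof -
    define r where "r = min (e / 2) ((q - p) / 4)"
    have r: "0 < r" "r < e" "r \<le> (q - p) / 4" using assms that by (auto simp: r_def min_def)
    then have "?m + r \<in> {p<..<q}" using assms by (auto simp: field_simps)
    moreover have "dist (Complex (?m + r) h) (Complex ?m h) = r" using r by (simp add: dist_norm cmod_def)
    moreover have "Complex (?m + r) h \<noteq> Complex ?m h"
      using r(1) by (metis add_cancel_right_right complex.inject less_irrefl)
    ultimately show ?thesis using r by (intro bexI[of _ "Complex (?m + r) h"] conjI imageI) simp_all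
  qed
  then show ?thesis unfolding islimpt_approachable by blast
qed

lemma b2_star_injective:
  assumes h: "h > 0" and pq: "p < q" and \<phi>: "integrable (lebesgue_on {a<..<b}) \<phi>"
    and zero: "AE x in lebesgue_on {p<..<q}. b2_star h {a<..<b} \<phi> x = 0"
  shows "AE t in lebesgue_on {a<..<b}. \<phi> t = 0"
proof -
  let ?D = "cauchy_transform_deriv a b (\<lambda>t. complex_of_real (\<phi> t))"
  note i = integrable_of_real_Ioo[OF \<phi>]
  have "b2_star h {a<..<b} \<phi> x = 0" if "x \<in> {p<..<q}" for x
    by (rule continuous_AE_zero_imp_zero[OF b2_star_continuous[OF h \<phi>] zero that])
  then have line: "?D (Complex x h) = 0" if "x \<in> {p<..<q}" for x
    using that by (simp add: b2_star_eq[OF h \<phi>] complex_eq_iff zero_prod_def)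
  have "?D z = 0" if "z \<in> slit a b" for z
  proof (rule analytic_continuation[OF cauchy_transform_holomorphic(2)[OF i] open_slit connected_slit _ _ islimpt_line[OF pq, of h] _ that])
    show "(\<lambda>x. Complex x h) ` {p<..<q} \<subseteq> slit a b" "Complex ((p + q) / 2) h \<in> slit a b"
      using line_in_slit[of h _ a b] h by (simp_all add: image_subset_iff del: Compl_iff)
  qed (use line in auto)
  from cauchy_transform_deriv_injective[OF i this] show ?thesis by simp
qed

section \<open>The adjoint operator and density of the range\<close>

text \<open>The kernel satisfies \<open>(t - (x + i h))^2 = (x - (t - i h))^2\<close>, so the
  transposed operator is again a Cauchy transform, evaluated on the line at height
  \<open>- h\<close>.\<close>

lemma cauchy_transform_deriv_Fubini:
  assumes h: "h > 0" and c: "integrable (lebesgue_on {p<..<q}) c" and \<phi>: "integrable (lebesgue_on {a<..<b}) \<phi>"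
  shows "(LINT x|lebesgue_on {p<..<q}. c x * cauchy_transform_deriv a b \<phi> (Complex x h))
       = (LINT t|lebesgue_on {a<..<b}. \<phi> t * cauchy_transform_deriv p q c (Complex t (- h)))"
proof -
  let ?S = "lebesgue_on {p<..<q}" and ?K = "lebesgue_on {a<..<b}"
  interpret S: finite_measure ?S by simp
  interpret K: finite_measure ?K by simp
  interpret pair_sigma_finite ?S ?K ..
  have [measurable]: "complex_of_real \<in> borel_measurable ?S" "complex_of_real \<in> borel_measurable ?K"
    by (intro borel_measurable_integrable continuous_integrable_Ioo continuous_intros)+
  have [measurable]: "c \<in> borel_measurable ?S" "\<phi> \<in> borel_measurable ?K" using c \<phi> by auto
  let ?k = "\<lambda>(x, t). 1 / (of_real t - Complex x h)\<^sup>2"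
  define s where "s = Complex 0 h"
  have C: "Complex x h = of_real x + s" for x by (simp add: s_def complex_eq_iff)
  have kb: "norm (?k y) \<le> 1 / h\<^sup>2" for y
    using h power_mono[OF line_distance[of h "snd y" "fst y"], of 2]
    by (simp add: case_prod_beta norm_divide norm_power frac_le)
  have k: "?k \<in> borel_measurable (?S \<Otimes>\<^sub>M ?K)" unfolding C by measurable
  have prod: "integrable (?S \<Otimes>\<^sub>M ?K) (\<lambda>(x, t). c x * \<phi> t)"
  proof (rule Fubini_integrable)
    have "(\<lambda>x. LINT t|?K. norm (case (x, t) of (x, t) \<Rightarrow> c x * \<phi> t)) = (\<lambda>x. norm (c x) * (LINT t|?K. norm (\<phi> t)))"
      by (simp add: norm_mult)
    then show "integrable ?S (\<lambda>x. LINT t|?K. norm (case (x, t) of (x, t) \<Rightarrow> c x * \<phi> t))" using c by simp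
  qed (use c \<phi> in auto)
  have "integrable (?S \<Otimes>\<^sub>M ?K) (\<lambda>y. (case y of (x, t) \<Rightarrow> c x * \<phi> t) * ?k y)"
    by (rule integrable_mult_norm_bounded(1)[OF prod k kb])
  then have int: "integrable (?S \<Otimes>\<^sub>M ?K) (\<lambda>(x, t). c x * \<phi> t * (1 / (of_real t - Complex x h)\<^sup>2))"
    by (simp add: case_prod_unfold)
  have "(LINT x|?S. c x * cauchy_transform_deriv a b \<phi> (Complex x h))
      = (LINT x|?S. LINT t|?K. c x * \<phi> t * (1 / (of_real t - Complex x h)\<^sup>2))"
    unfolding cauchy_transform_deriv_def
    by (intro Bochner_Integration.integral_cong refl, subst Bochner_Integration.integral_mult_right_zero[symmetric]) (simp add: mult.assoc)
  also have "\<dots> = (LINT t|?K. LINT x|?S. c x * \<phi> t * (1 / (of_real t - Complex x h)\<^sup>2))"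
    by (rule Fubini_integral[OF int, symmetric])
  also have "\<dots> = (LINT t|?K. \<phi> t * cauchy_transform_deriv p q c (Complex t (- h)))"
    unfolding cauchy_transform_deriv_def
  proof (intro Bochner_Integration.integral_cong refl, subst Bochner_Integration.integral_mult_right_zero[symmetric], intro Bochner_Integration.integral_cong refl)
    fix t x
    have "complex_of_real t - Complex x h = - (of_real x - Complex t (- h))" by (simp add: complex_eq_iff)
    then show "c x * \<phi> t * (1 / (of_real t - Complex x h)\<^sup>2) = \<phi> t * (c x * (1 / (of_real x - Complex t (- h))\<^sup>2))"
      by (simp only: power2_minus mult_ac)
  qed
  finally show ?thesis .
qed

lemma cauchy_transform_deriv_cnj:
  "cauchy_transform_deriv p q (\<lambda>t. cnj (c t)) (cnj z) = cnj (cauchy_transform_deriv p q c z)"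
proof -
  have "cnj (c t) * (1 / (of_real t - cnj z)\<^sup>2) = cnj (c t * (1 / (of_real t - z)\<^sup>2))" for t by simp
  then show ?thesis unfolding cauchy_transform_deriv_def by (simp only: Bochner_Integration.integral_cnj)
qed

text \<open>If the real part of the transform of the density vanishes on a piece of the line below the slit,
  then by reflection the transform continues to an entire function vanishing at infinity.\<close>

lemma cauchy_transform_deriv_Re_injective:
  assumes h: "h > 0" and ab: "a < b" and c: "integrable (lebesgue_on {p<..<q}) c"
    and zero: "\<And>t. t \<in> {a<..<b} \<Longrightarrow> Re (cauchy_transform_deriv p q c (Complex t (- h))) = 0"
  shows "AE t in lebesgue_on {p<..<q}. c t = 0"
proof -
  \<comment> \<open>The translation puts the line at height \<open>- h\<close> on the real axis. The
    slit of \<open>G\<close> then lies at height \<open>h\<close> and that of \<open>G'\<close> at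
    height \<open>- h\<close>, and \<open>G'\<close> is the conjugate reflection of
    \<open>G\<close>, so their sum on the real axis is twice the real part of
    \<open>G\<close>.\<close>
  define G where "G w = cauchy_transform_deriv p q c (w + Complex 0 (- h))" for w
  define G' where "G' w = cauchy_transform_deriv p q (\<lambda>t. cnj (c t)) (w + Complex 0 h)" for w
  have c': "integrable (lebesgue_on {p<..<q}) (\<lambda>t. cnj (c t))" using c by simp
  define L where "L = {w. Im w < h}"
  define U where "U = {w. Im w > - h}"
  have LU: "open L" "open U" "L \<union> U = UNIV" "convex (L \<inter> U)"
    unfolding L_def U_def using h
    by (auto simp: open_halfspace_Im_lt open_halfspace_Im_gt intro!: convex_Int convex_halfspace_Im_lt convex_halfspace_Im_gt)
  have "w + Complex 0 (- h) \<in> slit p q" if "w \<in> L" for w using that by (auto simp: L_def complex_eq_iff)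
  then have hG: "G holomorphic_on L" unfolding G_def
    by (intro holomorphic_on_compose_gen[OF _ cauchy_transform_holomorphic(2)[OF c], unfolded o_def] holomorphic_intros) auto
  have "w + Complex 0 h \<in> slit p q" if "w \<in> U" for w using that by (auto simp: U_def complex_eq_iff)
  then have hG': "G' holomorphic_on U" unfolding G'_def
    by (intro holomorphic_on_compose_gen[OF _ cauchy_transform_holomorphic(2)[OF c'], unfolded o_def] holomorphic_intros) auto
  have real: "G (of_real t) + G' (of_real t) = 0" if "t \<in> {a<..<b}" for t
  proof -
    have z: "of_real t + Complex 0 (- h) = Complex t (- h)" "of_real t + Complex 0 h = cnj (Complex t (- h))"
      by (simp_all add: complex_eq_iff)
    show ?thesis
      using zero[OF that] unfolding G_def G'_def z cauchy_transform_deriv_cnj by (simp add: complex_eq_iff)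
  qed
  have strip: "G w + G' w = 0" if "w \<in> L \<inter> U" for w
  proof (rule analytic_continuation[where S = "L \<inter> U" and f = "\<lambda>w. G w + G' w"])
    show "(\<lambda>w. G w + G' w) holomorphic_on L \<inter> U"
      by (intro holomorphic_on_add holomorphic_on_subset[OF hG] holomorphic_on_subset[OF hG']) auto
    show "(\<lambda>x. Complex x 0) ` {a<..<b} \<subseteq> L \<inter> U" "Complex ((a + b) / 2) 0 \<in> L \<inter> U"
      using h by (auto simp: L_def U_def)
    show "Complex ((a + b) / 2) 0 islimpt (\<lambda>x. Complex x 0) ` {a<..<b}" by (rule islimpt_line[OF ab])
    show "G w + G' w = 0" if "w \<in> (\<lambda>x. Complex x 0) ` {a<..<b}" for w
      using that real by (auto simp flip: complex_of_real_def)
  qed (use LU that in \<open>auto intro: convex_connected\<close>)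
  \<comment> \<open>On the overlap \<open>L \<inter> U\<close> the branches \<open>G\<close> and
    \<open>- G'\<close> agree, and the two half-planes cover the plane.\<close>
  define E where "E w = (if w \<in> L then G w else - G' w)" for w
  have "E holomorphic_on L \<union> U" unfolding E_def
    by (intro holomorphic_on_If_Un hG holomorphic_on_minus hG' LU) (use strip in \<open>auto simp: eq_neg_iff_add_eq_0\<close>)
  then have "E holomorphic_on UNIV" by (simp add: LU)
  moreover have "(E \<longlongrightarrow> 0) at_infinity"
  proof -
    have G: "(G \<longlongrightarrow> 0) at_infinity" "(G' \<longlongrightarrow> 0) at_infinity"
      unfolding G_def G'_def by (intro cauchy_transform_deriv_at_infinity c c')+
    have "((\<lambda>w. norm (G w) + norm (G' w)) \<longlongrightarrow> 0 + 0) at_infinity"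
      by (intro tendsto_add tendsto_norm_zero G)
    then show ?thesis
      by (intro Lim_null_comparison[of E "\<lambda>w. norm (G w) + norm (G' w)"]) (auto simp: E_def)
  qed
  ultimately have E0: "E w = 0" for w by (rule Liouville_weak)
  have line: "cauchy_transform_deriv p q c (Complex x (- h)) = 0" for x
  proof -
    have "of_real x + Complex 0 (- h) = Complex x (- h)" by (simp add: complex_eq_iff)
    then show ?thesis using E0[of "of_real x"] h by (simp add: E_def L_def G_def)
  qed
  have "cauchy_transform_deriv p q c z = 0" if "z \<in> slit p q" for z
  proof (rule analytic_continuation[OF cauchy_transform_holomorphic(2)[OF c] open_slit connected_slit _ _ islimpt_line[OF ab, of "- h"] _ that])
    show "(\<lambda>x. Complex x (- h)) ` {a<..<b} \<subseteq> slit p q" "Complex ((a + b) / 2) (- h) \<in> slit p q"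
      using line_in_slit[of "- h" _ p q] h by (simp_all add: image_subset_iff del: Compl_iff)
  qed (use line in auto)
  then show ?thesis by (rule cauchy_transform_deriv_injective[OF c])
qed

text \<open>Moving the operator to the other side of the pairing turns orthogonality to all images
  into orthogonality of a continuous function \<open>k\<close> to all test functions;
  \<open>k\<close> is the real part handled by the reflection argument.\<close>

lemma b2_star_dense_range:
  assumes h: "h > 0" and ab: "a < b" and f: "f \<in> L2 {p<..<q}"
    and orth: "\<And>\<psi>. \<psi> \<in> test_functions {a<..<b} \<Longrightarrow> L2_inner {p<..<q} f (b2_star h {a<..<b} \<psi>) = 0"
  shows "AE x in lebesgue_on {p<..<q}. f x = 0"
proof -
  let ?S = "lebesgue_on {p<..<q}" and ?K = "lebesgue_on {a<..<b}"
  \<comment> \<open>The components are swapped so that the real inner product with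
    \<open>b2_star\<close> becomes \<open>- 1 / pi\<close> times the real part of a complex
    product.\<close>
  define c where "c x = Complex (snd (f x)) (fst (f x))" for x
  have fi: "integrable ?S f" by (rule L2_integrable[OF f])
  have ci: "integrable ?S c"
    unfolding c_def[abs_def] Complex_eq
    using integrable_bounded_linear[OF bounded_linear_fst fi] integrable_bounded_linear[OF bounded_linear_snd fi]
    by simp
  define k where "k t = Re (cauchy_transform_deriv p q c (Complex t (- h)))" for t
  have kc: "continuous_on A k" for A
    unfolding k_def by (intro continuous_intros cauchy_transform_deriv_line_continuous ci) (use h in simp)
  have "(LINT t|?K. k t * \<psi> t) = 0" if \<psi>: "\<psi> \<in> test_functions {a<..<b}" for \<psi>
  proof -
    have \<psi>i: "integrable ?K \<psi>" by (intro continuous_integrable_Ioo test_function_deriv(2)[OF \<psi>])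
    note \<psi>c = integrable_of_real_Ioo[OF \<psi>i]
    let ?D = "\<lambda>x. cauchy_transform_deriv a b (\<lambda>t. complex_of_real (\<psi> t)) (Complex x h)"
    let ?H = "\<lambda>t. cauchy_transform_deriv p q c (Complex t (- h))"
    have bdd: "\<exists>B. \<forall>x\<in>{u..v}. norm (W x) \<le> B" if "continuous_on {u..v} W" for W :: "real \<Rightarrow> complex" and u v
      using compact_imp_bounded[OF compact_continuous_image[OF that compact_Icc]] by (auto simp: bounded_iff)
    have Dc: "continuous_on A ?D" and Hc: "continuous_on A ?H" for A
      using h by (intro cauchy_transform_deriv_line_continuous \<psi>c ci; simp)+
    obtain B where "\<forall>x\<in>{p..q}. norm (?D x) \<le> B" using bdd[OF Dc] by blast
    then have i1: "integrable ?S (\<lambda>x. c x * ?D x)"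
      by (intro integrable_mult_norm_bounded(1)[OF ci, where B = B] borel_measurable_integrable[OF continuous_integrable_Ioo[OF Dc]]) auto
    obtain B where "\<forall>x\<in>{a..b}. norm (?H x) \<le> B" using bdd[OF Hc] by blast
    then have i2: "integrable ?K (\<lambda>t. complex_of_real (\<psi> t) * ?H t)"
      by (intro integrable_mult_norm_bounded(1)[OF \<psi>c, where B = B] borel_measurable_integrable[OF continuous_integrable_Ioo[OF Hc]]) auto
    have "f x \<bullet> b2_star h {a<..<b} \<psi> x = (- 1 / pi) * Re (c x * ?D x)" for x
      unfolding b2_star_eq[OF h \<psi>i] by (cases "f x") (simp add: c_def field_simps)
    then have "0 = (- 1 / pi) * (LINT x|?S. Re (c x * ?D x))"
      using orth[OF \<psi>] by (simp add: L2_inner_def)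
    then have "(LINT x|?S. Re (c x * ?D x)) = 0" by simp
    then have "Re (LINT x|?S. c x * ?D x) = 0" using integral_Re[OF i1] by simp
    then have "Re (LINT t|?K. complex_of_real (\<psi> t) * ?H t) = 0"
      by (simp add: cauchy_transform_deriv_Fubini[OF h ci \<psi>c])
    then show ?thesis using integral_Re[OF i2] by (simp add: k_def mult.commute)
  qed
  \<comment> \<open>Orthogonality to all test functions says precisely that \<open>k\<close> is a
    weak derivative of 0, so uniqueness of weak derivatives gives \<open>k = 0\<close>.\<close>
  then have "has_L2_weak_deriv {a<..<b} (\<lambda>_. 0) k"
    using continuous_L2_Ioo[OF kc] by (simp add: has_L2_weak_deriv_def)
  from weak_deriv_unique[OF ab zero_W012[OF ab] this zero_weak_deriv]
  have "AE t in ?K. k t = 0" by (simp add: eq_L2_def)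
  from continuous_AE_zero_imp_zero[OF kc this] have "k t = 0" if "t \<in> {a<..<b}" for t using that by blast
  then have "AE x in ?S. c x = 0"
    by (intro cauchy_transform_deriv_Re_injective[OF h ab ci]) (simp add: k_def)
  then show ?thesis
    by eventually_elim (simp add: c_def complex_eq_iff prod_eq_iff)
qed

section \<open>The constrained minimization problem\<close>

lemma L2_inner_integrable:
  assumes "f \<in> L2 S" "g \<in> L2 S"
  shows "integrable (lebesgue_on S) (\<lambda>x. f x \<bullet> g x)"
proof -
  have [measurable]: "f \<in> borel_measurable (lebesgue_on S)" "g \<in> borel_measurable (lebesgue_on S)"
    using assms by (simp_all add: L2_measurable)
  have "integrable (lebesgue_on S) (\<lambda>x. norm (f x) * norm (g x))"
    by (rule integrable_mult_of_squares) (use L2_square[OF assms(1)] L2_square[OF assms(2)] in measurable)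
  then show ?thesis
    by (rule Bochner_Integration.integrable_bound) (auto simp: Cauchy_Schwarz_ineq2)
qed

lemma L2_inner_lin_comb:
  assumes f: "f \<in> L2 S" and g: "g \<in> L2 S"
  shows "L2_inner S (\<lambda>x. p *\<^sub>R f x + q *\<^sub>R g x) (\<lambda>x. p *\<^sub>R f x + q *\<^sub>R g x)
     = p\<^sup>2 * L2_inner S f f + 2 * p * q * L2_inner S f g + q\<^sup>2 * L2_inner S g g"
proof -
  have "(p *\<^sub>R f x + q *\<^sub>R g x) \<bullet> (p *\<^sub>R f x + q *\<^sub>R g x)
      = p\<^sup>2 * (f x \<bullet> f x) + 2 * p * q * (f x \<bullet> g x) + q\<^sup>2 * (g x \<bullet> g x)" for x
    by (simp add: inner_add_left inner_add_right inner_commute power2_eq_square algebra_simps)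
  then show ?thesis
    unfolding L2_inner_def
    using L2_inner_integrable[OF f f] L2_inner_integrable[OF f g] L2_inner_integrable[OF g g] by simp
qed

lemma L2_inner_self_nonneg: "0 \<le> L2_inner S f f"
  unfolding L2_inner_def by (rule Bochner_Integration.integral_nonneg) simp

lemma L2_inner_self_eq_0:
  assumes f: "f \<in> L2 S" and "L2_inner S f f = 0"
  shows "AE x in lebesgue_on S. f x = 0"
proof -
  have "AE x in lebesgue_on S. f x \<bullet> f x = 0"
    using integral_nonneg_eq_0_iff_AE[OF L2_inner_integrable[OF f f]] assms(2) by (simp add: L2_inner_def)
  then show ?thesis by eventually_elim simp
qed

text \<open>Closedness of a ball. With \<open>r\<close> the difference of \<open>g\<close> and
  \<open>G n\<close>, Young's inequality with weight \<open>\<eta>\<close> bounds the mixed term;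
  letting \<open>n\<close> grow leaves \<open>(1 + \<eta>) * B\<close>.\<close>

lemma L2_inner_le_limit:
  fixes G :: "nat \<Rightarrow> real \<Rightarrow> real"
  assumes G: "\<And>n. G n \<in> L2 S" and g: "g \<in> L2 S" and bound: "\<And>n. L2_inner S (G n) (G n) \<le> B"
    and lim: "(\<lambda>n. LINT x|lebesgue_on S. (G n x - g x)\<^sup>2) \<longlonglongrightarrow> 0"
  shows "L2_inner S g g \<le> B"
proof (rule field_le_epsilon)
  fix \<epsilon> :: real assume "\<epsilon> > 0"
  have B: "B \<ge> 0" using bound[of 0] L2_inner_self_nonneg[of S "G 0"] by linarith
  define \<eta> where "\<eta> = \<epsilon> / (B + 1)"
  have \<eta>: "\<eta> > 0" using \<open>\<epsilon> > 0\<close> B by (simp add: \<eta>_def)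
  define d where "d n = (LINT x|lebesgue_on S. (G n x - g x)\<^sup>2)" for n
  have "L2_inner S g g \<le> (1 + \<eta>) * B + (1 + 1 / \<eta>) * d n" for n
  proof -
    let ?r = "\<lambda>x. g x - G n x"
    have r: "?r \<in> L2 S" by (rule L2_diff[OF g G])
    have "L2_inner S ?r ?r = d n"
      unfolding L2_inner_def d_def by (intro Bochner_Integration.integral_cong) (simp_all add: power2_eq_square algebra_simps)
    moreover have "L2_inner S g g = L2_inner S (G n) (G n) + 2 * L2_inner S (G n) ?r + L2_inner S ?r ?r"
      using L2_inner_lin_comb[OF G r, of 1 n 1] by simp
    moreover have "0 \<le> \<eta>\<^sup>2 * L2_inner S (G n) (G n) - 2 * \<eta> * L2_inner S (G n) ?r + L2_inner S ?r ?r"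
      using L2_inner_lin_comb[OF G r, of \<eta> n "-1"] L2_inner_self_nonneg[of S "\<lambda>x. \<eta> *\<^sub>R G n x + (-1) *\<^sub>R ?r x"] by simp
    then have "2 * L2_inner S (G n) ?r \<le> \<eta> * L2_inner S (G n) (G n) + L2_inner S ?r ?r / \<eta>"
      using \<eta> by (simp add: field_simps power2_eq_square)
    moreover have "(1 + \<eta>) * L2_inner S (G n) (G n) \<le> (1 + \<eta>) * B"
      using \<eta> bound by (intro mult_left_mono) auto
    ultimately show ?thesis by (simp add: algebra_simps)
  qed
  moreover have "(\<lambda>n. (1 + \<eta>) * B + (1 + 1 / \<eta>) * d n) \<longlonglongrightarrow> (1 + \<eta>) * B + (1 + 1 / \<eta>) * 0"
    using lim unfolding d_def by (intro tendsto_intros)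
  ultimately have "L2_inner S g g \<le> (1 + \<eta>) * B"
    by (intro LIMSEQ_le_const[of _ "(1 + \<eta>) * B" "L2_inner S g g"]) auto
  moreover have "\<eta> * B \<le> \<epsilon>" using B \<open>\<epsilon> > 0\<close> by (simp add: \<eta>_def field_simps)
  ultimately show "L2_inner S g g \<le> B + \<epsilon>" by (simp add: algebra_simps)
qed

text \<open>The first-order condition at a minimizer when only small perturbations are admissible:
  for small \<open>s\<close> of sign opposite to \<open>c\<close> the linear term wins.\<close>

lemma quadratic_nonneg_near_0:
  fixes c d :: real
  assumes "s0 > 0" "d \<ge> 0" "\<And>s. \<bar>s\<bar> \<le> s0 \<Longrightarrow> 0 \<le> 2 * s * c + s\<^sup>2 * d"
  shows "c = 0"
proof (rule ccontr)
  assume c: "c \<noteq> 0"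
  \<comment> \<open>Chosen so that \<open>t * d \<le> \<bar>c\<bar>\<close>, which leaves the linear
    contribution \<open>2 * \<bar>c\<bar>\<close> dominant.\<close>
  define t where "t = min s0 (\<bar>c\<bar> / (d + 1))"
  have t: "t > 0" "t \<le> s0" "t \<le> \<bar>c\<bar> / (d + 1)" using assms c by (auto simp: t_def)
  have "t * d \<le> \<bar>c\<bar>"
    using t assms(2) by (simp add: field_simps)
  have "0 \<le> 2 * (- sgn c * t) * c + (- sgn c * t)\<^sup>2 * d"
    by (rule assms(3)) (use t c in \<open>simp add: abs_mult abs_sgn_eq\<close>)
  also have "\<dots> = t * (t * d - 2 * \<bar>c\<bar>)"
    using c by (simp add: power_mult_distrib sgn_if abs_if power2_eq_square algebra_simps)
  also have "\<dots> < 0" using t(1) \<open>t * d \<le> \<bar>c\<bar>\<close> c by (intro mult_pos_neg) auto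
  finally show False by simp
qed

text \<open>The closure is compact and connected, hence a segment, and an open convex set is the
  interior of its closure.\<close>

lemma open_bounded_interval_Ioo:
  fixes S :: "real set"
  assumes "is_interval S" "open S" "bounded S" "S \<noteq> {}"
  obtains p q where "p < q" "S = {p<..<q}"
proof -
  have "convex S" using assms(1) by (simp add: is_interval_convex)
  then have "connected (closure S)" "compact (closure S)"
    using assms by (auto simp: convex_connected convex_closure)
  then obtain p q where "closure S = {p..q}" using connected_compact_interval_1[of "closure S"] by auto
  then have "S = {p<..<q}"
    using convex_interior_closure[OF \<open>convex S\<close>] assms(2) by (simp add: interior_open interior_atLeastAtMost_real)
  then show ?thesis using that assms(4) by force
qed

section \<open>The variational argument on two fixed intervals\<close>

context
  fixes a b p q h :: real and e :: "real \<Rightarrow> real \<times> real"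
  assumes ab: "a < b" and pq: "p < q" and h: "h > 0" and e: "e \<in> L2 {p<..<q}"
begin

abbreviation "W \<equiv> W012 {a<..<b}"
abbreviation "dirichlet \<phi> \<psi> \<equiv> L2_inner {a<..<b} (weak_deriv {a<..<b} \<phi>) (weak_deriv {a<..<b} \<psi>)"
abbreviation "b2 \<equiv> b2_star h {a<..<b}"
abbreviation "res \<phi> \<equiv> (\<lambda>x. b2 \<phi> x - e x)"
abbreviation "misfit \<phi> \<equiv> L2_inner {p<..<q} (res \<phi>) (res \<phi>)"

lemma W_integrable: "\<phi> \<in> W \<Longrightarrow> integrable (lebesgue_on {a<..<b}) \<phi>"
  by (auto simp: W012_def intro: L2_integrable)

lemma b2_L2: "\<phi> \<in> W \<Longrightarrow> b2 \<phi> \<in> L2 {p<..<q}"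
  by (intro continuous_L2_Ioo b2_star_continuous h W_integrable)

lemma res_L2: "\<phi> \<in> W \<Longrightarrow> res \<phi> \<in> L2 {p<..<q}"
  by (intro L2_diff b2_L2 e)

lemma weak_deriv_L2: "\<phi> \<in> W \<Longrightarrow> weak_deriv {a<..<b} \<phi> \<in> L2 {a<..<b}"
  using has_weak_deriv[of \<phi> "{a<..<b}"] by (simp add: has_L2_weak_deriv_def)

lemma dirichlet_eq:
  assumes "\<phi> \<in> W" "has_L2_weak_deriv {a<..<b} \<phi> g"
  shows "dirichlet \<phi> \<phi> = L2_inner {a<..<b} g g"
proof -
  have "W012_norm {a<..<b} \<phi> = sqrt (L2_inner {a<..<b} g g)"
    using W012_norm_eq[OF ab assms] by (simp add: L2_inner_def power2_eq_square)
  then show ?thesis by (simp add: W012_norm_def L2_norm_def)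
qed

lemma dirichlet_lin_comb:
  assumes \<phi>: "\<phi> \<in> W" and \<psi>: "\<psi> \<in> W"
  shows "dirichlet (\<lambda>x. r * \<phi> x + s * \<psi> x) (\<lambda>x. r * \<phi> x + s * \<psi> x)
    = r\<^sup>2 * dirichlet \<phi> \<phi> + 2 * r * s * dirichlet \<phi> \<psi> + s\<^sup>2 * dirichlet \<psi> \<psi>"
proof -
  have L: "\<phi> \<in> L2 {a<..<b}" "\<psi> \<in> L2 {a<..<b}" using \<phi> \<psi> by (auto simp: W012_def)
  have "dirichlet (\<lambda>x. r * \<phi> x + s * \<psi> x) (\<lambda>x. r * \<phi> x + s * \<psi> x)
     = L2_inner {a<..<b} (\<lambda>x. r *\<^sub>R weak_deriv {a<..<b} \<phi> x + s *\<^sub>R weak_deriv {a<..<b} \<psi> x)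
         (\<lambda>x. r *\<^sub>R weak_deriv {a<..<b} \<phi> x + s *\<^sub>R weak_deriv {a<..<b} \<psi> x)"
    using dirichlet_eq[OF W012_lin_comb[OF ab \<phi> \<psi>]
        has_L2_weak_deriv_lin_comb[OF has_weak_deriv[OF \<phi>] has_weak_deriv[OF \<psi>] L]] by simp
  then show ?thesis by (simp only: L2_inner_lin_comb[OF weak_deriv_L2[OF \<phi>] weak_deriv_L2[OF \<psi>]])
qed

text \<open>The parallelogram identity, in which \<open>e\<close> cancels from the difference of the
  residuals. Dropping the last term gives the convexity used for existence; keeping it gives
  uniqueness.\<close>

lemma misfit_midpoint:
  assumes \<phi>: "\<phi> \<in> W" and \<psi>: "\<psi> \<in> W"
  shows "misfit (\<lambda>x. 1/2 * \<phi> x + 1/2 * \<psi> x)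
    = (misfit \<phi> + misfit \<psi>) / 2 - L2_inner {p<..<q} (\<lambda>x. b2 \<phi> x - b2 \<psi> x) (\<lambda>x. b2 \<phi> x - b2 \<psi> x) / 4"
proof -
  note R = res_L2[OF \<phi>] res_L2[OF \<psi>]
  have "res (\<lambda>x. 1/2 * \<phi> x + 1/2 * \<psi> x) = (\<lambda>x. (1/2) *\<^sub>R res \<phi> x + (1/2) *\<^sub>R res \<psi> x)"
    unfolding b2_star_lin_comb[OF h W_integrable[OF \<phi>] W_integrable[OF \<psi>]]
    by (simp add: fun_eq_iff prod_eq_iff field_simps)
  then have "misfit (\<lambda>x. 1/2 * \<phi> x + 1/2 * \<psi> x)
     = misfit \<phi> / 4 + L2_inner {p<..<q} (res \<phi>) (res \<psi>) / 2 + misfit \<psi> / 4"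
    using L2_inner_lin_comb[OF R, of "1/2" "1/2"] by (simp add: power2_eq_square)
  moreover have "(\<lambda>x. b2 \<phi> x - b2 \<psi> x) = (\<lambda>x. 1 *\<^sub>R res \<phi> x + (-1) *\<^sub>R res \<psi> x)" by simp
  then have "L2_inner {p<..<q} (\<lambda>x. b2 \<phi> x - b2 \<psi> x) (\<lambda>x. b2 \<phi> x - b2 \<psi> x)
     = misfit \<phi> - 2 * L2_inner {p<..<q} (res \<phi>) (res \<psi>) + misfit \<psi>"
    using L2_inner_lin_comb[OF R, of 1 "-1"] by simp
  ultimately show ?thesis by (simp add: field_simps)
qed

text \<open>The factor 1 is kept so that the perturbed function matches \<open>W012_lin_comb\<close>
  and \<open>dirichlet_lin_comb\<close> literally.\<close>

lemma misfit_perturbation: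
  assumes \<phi>: "\<phi> \<in> W" and \<psi>: "\<psi> \<in> W"
  shows "misfit (\<lambda>x. 1 * \<phi> x + s * \<psi> x)
    = misfit \<phi> + 2 * s * L2_inner {p<..<q} (res \<phi>) (b2 \<psi>) + s\<^sup>2 * L2_inner {p<..<q} (b2 \<psi>) (b2 \<psi>)"
proof -
  have "res (\<lambda>x. 1 * \<phi> x + s * \<psi> x) = (\<lambda>x. 1 *\<^sub>R res \<phi> x + s *\<^sub>R b2 \<psi> x)"
    unfolding b2_star_lin_comb[OF h W_integrable[OF \<phi>] W_integrable[OF \<psi>]] by (auto simp: algebra_simps)
  then show ?thesis using L2_inner_lin_comb[OF res_L2[OF \<phi>] b2_L2[OF \<psi>], of 1 s] by simp
qed

text \<open>Expand the misfit at \<open>\<phi>\<close> in the direction \<open>X n - \<phi>\<close>.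
  The image of this direction is uniformly at most \<open>\<delta> n\<close>, so the linear and
  quadratic terms both tend to zero.\<close>

lemma misfit_tendsto:
  assumes X: "\<And>n. X n \<in> W" and \<phi>: "\<phi> \<in> W"
    and lim: "(\<lambda>n. LINT x|lebesgue_on {a<..<b}. \<bar>X n x - \<phi> x\<bar>) \<longlonglongrightarrow> 0"
  shows "(\<lambda>n. misfit (X n)) \<longlonglongrightarrow> misfit \<phi>"
proof -
  let ?M = "lebesgue_on {p<..<q}"
  define \<delta> where "\<delta> n = 1 / h\<^sup>2 * (LINT x|lebesgue_on {a<..<b}. \<bar>X n x - \<phi> x\<bar>)" for n
  have \<delta>0: "\<delta> n \<ge> 0" for n unfolding \<delta>_def by (intro mult_nonneg_nonneg Bochner_Integration.integral_nonneg) auto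
  have \<delta>lim: "\<delta> \<longlonglongrightarrow> 0" unfolding \<delta>_def[abs_def] by (rule tendsto_mult_right_zero[OF lim])
  define R where "R = (LINT x|?M. norm (res \<phi> x))"
  have arith: "\<bar>2 * x + y\<bar> \<le> 2 * r + s" if "\<bar>x\<bar> \<le> r" "\<bar>y\<bar> \<le> s" for x y r s :: real
    using that by (simp add: abs_le_iff)
  have "\<bar>misfit (X n) - misfit \<phi>\<bar> \<le> 2 * (\<delta> n * R) + (\<delta> n)\<^sup>2 * (q - p)" for n
  proof -
    let ?\<psi> = "\<lambda>x. 1 * X n x + (-1) * \<phi> x"
    have \<psi>: "?\<psi> \<in> W" by (rule W012_lin_comb[OF ab X \<phi>])
    have bound: "norm (b2 ?\<psi> x) \<le> \<delta> n" for x
      using b2_star_bound[OF h W_integrable[OF \<psi>], of x] by (simp add: \<delta>_def)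
    have "misfit (X n) - misfit \<phi> = 2 * L2_inner {p<..<q} (res \<phi>) (b2 ?\<psi>) + L2_inner {p<..<q} (b2 ?\<psi>) (b2 ?\<psi>)"
      using misfit_perturbation[OF \<phi> \<psi>, of 1] by simp
    moreover have "norm (L2_inner {p<..<q} (res \<phi>) (b2 ?\<psi>)) \<le> (LINT x|?M. \<delta> n * norm (res \<phi> x))"
      unfolding L2_inner_def
    proof (rule norm_integral_le)
      show "integrable ?M (\<lambda>x. \<delta> n * norm (res \<phi> x))" using L2_integrable[OF res_L2[OF \<phi>]] by simp
      show "norm (res \<phi> x \<bullet> b2 ?\<psi> x) \<le> \<delta> n * norm (res \<phi> x)" for x
        using Cauchy_Schwarz_ineq2[of "res \<phi> x" "b2 ?\<psi> x"] mult_left_mono[OF bound[of x], of "norm (res \<phi> x)"]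
        by (simp add: mult.commute)
    qed (rule L2_inner_integrable[OF res_L2[OF \<phi>] b2_L2[OF \<psi>]])
    moreover have "norm (L2_inner {p<..<q} (b2 ?\<psi>) (b2 ?\<psi>)) \<le> (LINT x|?M. (\<delta> n)\<^sup>2)"
      unfolding L2_inner_def
    proof (rule norm_integral_le)
      show "norm (b2 ?\<psi> x \<bullet> b2 ?\<psi> x) \<le> (\<delta> n)\<^sup>2" for x
        using power_mono[OF bound[of x], of 2] by (simp add: power2_norm_eq_inner)
      show "integrable ?M (\<lambda>x. (\<delta> n)\<^sup>2)" by (rule finite_measure.integrable_const) simp
    qed (rule L2_inner_integrable[OF b2_L2[OF \<psi>] b2_L2[OF \<psi>]])
    ultimately show ?thesis
      using arith[of "L2_inner {p<..<q} (res \<phi>) (b2 ?\<psi>)" "\<delta> n * R" "L2_inner {p<..<q} (b2 ?\<psi>) (b2 ?\<psi>)" "(\<delta> n)\<^sup>2 * (q - p)"] pq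
      by (simp add: R_def measure_restrict_space mult.commute)
  qed
  then have le: "norm (misfit (X n) - misfit \<phi>) \<le> 2 * (\<delta> n * R) + (\<delta> n)\<^sup>2 * (q - p)" for n
    unfolding real_norm_def .
  have "(\<lambda>n. 2 * (\<delta> n * R) + (\<delta> n)\<^sup>2 * (q - p)) \<longlonglongrightarrow> 2 * (0 * R) + 0\<^sup>2 * (q - p)"
    by (intro tendsto_intros \<delta>lim)
  then have "(\<lambda>n. 2 * (\<delta> n * R) + (\<delta> n)\<^sup>2 * (q - p)) \<longlonglongrightarrow> 0" by simp
  from Lim_null_comparison[OF always_eventually[OF allI[OF le]] this]
  have "(\<lambda>n. misfit (X n) - misfit \<phi>) \<longlonglongrightarrow> 0" .
  then show ?thesis by (simp add: LIM_zero_iff)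
qed

lemma constrained_minimizer_exists:
  assumes M: "M \<ge> 0"
  shows "\<exists>\<phi>\<in>{\<phi> \<in> W. dirichlet \<phi> \<phi> \<le> M\<^sup>2}. \<forall>\<psi>\<in>{\<phi> \<in> W. dirichlet \<phi> \<phi> \<le> M\<^sup>2}. misfit \<phi> \<le> misfit \<psi>"
\<comment> \<open>The distance \<open>D\<close> is taken between the chosen weak derivatives, so
  that the Cauchy condition is literally the hypothesis of \<open>W012_complete\<close>.\<close>
proof (rule midpoint_minimizer_exists[where N = "\<lambda>\<phi>. dirichlet \<phi> \<phi>" and B = "M\<^sup>2"
      and D = "\<lambda>\<phi> \<psi>. LINT x|lebesgue_on {a<..<b}. (weak_deriv {a<..<b} \<phi> x - weak_deriv {a<..<b} \<psi> x)\<^sup>2"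
      and mid = "\<lambda>\<phi> \<psi> x. 1/2 * \<phi> x + 1/2 * \<psi> x"])
  have "dirichlet (\<lambda>_. 0) (\<lambda>_. 0) = 0"
    using dirichlet_eq[OF zero_W012[OF ab] zero_weak_deriv] by (simp add: L2_inner_def)
  then show "{\<phi> \<in> W. dirichlet \<phi> \<phi> \<le> M\<^sup>2} \<noteq> {}" using zero_W012[OF ab] by force
next
  fix \<phi> \<psi> assume "\<phi> \<in> {\<phi> \<in> W. dirichlet \<phi> \<phi> \<le> M\<^sup>2}" "\<psi> \<in> {\<phi> \<in> W. dirichlet \<phi> \<phi> \<le> M\<^sup>2}"
  then have \<phi>: "\<phi> \<in> W" "dirichlet \<phi> \<phi> \<le> M\<^sup>2" and \<psi>: "\<psi> \<in> W" "dirichlet \<psi> \<psi> \<le> M\<^sup>2" by auto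
  let ?D = "LINT x|lebesgue_on {a<..<b}. (weak_deriv {a<..<b} \<phi> x - weak_deriv {a<..<b} \<psi> x)\<^sup>2"
  have "?D = dirichlet \<phi> \<phi> - 2 * dirichlet \<phi> \<psi> + dirichlet \<psi> \<psi>"
    using L2_inner_lin_comb[OF weak_deriv_L2[OF \<phi>(1)] weak_deriv_L2[OF \<psi>(1)], of 1 "-1"]
    by (simp add: L2_inner_def power2_eq_square)
  then have N: "dirichlet (\<lambda>x. 1/2 * \<phi> x + 1/2 * \<psi> x) (\<lambda>x. 1/2 * \<phi> x + 1/2 * \<psi> x) = (dirichlet \<phi> \<phi> + dirichlet \<psi> \<psi>) / 2 - ?D / 4"
    unfolding dirichlet_lin_comb[OF \<phi>(1) \<psi>(1)] by (simp add: power2_eq_square field_simps)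
  then show "dirichlet (\<lambda>x. 1/2 * \<phi> x + 1/2 * \<psi> x) (\<lambda>x. 1/2 * \<phi> x + 1/2 * \<psi> x) \<le> (dirichlet \<phi> \<phi> + dirichlet \<psi> \<psi>) / 2 - ?D / 4" by simp
  have arith: "(r + s) / 2 - d / 4 \<le> m" if "r \<le> m" "s \<le> m" "0 \<le> d" for r s d m :: real
    using that by (simp add: field_simps)
  have arith': "r - d / 4 \<le> r" if "0 \<le> d" for r d :: real using that by simp
  have "dirichlet (\<lambda>x. 1/2 * \<phi> x + 1/2 * \<psi> x) (\<lambda>x. 1/2 * \<phi> x + 1/2 * \<psi> x) \<le> M\<^sup>2"
    unfolding N by (rule arith[OF \<phi>(2) \<psi>(2)]) simp
  then show "(\<lambda>x. 1/2 * \<phi> x + 1/2 * \<psi> x) \<in> {\<phi> \<in> W. dirichlet \<phi> \<phi> \<le> M\<^sup>2}"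
    using W012_lin_comb[OF ab \<phi>(1) \<psi>(1), of "1/2" "1/2"] by blast
  show "misfit (\<lambda>x. 1/2 * \<phi> x + 1/2 * \<psi> x) \<le> (misfit \<phi> + misfit \<psi>) / 2"
    unfolding misfit_midpoint[OF \<phi>(1) \<psi>(1)]
    by (rule arith'[OF L2_inner_self_nonneg])
next
  fix X :: "nat \<Rightarrow> real \<Rightarrow> real" assume "\<And>n. X n \<in> {\<phi> \<in> W. dirichlet \<phi> \<phi> \<le> M\<^sup>2}"
  then have X: "\<And>n. X n \<in> W" "\<And>n. dirichlet (X n) (X n) \<le> M\<^sup>2" by auto
  assume "\<And>\<epsilon>. \<epsilon> > 0 \<Longrightarrow> \<exists>n0. \<forall>m\<ge>n0. \<forall>n\<ge>n0.
     (LINT x|lebesgue_on {a<..<b}. (weak_deriv {a<..<b} (X m) x - weak_deriv {a<..<b} (X n) x)\<^sup>2) < \<epsilon>"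
  from W012_complete[OF ab X(1) has_weak_deriv[OF X(1)] this]
  obtain \<phi> g where \<phi>: "\<phi> \<in> W" "has_L2_weak_deriv {a<..<b} \<phi> g"
    and lim: "(\<lambda>n. LINT x|lebesgue_on {a<..<b}. (weak_deriv {a<..<b} (X n) x - g x)\<^sup>2) \<longlonglongrightarrow> 0"
      "(\<lambda>n. LINT x|lebesgue_on {a<..<b}. \<bar>X n x - \<phi> x\<bar>) \<longlonglongrightarrow> 0" by blast
  have "g \<in> L2 {a<..<b}" using \<phi>(2) by (simp add: has_L2_weak_deriv_def)
  from L2_inner_le_limit[OF weak_deriv_L2[OF X(1)] this X(2) lim(1)]
  have "dirichlet \<phi> \<phi> \<le> M\<^sup>2" using dirichlet_eq[OF \<phi>] by simp
  then show "\<exists>\<phi>\<in>{\<phi> \<in> W. dirichlet \<phi> \<phi> \<le> M\<^sup>2}. (\<lambda>n. misfit (X n)) \<longlonglongrightarrow> misfit \<phi>"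
    using \<phi>(1) misfit_tendsto[OF X(1) \<phi>(1) lim(2)] by blast
qed (auto intro: L2_inner_self_nonneg)

lemma is_solution_iff:
  assumes M: "M \<ge> 0"
  shows "is_solution {p<..<q} {a<..<b} h e M \<phi> \<longleftrightarrow>
    \<phi> \<in> W \<and> dirichlet \<phi> \<phi> \<le> M\<^sup>2 \<and> (\<forall>\<psi>\<in>W. dirichlet \<psi> \<psi> \<le> M\<^sup>2 \<longrightarrow> misfit \<phi> \<le> misfit \<psi>)"
proof -
  have "W012_norm {a<..<b} \<psi> \<le> M \<longleftrightarrow> dirichlet \<psi> \<psi> \<le> M\<^sup>2" for \<psi>
    using M real_sqrt_le_iff[of "dirichlet \<psi> \<psi>" "M\<^sup>2"] by (simp add: W012_norm_def L2_norm_def)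
  then show ?thesis by (simp add: is_solution_def L2_norm_def)
qed

text \<open>The midpoint of two solutions is admissible. By \<open>misfit_midpoint\<close> it would
  improve on them unless their images agree, and injectivity does the rest.\<close>

lemma solution_unique:
  assumes M: "M \<ge> 0" and s: "is_solution {p<..<q} {a<..<b} h e M \<phi>" "is_solution {p<..<q} {a<..<b} h e M \<psi>"
  shows "eq_L2 {a<..<b} \<phi> \<psi>"
proof -
  have \<phi>: "\<phi> \<in> W" "dirichlet \<phi> \<phi> \<le> M\<^sup>2" and \<psi>: "\<psi> \<in> W" "dirichlet \<psi> \<psi> \<le> M\<^sup>2"
    and min: "\<And>\<eta>. \<eta> \<in> W \<Longrightarrow> dirichlet \<eta> \<eta> \<le> M\<^sup>2 \<Longrightarrow> misfit \<phi> \<le> misfit \<eta>" and le: "misfit \<psi> \<le> misfit \<phi>"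
    using s by (auto simp: is_solution_iff[OF M])
  let ?m = "\<lambda>x. 1/2 * \<phi> x + 1/2 * \<psi> x"
  let ?d = "\<lambda>x. 1 * \<phi> x + (-1) * \<psi> x"
  \<comment> \<open>Nonnegativity at the difference bounds the mixed term, which makes the midpoint
    admissible.\<close>
  have "0 \<le> dirichlet ?d ?d" by (rule L2_inner_self_nonneg)
  then have "dirichlet ?m ?m \<le> M\<^sup>2"
    using \<phi>(2) \<psi>(2) unfolding dirichlet_lin_comb[OF \<phi>(1) \<psi>(1)] by (simp add: power2_eq_square)
  note mid = min[OF W012_lin_comb[OF ab \<phi>(1) \<psi>(1)] this, unfolded misfit_midpoint[OF \<phi>(1) \<psi>(1)]]
  have arith: "d = 0" if "r \<le> (r + s) / 2 - d / 4" "s \<le> r" "0 \<le> d" for r s d :: real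
    using that by (simp add: field_simps)
  have "L2_inner {p<..<q} (\<lambda>x. b2 \<phi> x - b2 \<psi> x) (\<lambda>x. b2 \<phi> x - b2 \<psi> x) = 0"
    by (rule arith[OF mid le L2_inner_self_nonneg])
  from L2_inner_self_eq_0[OF L2_diff[OF b2_L2[OF \<phi>(1)] b2_L2[OF \<psi>(1)]] this]
  have "AE x in lebesgue_on {p<..<q}. b2 ?d x = 0"
    unfolding b2_star_lin_comb[OF h W_integrable[OF \<phi>(1)] W_integrable[OF \<psi>(1)]] by simp
  from b2_star_injective[OF h pq W_integrable[OF W012_lin_comb[OF ab \<phi>(1) \<psi>(1)]] this]
  show ?thesis by (simp add: eq_L2_def)
qed

lemma solution_norm:
  assumes M: "M \<ge> 0" and s: "is_solution {p<..<q} {a<..<b} h e M \<phi>"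
    and ne: "\<nexists>\<psi>. \<psi> \<in> W \<and> eq_L2 {p<..<q} (b2 \<psi>) e"
  shows "W012_norm {a<..<b} \<phi> = M"
proof (rule ccontr)
  assume neq: "W012_norm {a<..<b} \<phi> \<noteq> M"
  have \<phi>: "\<phi> \<in> W" "dirichlet \<phi> \<phi> \<le> M\<^sup>2"
    and min: "\<And>\<eta>. \<eta> \<in> W \<Longrightarrow> dirichlet \<eta> \<eta> \<le> M\<^sup>2 \<Longrightarrow> misfit \<phi> \<le> misfit \<eta>"
    using s by (auto simp: is_solution_iff[OF M])
  have "dirichlet \<phi> \<phi> \<noteq> M\<^sup>2" using neq M by (auto simp: W012_norm_def L2_norm_def)
  then have lt: "M\<^sup>2 - dirichlet \<phi> \<phi> > 0" using \<phi>(2) by simp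
  have "L2_inner {p<..<q} (res \<phi>) (b2 \<psi>) = 0" if "\<psi> \<in> test_functions {a<..<b}" for \<psi>
  proof -
    have \<psi>: "\<psi> \<in> W" by (rule test_function_W012(2)[OF ab that])
    define B where "B = 2 * \<bar>dirichlet \<phi> \<psi>\<bar> + dirichlet \<psi> \<psi>"
    have B: "B \<ge> 0" by (simp add: B_def L2_inner_self_nonneg)
    \<comment> \<open>For \<open>\<bar>s\<bar> \<le> 1\<close> the squared norm grows by at most
      \<open>\<bar>s\<bar> * B\<close>, so the second bound keeps the perturbation inside the slack
      of the constraint. The added 1 covers \<open>B = 0\<close>.\<close>
    define s0 where "s0 = min 1 ((M\<^sup>2 - dirichlet \<phi> \<phi>) / (B + 1))"
    show ?thesis
    proof (rule quadratic_nonneg_near_0[of s0 "L2_inner {p<..<q} (b2 \<psi>) (b2 \<psi>)"])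
      show "s0 > 0" using lt B by (simp add: s0_def)
      fix s :: real assume s: "\<bar>s\<bar> \<le> s0"
      have "2 * s * dirichlet \<phi> \<psi> \<le> \<bar>s\<bar> * (2 * \<bar>dirichlet \<phi> \<psi>\<bar>)"
        using abs_ge_self[of "2 * s * dirichlet \<phi> \<psi>"] by (simp add: abs_mult mult_ac)
      moreover have "s\<^sup>2 * dirichlet \<psi> \<psi> \<le> \<bar>s\<bar> * dirichlet \<psi> \<psi>"
      proof (rule mult_right_mono)
        show "s\<^sup>2 \<le> \<bar>s\<bar>" using s mult_left_le[of "\<bar>s\<bar>" "\<bar>s\<bar>"] by (simp add: s0_def power2_eq_square)
      qed (rule L2_inner_self_nonneg)
      moreover have "\<bar>s\<bar> * B \<le> M\<^sup>2 - dirichlet \<phi> \<phi>"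
      proof -
        have "\<bar>s\<bar> * (B + 1) \<le> M\<^sup>2 - dirichlet \<phi> \<phi>" using s B by (simp add: s0_def pos_le_divide_eq)
        then show ?thesis by (simp add: distrib_left)
      qed
      ultimately have "dirichlet (\<lambda>x. 1 * \<phi> x + s * \<psi> x) (\<lambda>x. 1 * \<phi> x + s * \<psi> x) \<le> M\<^sup>2"
        unfolding dirichlet_lin_comb[OF \<phi>(1) \<psi>] by (simp add: B_def algebra_simps)
      from min[OF W012_lin_comb[OF ab \<phi>(1) \<psi>] this]
      show "0 \<le> 2 * s * L2_inner {p<..<q} (res \<phi>) (b2 \<psi>) + s\<^sup>2 * L2_inner {p<..<q} (b2 \<psi>) (b2 \<psi>)"
        unfolding misfit_perturbation[OF \<phi>(1) \<psi>] by simp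
    qed (rule L2_inner_self_nonneg)
  qed
  \<comment> \<open>The residual is thus zero almost everywhere, so \<open>\<phi>\<close> itself
    attains \<open>e\<close>, against \<open>ne\<close>.\<close>
  from b2_star_dense_range[OF h ab res_L2[OF \<phi>(1)] this]
  have "eq_L2 {p<..<q} (b2 \<phi>) e" by (simp add: eq_L2_def)
  then show False using ne \<phi>(1) by blast
qed

end

text \<open>Functions stand for their classes modulo null sets; hence uniqueness and membership of
  \<open>e\<close> in the range are both expressed by \<open>eq_L2\<close>.\<close>

theorem proposition7:
  fixes S K :: "real set" and h M :: real and e :: "real \<Rightarrow> real \<times> real"
  assumes "is_interval S" "open S" "bounded S" "S \<noteq> {}"
    and "is_interval K" "open K" "bounded K" "K \<noteq> {}"
    and "h > 0"
    and "e \<in> L2 S"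
    and "M \<ge> 0"
  shows "\<exists>\<phi>\<^sub>o. is_solution S K h e M \<phi>\<^sub>o \<and>
           (\<forall>\<phi>. is_solution S K h e M \<phi> \<longrightarrow> eq_L2 K \<phi> \<phi>\<^sub>o) \<and>
           ((\<nexists>\<phi>. \<phi> \<in> W012 K \<and> eq_L2 S (b2_star h K \<phi>) e) \<longrightarrow> W012_norm K \<phi>\<^sub>o = M)"
proof -
  obtain p q where S: "p < q" "S = {p<..<q}" using open_bounded_interval_Ioo[OF assms(1-4)] .
  obtain a b where K: "a < b" "K = {a<..<b}" using open_bounded_interval_Ioo[OF assms(5-8)] .
  have e: "e \<in> L2 {p<..<q}" using assms(10) S by simp
  note ctx = K(1) S(1) assms(9) e
  obtain \<phi> where "is_solution S K h e M \<phi>"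
    using constrained_minimizer_exists[OF ctx assms(11)]
    unfolding S K is_solution_iff[OF ctx assms(11)] by blast
  then show ?thesis
    using solution_unique[OF ctx assms(11)] solution_norm[OF ctx assms(11)] unfolding S K by blast
qed

end
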